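(* Let $n\ge1$ and $v\in\mathbb{C}^*$ not a root of unity. For any $k\in\mathbb{Z}$ and $j\in\mathbb{Z}_{>0}$ the following relations hold for the operators on the semi-infinite wedge spaces $\Lambda^{\infty/2}_{v,\mathtt m}(\mathbb{C}^n[Y^{\pm1}])$, $\mathtt m\in\mathbb{Z}$: $$[B_{-j},\hat\Phi_k]=\hat\Phi_{k-nj},\quad[B_{-j},\hat\Psi_k]=v^{-j}\hat\Psi_{k-nj},\quad[B_{-j},\hat\Phi^*_k]=-\hat\Phi^*_{k-nj},\quad[B_{-j},\hat\Psi^*_k]=-v^{-j}\hat\Psi^*_{k-nj},$$ $$[B_j,\hat\Phi_k]=\hat\Phi_{k+nj},\quad[B_j,\hat\Psi_k]=v^{j(2n-1)}\hat\Psi_{k+nj},\quad[B_j,\hat\Phi^*_k]=-v^{2jn}\hat\Phi^*_{k+nj},\quad[B_j,\hat\Psi^*_k]=-v^{-j}\hat\Psi^*_{k+nj}.$$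
   Context: **Wedges.** $V=\mathbb{C}^n[Y^{\pm1}]$, $\mathbb{C}^n$ with basis $e_0,\dots,e_{n-1}$; $e_{nj+a}=Y^je_a$ ($j\in\mathbb{Z}$, $0\le a<n$). Identify $V^{\otimes N}=(\mathbb{C}^n)^{\otimes N}[Y_1^{\pm1},\dots,Y_N^{\pm1}]$. Hecke generators act by $T_i=s_i^YR_{i,i+1}+(v-v^{-1})\frac{s_i^Y-1}{Y_i/Y_{i+1}-1}$, where $s^Y_i$ swaps only the variables $Y_i,Y_{i+1}$ and $R=v\sum_aE_{aa}\otimes E_{aa}+\sum_{a<b}(E_{ab}\otimes E_{ba}+E_{ba}\otimes E_{ab}+(v-v^{-1})E_{aa}\otimes E_{bb})$ acts on tensor factors $i,i+1$. $[i]^{\pm}_v=\frac{v^{\pm2i}-1}{v^{\pm2}-1}$, $[N]!^-_v=\prod_{i=1}^N[i]_v^-$, $\mathbf{S}_-=\frac1{[N]!^-_v}\sum_{w\in S_N}(-v)^{-\ell(w)}T_w$, $\Lambda^N=\mathbf{S}_-V^{\otimes N}$, $e_{i_1}\wedge\dots\wedge e_{i_N}=\mathbf{S}_-(e_{i_1}\otimes\dots\otimes e_{i_N})$; those with $i_1<\dots<i_N$ form a basis of $\Lambda^N$. For $\mathtt m\in\mathbb{Z}$: $\varphi^{(\mathtt m)}_{N+1,N}:\Lambda^N\to\Lambda^{N+1}$, $w\mapsto w\wedge e_{N-\mathtt m}$; $\varphi^{(\mathtt m)}_{R,N}$ are the composites, $\Lambda^{\infty/2}_{v,\mathtt m}(V)$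 is the inductive limit, $\varphi_N^{(\mathtt m)}$ the canonical map from $\Lambda^N$. **Operators.** $\Phi_k,\Psi_k:\Lambda^N\to\Lambda^{N+1}$, $\Phi_k(w)=e_k\wedge w$, $\Psi_k(w)=w\wedge e_k$. For $w=\sum y_{t_1,\dots,t_N}e_{t_1}\otimes\dots\otimes e_{t_N}\in\Lambda^N\subset V^{\otimes N}$: $\Phi^*_k(w)=\sum y_{-k,t_2,\dots,t_N}e_{t_2}\otimes\dots\otimes e_{t_N}$ and $\Psi_k^*(w)=\sum y_{t_1,\dots,t_{N-1},-k}e_{t_1}\otimes\dots\otimes e_{t_{N-1}}$, both in $\Lambda^{N-1}$. On $\Lambda^N$ (for given $\mathtt m$) put $\tilde\Phi^*_k=[N]_v^+\Phi_k^*$, $\tilde\Psi_k=(-1)^Nv^{\lfloor\frac{N-1-\mathtt m-k}{n}\rfloor-N}\Psi_k$, $\tilde\Psi_k^*=(-1)^{N-1}[N]_v^-v^{N-1-\lfloor\frac{N-1-\mathtt m+k}{n}\rfloor}\Psi^*_k$. The operators $\Phi_k,\tilde\Psi_k$ (resp. $\tilde\Phi^*_k,\tilde\Psi^*_k$) induce $\hat\Phi_k,\hat\Psi_k:\Lambda^{\infty/2}_{v,\mathtt m}\to\Lambda^{\infty/2}_{v,\mathtt m+1}$ (resp. $\hat\Phi_k^*,\hat\Psi_k^*:\Lambda^{\infty/2}_{v,\mathtt m}\to\Lambda^{\infty/2}_{v,\mathtt m-1}$) by $\hat A\,\varphi^{(\mathtt m)}_l(w)=\varphi^{(\mathtt m\pm1)}_{N\pm1}A\,\varphi^{(\mathtt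 m)}_{N,l}(w)$ for all large $N$. For $j\ne0$, $B_j:\Lambda^{\infty/2}_{v,\mathtt m}\to\Lambda^{\infty/2}_{v,\mathtt m}$ is defined by $B_j\,\varphi^{(\mathtt m)}_l(w)=\varphi_N^{(\mathtt m)}\big((Y_1^j+\dots+Y_N^j)\varphi^{(\mathtt m)}_{N,l}(w)\big)$ for all large $N$ (known to be well defined). *)

theory Defs
  imports Complex_Main "HOL-Library.Poly_Mapping" "HOL-Combinatorics.Permutations"
begin

text \<open>
  Throughout, \<open>n\<close> is the dimension of the space with basis \<open>e\<^sub>0, \<dots>, e\<^sub>n\<^sub>-\<^sub>1\<close>, \<open>V\<close> is its space of
  Laurent polynomials in \<open>Y\<close>, with basis vectors \<open>e\<^sub>t\<close> for integers \<open>t\<close>, and \<open>Y e\<^sub>t = e\<^sub>t\<^sub>+\<^sub>n\<close>.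
  A list \<open>[t\<^sub>1, \<dots>, t\<^sub>N]\<close> stands for the pure tensor of \<open>e\<close>'s with these indices, so the
  type below is the direct sum of all tensor powers of \<open>V\<close>.  Tensor factors, the variables \<open>Y\<^sub>i\<close>
  and the Hecke generators are numbered from \<open>0\<close>, following list positions.
\<close>

type_synonym tensor = "int list \<Rightarrow>\<^sub>0 complex"

definition basis :: "int list \<Rightarrow> tensor" where
  "basis t = Poly_Mapping.single t 1"

definition smul :: "complex \<Rightarrow> tensor \<Rightarrow> tensor" where
  "smul c = Poly_Mapping.map ((*) c)"

text \<open>Linear extension of a map given on pure basis tensors.\<close>

definition lin :: "(int list \<Rightarrow> tensor) \<Rightarrow> tensor \<Rightarrow> tensor" where
  "lin f w = (\<Sum>t\<in>Poly_Mapping.keys w. smul (Poly_Mapping.lookup w t) (f t))"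

definition tensor_power :: "nat \<Rightarrow> tensor set" where
  "tensor_power N = {w. \<forall>t\<in>Poly_Mapping.keys w. length t = N}"


subsection \<open>The Hecke algebra action\<close>

text \<open>Multiplication by \<open>Y\<^sub>i\<close> to the power \<open>j\<close>.\<close>

definition Y_pow :: "nat \<Rightarrow> nat \<Rightarrow> int \<Rightarrow> tensor \<Rightarrow> tensor" where
  "Y_pow n i j = lin (\<lambda>t. basis (t[i := t ! i + int n * j]))"

text \<open>
  The index \<open>t = n p + a\<close> with \<open>0 \<le> a < n\<close> has \<open>Y\<close>-degree \<open>p = t div n\<close> and residue \<open>a = t mod n\<close>.
  The swap exchanges the degrees and keeps the residues.
\<close>

definition swap_Y :: "nat \<Rightarrow> nat \<Rightarrow> tensor \<Rightarrow> tensor" where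
  "swap_Y n i = lin (\<lambda>t.
     let p = t ! i div int n; a = t ! i mod int n;
         q = t ! Suc i div int n; b = t ! Suc i mod int n
     in basis (t[i := int n * q + a, Suc i := int n * p + b]))"

text \<open>
  The matrix \<open>R\<close>: \<open>E\<^sub>b\<^sub>a \<otimes> E\<^sub>a\<^sub>b\<close> sends \<open>e\<^sub>a \<otimes> e\<^sub>b\<close> to \<open>e\<^sub>b \<otimes> e\<^sub>a\<close>, and the term with coefficient
  \<open>v - v\<^sup>-\<^sup>1\<close> only sees \<open>e\<^sub>a \<otimes> e\<^sub>b\<close> with \<open>a < b\<close>.
\<close>

definition R_mat :: "nat \<Rightarrow> complex \<Rightarrow> nat \<Rightarrow> tensor \<Rightarrow> tensor" where
  "R_mat n v i = lin (\<lambda>t.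
     let p = t ! i div int n; a = t ! i mod int n;
         q = t ! Suc i div int n; b = t ! Suc i mod int n
     in if a = b then smul v (basis t)
        else basis (t[i := int n * p + b, Suc i := int n * q + a])
             + (if a < b then smul (v - inverse v) (basis t) else 0))"

text \<open>
  The operator \<open>(s - 1) / (Y\<^sub>i / Y\<^sub>i\<^sub>+\<^sub>1 - 1)\<close>, with \<open>s\<close> the swap of the two variables.  With
  \<open>z = Y\<^sub>i / Y\<^sub>i\<^sub>+\<^sub>1\<close> it multiplies a monomial of degrees \<open>(p, q)\<close> in \<open>Y\<^sub>i, Y\<^sub>i\<^sub>+\<^sub>1\<close> by
  \<open>(z\<^sup>q\<^sup>-\<^sup>p - 1) / (z - 1)\<close>, a geometric sum; see \<open>div_diff_eq\<close> below.
\<close>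

definition div_diff :: "nat \<Rightarrow> nat \<Rightarrow> tensor \<Rightarrow> tensor" where
  "div_diff n i = lin (\<lambda>t.
     let p = t ! i div int n; a = t ! i mod int n;
         q = t ! Suc i div int n; b = t ! Suc i mod int n;
         E = (\<lambda>l. basis (t[i := int n * l + a, Suc i := int n * (p + q - l) + b]))
     in (\<Sum>l\<in>{p..<q}. E l) - (\<Sum>l\<in>{q..<p}. E l))"

definition hecke :: "nat \<Rightarrow> complex \<Rightarrow> nat \<Rightarrow> tensor \<Rightarrow> tensor" where
  "hecke n v i w = swap_Y n i (R_mat n v i w) + smul (v - inverse v) (div_diff n i w)"

definition hecke_word :: "nat \<Rightarrow> complex \<Rightarrow> nat list \<Rightarrow> tensor \<Rightarrow> tensor" where
  "hecke_word n v is w = foldr (hecke n v) is w"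

definition word_perm :: "nat list \<Rightarrow> nat \<Rightarrow> nat" where
  "word_perm is = foldr (\<lambda>i \<sigma>. transpose i (Suc i) \<circ> \<sigma>) is id"

text \<open>
  A reduced word of a permutation of \<open>{..<N}\<close>; its number of letters is the Coxeter length.
  The operator of a permutation does not depend on the chosen word, by the braid relations.
\<close>

definition reduced_word :: "nat \<Rightarrow> (nat \<Rightarrow> nat) \<Rightarrow> nat list" where
  "reduced_word N \<sigma> = arg_min length (\<lambda>is. (\<forall>i\<in>set is. Suc i < N) \<and> word_perm is = \<sigma>)"

definition perm_length :: "nat \<Rightarrow> (nat \<Rightarrow> nat) \<Rightarrow> nat" where
  "perm_length N \<sigma> = length (reduced_word N \<sigma>)"

definition hecke_perm :: "nat \<Rightarrow> complex \<Rightarrow> nat \<Rightarrow> (nat \<Rightarrow> nat) \<Rightarrow> tensor \<Rightarrow> tensor" where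
  "hecke_perm n v N \<sigma> = hecke_word n v (reduced_word N \<sigma>)"


subsection \<open>Finite wedges\<close>

definition qint_plus :: "complex \<Rightarrow> nat \<Rightarrow> complex" where
  "qint_plus v i = (v powi (2 * int i) - 1) / (v powi 2 - 1)"

definition qint_minus :: "complex \<Rightarrow> nat \<Rightarrow> complex" where
  "qint_minus v i = (v powi (- 2 * int i) - 1) / (v powi (- 2) - 1)"

definition qfact_minus :: "complex \<Rightarrow> nat \<Rightarrow> complex" where
  "qfact_minus v N = (\<Prod>i=1..N. qint_minus v i)"

definition antisym :: "nat \<Rightarrow> complex \<Rightarrow> nat \<Rightarrow> tensor \<Rightarrow> tensor" where
  "antisym n v N w = smul (1 / qfact_minus v N)
     (\<Sum>\<sigma> | \<sigma> permutes {..<N}. smul ((- v) powi (- int (perm_length N \<sigma>))) (hecke_perm n v N \<sigma> w))"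

definition wedge_space :: "nat \<Rightarrow> complex \<Rightarrow> nat \<Rightarrow> tensor set" where
  "wedge_space n v N = antisym n v N ` tensor_power N"

text \<open>
  \<open>e\<^sub>k \<and> w\<close> and \<open>w \<and> e\<^sub>k\<close> for \<open>w\<close> in the \<open>N\<close>-th wedge space.
\<close>

definition Phi :: "nat \<Rightarrow> complex \<Rightarrow> nat \<Rightarrow> int \<Rightarrow> tensor \<Rightarrow> tensor" where
  "Phi n v N k w = antisym n v (Suc N) (lin (\<lambda>t. basis (k # t)) w)"

definition Psi :: "nat \<Rightarrow> complex \<Rightarrow> nat \<Rightarrow> int \<Rightarrow> tensor \<Rightarrow> tensor" where
  "Psi n v N k w = antisym n v (Suc N) (lin (\<lambda>t. basis (t @ [k])) w)"

definition Phi_star :: "int \<Rightarrow> tensor \<Rightarrow> tensor" where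
  "Phi_star k = lin (\<lambda>t. if t \<noteq> [] \<and> hd t = - k then basis (tl t) else 0)"

definition Psi_star :: "int \<Rightarrow> tensor \<Rightarrow> tensor" where
  "Psi_star k = lin (\<lambda>t. if t \<noteq> [] \<and> last t = - k then basis (butlast t) else 0)"

text \<open>
  Renormalised versions on the \<open>N\<close>-th wedge space, for charge \<open>m\<close>.  On integers \<open>div\<close> is the
  floor of the quotient.
\<close>

definition Phi_star_norm :: "complex \<Rightarrow> nat \<Rightarrow> int \<Rightarrow> tensor \<Rightarrow> tensor" where
  "Phi_star_norm v N k w = smul (qint_plus v N) (Phi_star k w)"

definition Psi_norm :: "nat \<Rightarrow> complex \<Rightarrow> int \<Rightarrow> nat \<Rightarrow> int \<Rightarrow> tensor \<Rightarrow> tensor" where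
  "Psi_norm n v m N k w =
     smul ((- 1) ^ N * v powi ((int N - 1 - m - k) div int n - int N)) (Psi n v N k w)"

definition Psi_star_norm :: "nat \<Rightarrow> complex \<Rightarrow> int \<Rightarrow> nat \<Rightarrow> int \<Rightarrow> tensor \<Rightarrow> tensor" where
  "Psi_star_norm n v m N k w =
     smul ((- 1) powi (int N - 1) * qint_minus v N * v powi (int N - 1 - (int N - 1 - m + k) div int n))
       (Psi_star k w)"

definition power_sum :: "nat \<Rightarrow> nat \<Rightarrow> int \<Rightarrow> tensor \<Rightarrow> tensor" where
  "power_sum n N j w = (\<Sum>i<N. Y_pow n i j w)"


subsection \<open>Semi-infinite wedges\<close>

text \<open>The transition map from level \<open>N\<close> to level \<open>M \<ge> N\<close> (the identity for \<open>M \<le> N\<close>).\<close>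

definition transition :: "nat \<Rightarrow> complex \<Rightarrow> int \<Rightarrow> nat \<Rightarrow> nat \<Rightarrow> tensor \<Rightarrow> tensor" where
  "transition n v m M N w = fold (\<lambda>L. Psi n v L (int L - m)) [N..<M] w"

text \<open>
  The inductive limit is the quotient of the disjoint union of the wedge spaces that identifies
  two elements when they agree at some higher level.
\<close>

definition limit_rel :: "nat \<Rightarrow> complex \<Rightarrow> int \<Rightarrow> ((nat \<times> tensor) \<times> (nat \<times> tensor)) set" where
  "limit_rel n v m = {((N, w), (M, u)). w \<in> wedge_space n v N \<and> u \<in> wedge_space n v M \<and>
     (\<exists>R\<ge>max N M. transition n v m R N w = transition n v m R M u)}"

type_synonym semi_wedge = "(nat \<times> tensor) set"

definition semi_space :: "nat \<Rightarrow> complex \<Rightarrow> int \<Rightarrow> semi_wedge set" where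
  "semi_space n v m = (SIGMA N:UNIV. wedge_space n v N) // limit_rel n v m"

definition canon :: "nat \<Rightarrow> complex \<Rightarrow> int \<Rightarrow> nat \<Rightarrow> tensor \<Rightarrow> semi_wedge" where
  "canon n v m N w = limit_rel n v m `` {(N, w)}"

text \<open>The linear structure of the limit, via representatives brought to a common level.\<close>

definition semi_scale :: "nat \<Rightarrow> complex \<Rightarrow> int \<Rightarrow> complex \<Rightarrow> semi_wedge \<Rightarrow> semi_wedge" where
  "semi_scale n v m c X = (\<Union>(N, w)\<in>X. canon n v m N (smul c w))"

definition semi_diff :: "nat \<Rightarrow> complex \<Rightarrow> int \<Rightarrow> semi_wedge \<Rightarrow> semi_wedge \<Rightarrow> semi_wedge" where
  "semi_diff n v m X Z = (\<Union>(N, w)\<in>X. \<Union>(M, u)\<in>Z.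
     canon n v m (max N M) (transition n v m (max N M) N w - transition n v m (max N M) M u))"

text \<open>
  The operator from charge \<open>m\<close> to charge \<open>m + d\<close> induced by operators \<open>A m N\<close> from
  the \<open>N\<close>-th to the \<open>(N + d)\<close>-th wedge space: the image of the class of \<open>(l, w)\<close> is, for every
  representative, the eventual value of the class of \<open>A m N (\<phi>\<^sub>N\<^sub>,\<^sub>l w)\<close>.
\<close>

definition induced :: "nat \<Rightarrow> complex \<Rightarrow> int \<Rightarrow> (int \<Rightarrow> nat \<Rightarrow> tensor \<Rightarrow> tensor) \<Rightarrow>
    int \<Rightarrow> semi_wedge \<Rightarrow> semi_wedge" where
  "induced n v d A m X = (THE Z. \<forall>(l, w)\<in>X. \<forall>\<^sub>F N in sequentially.
     Z = canon n v (m + d) (nat (int N + d)) (A m N (transition n v m N l w)))"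

definition hat_Phi :: "nat \<Rightarrow> complex \<Rightarrow> int \<Rightarrow> int \<Rightarrow> semi_wedge \<Rightarrow> semi_wedge" where
  "hat_Phi n v k = induced n v 1 (\<lambda>m N. Phi n v N k)"

definition hat_Psi :: "nat \<Rightarrow> complex \<Rightarrow> int \<Rightarrow> int \<Rightarrow> semi_wedge \<Rightarrow> semi_wedge" where
  "hat_Psi n v k = induced n v 1 (\<lambda>m N. Psi_norm n v m N k)"

definition hat_Phi_star :: "nat \<Rightarrow> complex \<Rightarrow> int \<Rightarrow> int \<Rightarrow> semi_wedge \<Rightarrow> semi_wedge" where
  "hat_Phi_star n v k = induced n v (- 1) (\<lambda>m N. Phi_star_norm v N k)"

definition hat_Psi_star :: "nat \<Rightarrow> complex \<Rightarrow> int \<Rightarrow> int \<Rightarrow> semi_wedge \<Rightarrow> semi_wedge" where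
  "hat_Psi_star n v k = induced n v (- 1) (\<lambda>m N. Psi_star_norm n v m N k)"

definition boson :: "nat \<Rightarrow> complex \<Rightarrow> int \<Rightarrow> int \<Rightarrow> semi_wedge \<Rightarrow> semi_wedge" where
  "boson n v j = induced n v 0 (\<lambda>m N. power_sum n N j)"

text \<open>
  \<open>[B, A]\<close> on the space of charge \<open>m\<close>, where the family \<open>B\<close> preserves the charge and the family \<open>A\<close>
  raises it by \<open>d\<close>.
\<close>

definition commutator :: "nat \<Rightarrow> complex \<Rightarrow> int \<Rightarrow> (int \<Rightarrow> semi_wedge \<Rightarrow> semi_wedge) \<Rightarrow>
    (int \<Rightarrow> semi_wedge \<Rightarrow> semi_wedge) \<Rightarrow> int \<Rightarrow> semi_wedge \<Rightarrow> semi_wedge" where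
  "commutator n v d B A m X = semi_diff n v (m + d) (B (m + d) (A m X)) (A m (B m X))"


subsection \<open>The divided difference is a quotient\<close>

lemma lookup_smul [simp]: "Poly_Mapping.lookup (smul c w) t = c * Poly_Mapping.lookup w t"
  by (simp add: smul_def map.rep_eq when_def)

lemma lin_superset:
  assumes "finite S" "Poly_Mapping.keys w \<subseteq> S"
  shows "lin f w = (\<Sum>t\<in>S. smul (Poly_Mapping.lookup w t) (f t))"
  unfolding lin_def using assms
  by (intro sum.mono_neutral_left) (auto simp: in_keys_iff intro!: poly_mapping_eqI)

lemma lin_add: "lin f (w + u) = lin f w + lin f u"
proof -
  let ?S = "Poly_Mapping.keys w \<union> Poly_Mapping.keys u"
  have "lin f (w + u) = (\<Sum>t\<in>?S. smul (Poly_Mapping.lookup (w + u) t) (f t))"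
    by (intro lin_superset) (auto simp: Poly_Mapping.keys_add)
  also have "\<dots> = (\<Sum>t\<in>?S. smul (Poly_Mapping.lookup w t) (f t) + smul (Poly_Mapping.lookup u t) (f t))"
    by (intro sum.cong refl poly_mapping_eqI) (simp add: lookup_add algebra_simps)
  also have "\<dots> = lin f w + lin f u"
    by (simp add: sum.distrib lin_superset[of ?S])
  finally show ?thesis .
qed

lemma lin_zero [simp]: "lin f 0 = 0"
  by (simp add: lin_def)

lemma lin_smul: "lin f (smul c w) = smul c (lin f w)"
proof -
  have "lin f (smul c w) = (\<Sum>t\<in>Poly_Mapping.keys w. smul (c * Poly_Mapping.lookup w t) (f t))"
    by (subst lin_superset[of "Poly_Mapping.keys w"]) (auto simp: in_keys_iff)
  also have "\<dots> = smul c (lin f w)"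
    by (rule poly_mapping_eqI) (simp add: lin_def lookup_sum sum_distrib_left algebra_simps)
  finally show ?thesis .
qed

lemma lin_diff: "lin f (w - u) = lin f w - lin f u"
  using lin_add[of f "w - u" u] by (simp add: algebra_simps)

lemma lin_sum: "lin f (\<Sum>i\<in>I. w i) = (\<Sum>i\<in>I. lin f (w i))"
  by (induction I rule: infinite_finite_induct) (auto simp: lin_add)

lemma lin_basis [simp]: "lin f (basis t) = f t"
  by (simp add: lin_def basis_def) (rule poly_mapping_eqI, simp)

lemma lin_lin: "lin g (lin f w) = lin (\<lambda>t. lin g (f t)) w"
  by (simp add: lin_def[of f] lin_sum lin_smul) (simp add: lin_def)

lemma div_diff_basis:
  assumes "Suc i < length t"
  shows "Y_pow n i 1 (Y_pow n (Suc i) (- 1) (div_diff n i (basis t))) - div_diff n i (basis t)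
           = swap_Y n i (basis t) - basis t"
proof -
  define p a q b where "p = t ! i div int n" and "a = t ! i mod int n"
    and "q = t ! Suc i div int n" and "b = t ! Suc i mod int n"
  define E where "E l = basis (t[i := int n * l + a, Suc i := int n * (p + q - l) + b])" for l
  have D: "div_diff n i (basis t) = sum E {p..<q} - sum E {q..<p}"
    by (simp add: div_diff_def Let_def p_def a_def q_def b_def E_def)
  have Y: "Y_pow n i 1 (Y_pow n (Suc i) (- 1) (E l)) = E (l + 1)" for l
    using assms
    by (simp add: Y_pow_def E_def nth_list_update list_update_swap[of i "Suc i"] algebra_simps)
  have S: "swap_Y n i (basis t) = E q"
    by (simp add: swap_Y_def Let_def p_def a_def q_def b_def E_def)
  have B: "basis t = E p"
    by (simp add: E_def p_def a_def q_def b_def)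
  have tele: "(\<Sum>l\<in>{x..<y}. E (l + 1)) - sum E {x..<y} = E y - E x" if "x \<le> y" for x y :: int
    using that
  proof (induction y rule: int_ge_induct)
    case (step y)
    have "{x..<y + 1} = insert y {x..<y}" using step by auto
    then show ?case using step by (simp add: algebra_simps)
  qed simp
  have shift: "Y_pow n i 1 (Y_pow n (Suc i) (- 1) (div_diff n i (basis t)))
          = (\<Sum>l\<in>{p..<q}. E (l + 1)) - (\<Sum>l\<in>{q..<p}. E (l + 1))"
    unfolding D using Y by (simp add: Y_pow_def lin_diff lin_sum)
  have "(\<Sum>l\<in>{p..<q}. E (l + 1)) - (\<Sum>l\<in>{q..<p}. E (l + 1))
          - (sum E {p..<q} - sum E {q..<p}) = E q - E p"
    using tele[of p q] tele[of q p] by (cases "p \<le> q") (auto simp: algebra_simps)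
  then show ?thesis
    by (simp only: shift) (simp only: D S, simp only: B)
qed

text \<open>\<open>(Y\<^sub>i / Y\<^sub>i\<^sub>+\<^sub>1 - 1) div_diff = s - 1\<close>.\<close>

lemma div_diff_eq:
  assumes "w \<in> tensor_power N" "Suc i < N"
  shows "Y_pow n i 1 (Y_pow n (Suc i) (- 1) (div_diff n i w)) - div_diff n i w = swap_Y n i w - w"
proof -
  define F where "F u = Y_pow n i 1 (Y_pow n (Suc i) (- 1) (div_diff n i u)) - div_diff n i u
    - (swap_Y n i u - u)" for u
  have sm: "smul c (x - y) = smul c x - smul c y" for c x y
    by (rule poly_mapping_eqI) (simp add: lookup_minus algebra_simps)
  have F_sum: "F (\<Sum>t\<in>S. u t) = (\<Sum>t\<in>S. F (u t))" for S u
    by (simp add: F_def Y_pow_def div_diff_def swap_Y_def lin_sum sum_subtractf)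
  have F_smul: "F (smul c u) = smul c (F u)" for c u
    by (simp add: F_def Y_pow_def div_diff_def swap_Y_def lin_smul sm)
  have w: "w = (\<Sum>t\<in>Poly_Mapping.keys w. smul (Poly_Mapping.lookup w t) (basis t))"
    by (rule poly_mapping_eqI)
      (simp add: lookup_sum basis_def lookup_single when_def in_keys_iff if_distrib sum.delta
        cong: if_cong)
  have "F (basis t) = 0" if "t \<in> Poly_Mapping.keys w" for t
    using div_diff_basis[of i t n] assms that by (simp add: F_def tensor_power_def)
  then have "F w = 0"
    by (subst w) (auto simp: F_sum F_smul lookup_sum intro!: sum.neutral poly_mapping_eqI)
  then show ?thesis by (simp add: F_def)
qed

end

theory Submission
  imports Defs
begin

text \<open>
  At a finite level each of the four families \<open>A\<^sub>k\<close> commutes with the power sums up to a multiple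
  of \<open>A\<^sub>k\<^sub>'\<close>, \<open>k' = k \<plusminus> nj\<close>.  For \<open>B\<^sub>-\<^sub>j\<close> this passes to the limit at once, because a lowered vector of
  the tail of the vacuum meets its own copy further left.  For \<open>B\<^sub>j\<close> the power sum does not commute
  with the transition maps: the discrepancy is the power sum of the last \<open>nj\<close> tail vectors.  Apply
  \<open>A\<^sub>k\<close> to this boundary term and wedge with the next \<open>nj\<close> tail vectors; by degree reasons everything
  straightens to one and the same wedge, so the result is \<open>c A\<^sub>k\<^sub>'\<close> with a constant \<open>c\<close> that does not
  depend on the argument of \<open>A\<^sub>k\<close>.  Evaluation on wedges of consecutive vectors gives \<open>c\<close>, and
  \<open>c\<close> is what distinguishes the constants for \<open>B\<^sub>j\<close> from those for \<open>B\<^sub>-\<^sub>j\<close>.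

  For the two families of removal operators both the eventual compatibility with the transition maps
  and the boundary term come from an expansion of \<open>A\<^sub>k (u \<and> e\<^sub>x)\<close> into terms \<open>A\<^sub>k\<^sub>-\<^sub>d u \<and> e\<^sub>x\<^sub>-\<^sub>d\<close>.
\<close>

subsection \<open>Linear operators on tensors\<close>

text \<open>The obstacle is that straightening \<open>R \<kappa>\<close> of a boundary term, or an
  insertion into it, produces far too many terms to follow. Straightening however preserves the sum
  of the indices and any interval containing them, and next to a long run of consecutive vectors
  only one increasing list has the required sum. The answer is therefore known up to a scalar before
  anything is computed. The scalar is read off from a test vector whose power sum is easy: in a run,
  or a run with one vector missing, nearly every raised vector collides with another one, and the
  survivor fills the gap at the cost of exchanging it with nj - 1 neighbours. In each of the three
  families with a boundary term, part of the boundary constant cancels the finite-level coefficient,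
  so that up to sign a single power of v is left. The first coordinate of a wedge is harder than the
  last one, because its coset expansion contains a chain of all generators. The affine relation for
  Y relates that chain to the chain of inverse generators, so the chain can be eliminated between
  the two expansions; hence both T and its inverse are treated as Hecke actions.\<close>

global_interpretation tm: vector_space smul
  by unfold_locales (auto intro!: poly_mapping_eqI simp: lookup_add algebra_simps)

definition linop :: "(tensor \<Rightarrow> tensor) \<Rightarrow> bool" where
  "linop f \<longleftrightarrow> (\<forall>x y. f (x + y) = f x + f y) \<and> (\<forall>c x. f (smul c x) = smul c (f x))"

lemma linop_add: "linop f \<Longrightarrow> f (x + y) = f x + f y"
  and linop_smul: "linop f \<Longrightarrow> f (smul c x) = smul c (f x)"
  by (auto simp: linop_def)

lemma linop_zero: "linop f \<Longrightarrow> f 0 = 0"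
  using linop_smul[of f 0 0] by simp

lemma linop_minus: "linop f \<Longrightarrow> f (- x) = - f x"
  using linop_smul[of f "-1" x] by simp

lemma linop_diff: "linop f \<Longrightarrow> f (x - y) = f x - f y"
  using linop_add[of f x "- y"] by (simp add: linop_minus)

lemma linop_sum: "linop f \<Longrightarrow> f (\<Sum>i\<in>I. w i) = (\<Sum>i\<in>I. f (w i))"
  by (induction I rule: infinite_finite_induct) (auto simp: linop_add linop_zero)

lemmas linop_simps = linop_add linop_smul linop_zero linop_minus linop_diff linop_sum

named_theorems linop_intros

lemma linop_lin [linop_intros]: "linop (lin f)"
  by (simp add: linop_def lin_add lin_smul)

lemma linop_id [linop_intros]: "linop (\<lambda>x. x)"
  by (simp add: linop_def)

lemma linop_0 [linop_intros]: "linop (\<lambda>x. 0)"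
  by (simp add: linop_def)

lemma linop_comp: "linop f \<Longrightarrow> linop g \<Longrightarrow> linop (\<lambda>x. f (g x))"
  by (simp add: linop_def)

lemma linop_scaled [linop_intros]: "linop f \<Longrightarrow> linop (\<lambda>x. smul c (f x))"
  by (simp add: linop_def tm.scale_right_distrib mult.commute)

lemma linop_plus [linop_intros]: "linop f \<Longrightarrow> linop g \<Longrightarrow> linop (\<lambda>x. f x + g x)"
  by (simp add: linop_def tm.scale_right_distrib algebra_simps)

lemma linop_subtract [linop_intros]: "linop f \<Longrightarrow> linop g \<Longrightarrow> linop (\<lambda>x. f x - g x)"
  by (simp add: linop_def tm.scale_right_diff_distrib algebra_simps)

lemma linop_setsum [linop_intros]: "(\<And>i. i \<in> I \<Longrightarrow> linop (f i)) \<Longrightarrow> linop (\<lambda>x. \<Sum>i\<in>I. f i x)"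
  by (simp add: linop_def sum.distrib tm.scale_sum_right)

lemma basis_expansion: "w = (\<Sum>t\<in>Poly_Mapping.keys w. smul (Poly_Mapping.lookup w t) (basis t))"
  by (rule poly_mapping_eqI)
    (simp add: lookup_sum basis_def lookup_single when_def in_keys_iff if_distrib sum.delta
      cong: if_cong)

lemma keys_basis [simp]: "Poly_Mapping.keys (basis t) = {t}"
  by (simp add: basis_def)

lemma basis_nonzero: "basis t \<noteq> 0"
  using keys_basis[of t] by force

text \<open>Carries side conditions on basis tensors, such as their length or the range of their
  indices, through linear maps; \<open>linop_eqI\<close> then compares two maps only on basis
  tensors that satisfy them.\<close>

definition supp :: "(int list \<Rightarrow> bool) \<Rightarrow> tensor \<Rightarrow> bool" where
  "supp P w \<longleftrightarrow> (\<forall>t\<in>Poly_Mapping.keys w. P t)"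

lemma supp_iff: "supp P w \<longleftrightarrow> (\<forall>t. P t \<or> Poly_Mapping.lookup w t = 0)"
  by (auto simp: supp_def in_keys_iff)

lemma supp_basis [simp]: "supp P (basis t) \<longleftrightarrow> P t"
  by (simp add: supp_def)

lemma supp_zero [simp]: "supp P 0"
  by (simp add: supp_def)

lemma supp_add: "supp P x \<Longrightarrow> supp P y \<Longrightarrow> supp P (x + y)"
  by (force simp: supp_iff lookup_add)

lemma supp_diff: "supp P x \<Longrightarrow> supp P y \<Longrightarrow> supp P (x - y)"
  by (force simp: supp_iff lookup_minus)

lemma supp_smul: "supp P x \<Longrightarrow> supp P (smul c x)"
  by (force simp: supp_iff)

lemma supp_sum: "(\<And>i. i \<in> I \<Longrightarrow> supp P (f i)) \<Longrightarrow> supp P (\<Sum>i\<in>I. f i)"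
  by (induction I rule: infinite_finite_induct) (auto simp: supp_add)

lemma supp_mono: "supp P x \<Longrightarrow> (\<And>t. P t \<Longrightarrow> Q t) \<Longrightarrow> supp Q x"
  by (auto simp: supp_def)

lemmas supp_intros = supp_add supp_diff supp_smul supp_sum

lemma supp_linop:
  assumes "linop f" "supp P w" "\<And>t. P t \<Longrightarrow> supp Q (f (basis t))"
  shows "supp Q (f w)"
  by (subst basis_expansion[of w])
    (use assms in \<open>auto simp: linop_simps supp_def[of P] intro!: supp_intros\<close>)

lemma linop_eqI:
  assumes "linop f" "linop g" "supp P w" "\<And>t. P t \<Longrightarrow> f (basis t) = g (basis t)"
  shows "f w = g w"
proof -
  have "f w = (\<Sum>t\<in>Poly_Mapping.keys w. smul (Poly_Mapping.lookup w t) (f (basis t)))"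
    by (subst basis_expansion[of w]) (simp add: linop_simps[OF assms(1)])
  also have "\<dots> = (\<Sum>t\<in>Poly_Mapping.keys w. smul (Poly_Mapping.lookup w t) (g (basis t)))"
    using assms(3,4) by (auto simp: supp_def)
  also have "\<dots> = g w"
    by (subst (3) basis_expansion[of w]) (simp add: linop_simps[OF assms(2)])
  finally show ?thesis .
qed

lemma linop_eqI': "linop f \<Longrightarrow> linop g \<Longrightarrow> (\<And>t. f (basis t) = g (basis t)) \<Longrightarrow> f w = g w"
  by (rule linop_eqI[where P = "\<lambda>_. True"]) (auto simp: supp_def)

lemma tensor_power_supp: "w \<in> tensor_power N \<longleftrightarrow> supp (\<lambda>t. length t = N) w"
  by (simp add: tensor_power_def supp_def)

definition tens :: "tensor \<Rightarrow> tensor \<Rightarrow> tensor" where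
  "tens u w = lin (\<lambda>s. lin (\<lambda>t. basis (s @ t)) w) u"

lemma tens_basis [simp]: "tens (basis s) (basis t) = basis (s @ t)"
  by (simp add: tens_def)

lemma linop_tens_left': "linop (\<lambda>u. tens u w)"
  unfolding tens_def by (rule linop_lin)

lemma linop_tens_right': "linop (tens u)"
  unfolding linop_def tens_def
  by (auto simp: lin_add lin_smul lin_def[of _ u] tm.scale_right_distrib sum.distrib
      tm.scale_sum_right mult.commute)

lemmas linop_tens_left [linop_intros] = linop_comp[OF linop_tens_left']
lemmas linop_tens_right [linop_intros] = linop_comp[OF linop_tens_right']
lemmas tens_simps = linop_simps[OF linop_tens_left'] linop_simps[OF linop_tens_right']

lemma tens_assoc: "tens (tens u w) z = tens u (tens w z)"
proof (rule linop_eqI'[where w = u and f = "\<lambda>u. tens (tens u w) z"])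
  show "tens (tens (basis t) w) z = tens (basis t) (tens w z)" for t
  proof (rule linop_eqI'[where w = w and f = "\<lambda>w. tens (tens (basis t) w) z"])
    show "tens (tens (basis t) (basis s)) z = tens (basis t) (tens (basis s) z)" for s
      by (rule linop_eqI'[where w = z]) (auto intro!: linop_intros)
  qed (auto intro!: linop_intros)
qed (auto intro!: linop_intros)

lemma tens_Nil_left [simp]: "tens (basis []) w = w"
  by (rule linop_eqI'[where w = w]) (auto intro!: linop_intros)

lemma tens_Nil_right [simp]: "tens w (basis []) = w"
  by (rule linop_eqI'[where w = w]) (auto intro!: linop_intros)

lemma supp_tens:
  assumes "supp P u" "supp Q w" "\<And>s t. P s \<Longrightarrow> Q t \<Longrightarrow> R (s @ t)"
  shows "supp R (tens u w)"
proof (rule supp_linop[OF linop_tens_left' assms(1)])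
  fix s assume "P s"
  then show "supp R (tens (basis s) w)"
    by (intro supp_linop[OF linop_tens_right' assms(2)]) (simp add: assms(3))
qed

lemma tens_power: "u \<in> tensor_power N \<Longrightarrow> w \<in> tensor_power M \<Longrightarrow> tens u w \<in> tensor_power (N + M)"
  unfolding tensor_power_supp by (erule (1) supp_tens) auto

lemma tensor_power_intros:
  "0 \<in> tensor_power N"
  "x \<in> tensor_power N \<Longrightarrow> y \<in> tensor_power N \<Longrightarrow> x + y \<in> tensor_power N"
  "x \<in> tensor_power N \<Longrightarrow> y \<in> tensor_power N \<Longrightarrow> x - y \<in> tensor_power N"
  "x \<in> tensor_power N \<Longrightarrow> smul c x \<in> tensor_power N"
  "(\<And>i. i \<in> I \<Longrightarrow> f i \<in> tensor_power N) \<Longrightarrow> (\<Sum>i\<in>I. f i) \<in> tensor_power N"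
  "length t = N \<Longrightarrow> basis t \<in> tensor_power N"
  by (auto simp: tensor_power_supp supp_intros)

subsection \<open>The Hecke operators on basis tensors\<close>

locale wedge_setup =
  fixes n :: nat and v :: complex
  assumes n_pos: "n \<ge> 1" and v_nonzero [simp]: "v \<noteq> 0"
    and not_root: "\<forall>r::nat. r > 0 \<longrightarrow> v ^ r \<noteq> 1"
begin

abbreviation h :: complex where "h \<equiv> v - inverse v"
abbreviation T :: "nat \<Rightarrow> tensor \<Rightarrow> tensor" where "T \<equiv> hecke n v"
abbreviation Y :: "nat \<Rightarrow> tensor \<Rightarrow> tensor" where "Y i \<equiv> Y_pow n i 1"

lemma linop_hecke: "linop (T i)"
proof -
  have "linop (\<lambda>w. swap_Y n i (R_mat n v i w))"
    unfolding swap_Y_def R_mat_def by (rule linop_comp) (rule linop_lin)+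
  moreover have "linop (\<lambda>w. smul h (div_diff n i w))"
    unfolding div_diff_def by (intro linop_intros)
  ultimately show ?thesis
    unfolding hecke_def[abs_def] by (rule linop_plus)
qed

lemmas T_simps = linop_simps[OF linop_hecke]
lemmas linop_T [linop_intros] = linop_comp[OF linop_hecke]

lemma linop_Y_pow: "linop (Y_pow n i j)"
  unfolding Y_pow_def by (rule linop_lin)

lemmas Y_simps = linop_simps[OF linop_Y_pow]
lemmas linop_Y [linop_intros] = linop_comp[OF linop_Y_pow]

lemma Y_basis: "Y_pow n i j (basis t) = basis (t[i := t ! i + int n * j])"
  by (simp add: Y_pow_def)

lemma div_deg [simp]: "0 \<le> a \<Longrightarrow> a < int n \<Longrightarrow> (int n * p + a) div int n = p"
  and mod_deg [simp]: "0 \<le> a \<Longrightarrow> a < int n \<Longrightarrow> (int n * p + a) mod int n = a"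
  using n_pos by (auto simp: algebra_simps)

lemma hecke_basis:
  assumes "length ps = i" and ab: "0 \<le> a" "a < int n" "0 \<le> b" "b < int n"
  shows "T i (basis (ps @ [int n * p + a, int n * q + b] @ qs)) =
    (if a = b then smul v (basis (ps @ [int n * q + b, int n * p + a] @ qs))
     else basis (ps @ [int n * q + b, int n * p + a] @ qs)
       + (if a < b then smul h (basis (ps @ [int n * q + a, int n * p + b] @ qs)) else 0))
    + smul h ((\<Sum>l\<in>{p..<q}. basis (ps @ [int n * l + a, int n * (p + q - l) + b] @ qs))
            - (\<Sum>l\<in>{q..<p}. basis (ps @ [int n * l + a, int n * (p + q - l) + b] @ qs)))"
  using assms(1)[symmetric] ab
  by (simp add: hecke_def R_mat_def swap_Y_def div_diff_def Let_def nth_append list_update_append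
      lin_add lin_smul)

lemma degree_cases:
  obtains p a where "x = int n * p + a" "0 \<le> a" "a < int n"
proof
  show "x = int n * (x div int n) + x mod int n" by simp
  show "0 \<le> x mod int n" "x mod int n < int n" using n_pos by simp_all
qed

lemma int_mult_less_iff:
  assumes "0 \<le> a" "a < int n" "0 \<le> b" "b < int n"
  shows "int n * p + a < int n * q + b \<longleftrightarrow> p < q \<or> p = q \<and> a < b"
proof -
  have n: "int n > 0" using n_pos by simp
  consider "p < q" | "p = q" | "q < p" by linarith
  then show ?thesis
  proof cases
    case 1
    then have "int n * (p + 1) \<le> int n * q" using n by (intro mult_left_mono) auto
    with 1 assms show ?thesis by (simp add: algebra_simps)
  next
    case 3
    then have "int n * (q + 1) \<le> int n * p" using n by (intro mult_left_mono) auto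
    with 3 assms show ?thesis by (simp add: algebra_simps)
  qed auto
qed

lemma mod_eq_residue:
  assumes "0 \<le> a" "a < int n" "0 \<le> b" "b < int n"
  shows "(int n * p + a) mod int n = (int n * q + b) mod int n \<longleftrightarrow> a = b"
  using assms by simp

text \<open>With \<open>t\<close> and \<open>x\<close> in place of degrees and residues, the \<open>R\<close>-matrix term is absorbed as an
  endpoint of the geometric sum.\<close>

lemma hecke_less:
  assumes "length ps = i" "t < x"
  shows "T i (basis (ps @ [t, x] @ qs)) =
    smul (if t mod int n = x mod int n then v else 1) (basis (ps @ [x, t] @ qs))
    + smul h (\<Sum>s\<in>{s. 0 \<le> s \<and> t + int n * s < x}. basis (ps @ [t + int n * s, x - int n * s] @ qs))"
proof -
  obtain p a where t: "t = int n * p + a" and a: "0 \<le> a" "a < int n" by (rule degree_cases)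
  obtain q b where x: "x = int n * q + b" and b: "0 \<le> b" "b < int n" by (rule degree_cases)
  define E where "E s = basis (ps @ [t + int n * s, x - int n * s] @ qs)" for s
  have pq: "p < q \<or> p = q \<and> a < b" using \<open>t < x\<close> int_mult_less_iff[OF a b] t x by simp
  have "t + int n * s < x \<longleftrightarrow> p + s < q \<or> p + s = q \<and> a < b" for s
  proof -
    have "t + int n * s = int n * (p + s) + a" by (simp add: t distrib_left)
    then show ?thesis unfolding x by (simp only: int_mult_less_iff[OF a b])
  qed
  then have "{s. 0 \<le> s \<and> t + int n * s < x} = {s. 0 \<le> s \<and> (p + s < q \<or> p + s = q \<and> a < b)}"
    by simp
  also have "\<dots> = (if a < b then {0..q - p} else {0..<q - p})" by auto
  finally have set: "{s. 0 \<le> s \<and> t + int n * s < x} = (if a < b then {0..q - p} else {0..<q - p})" .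
  have re: "(\<Sum>l\<in>{p..<q}. basis (ps @ [int n * l + a, int n * (p + q - l) + b] @ qs)) = sum E {0..<q - p}"
    by (rule sum.reindex_bij_witness[of _ "\<lambda>s. p + s" "\<lambda>l. l - p"])
      (auto simp: E_def t x algebra_simps)
  have emp: "{q..<p} = {}" using pq by auto
  have eq: "t mod int n = x mod int n \<longleftrightarrow> a = b" using mod_eq_residue[OF a b] t x by simp
  have "{0..q - p} = insert (q - p) {0..<q - p}" using pq by auto
  then have ins: "sum E {0..q - p} = E (q - p) + sum E {0..<q - p}" by simp
  have last: "basis (ps @ [int n * q + a, int n * p + b] @ qs) = E (q - p)"
    by (simp add: E_def t x algebra_simps)
  show ?thesis
    unfolding E_def[symmetric] set eq
    using hecke_basis[OF assms(1) a b, of p q qs]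
    unfolding re emp last t[symmetric] x[symmetric] 
    by (auto simp: ins tm.scale_right_distrib algebra_simps)
qed

text \<open>The geometric sum now enters with a minus sign and always contains the endpoint s = p -
  q. For b < a it stays in the sum; for a < b the R-matrix term cancels it; for a = b it is the
  swapped tensor itself and turns the coefficient v into v - h, the inverse of v.\<close>

lemma hecke_greater:
  assumes "length ps = i" "x < t"
  shows "T i (basis (ps @ [t, x] @ qs)) =
    smul (if t mod int n = x mod int n then inverse v else 1) (basis (ps @ [x, t] @ qs))
    - smul h (\<Sum>s\<in>{s. 1 \<le> s \<and> x < t - int n * s}. basis (ps @ [t - int n * s, x + int n * s] @ qs))"
proof -
  obtain p a where t: "t = int n * p + a" and a: "0 \<le> a" "a < int n" by (rule degree_cases)
  obtain q b where x: "x = int n * q + b" and b: "0 \<le> b" "b < int n" by (rule degree_cases)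
  define E where "E s = basis (ps @ [t - int n * s, x + int n * s] @ qs)" for s
  have pq: "q < p \<or> p = q \<and> b < a" using \<open>x < t\<close> int_mult_less_iff[OF b a] t x by auto
  have "x < t - int n * s \<longleftrightarrow> q < p - s \<or> q = p - s \<and> b < a" for s
  proof -
    have "t - int n * s = int n * (p - s) + a" by (simp add: t right_diff_distrib)
    then show ?thesis unfolding x by (simp only: int_mult_less_iff[OF b a])
  qed
  then have "{s. 1 \<le> s \<and> x < t - int n * s} = {s. 1 \<le> s \<and> (q < p - s \<or> q = p - s \<and> b < a)}"
    by simp
  also have "\<dots> = (if b < a then {1..p - q} else {1..<p - q})" by auto
  finally have set: "{s. 1 \<le> s \<and> x < t - int n * s} = (if b < a then {1..p - q} else {1..<p - q})" .
  have re: "(\<Sum>l\<in>{q..<p}. basis (ps @ [int n * l + a, int n * (p + q - l) + b] @ qs)) = sum E {1..p - q}"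
    by (rule sum.reindex_bij_witness[of _ "\<lambda>s. p - s" "\<lambda>l. p - l"])
      (auto simp: E_def t x algebra_simps)
  have emp: "{p..<q} = {}" using pq by auto
  have eq: "t mod int n = x mod int n \<longleftrightarrow> a = b" using mod_eq_residue[OF a b] t x by simp
  have ins: "sum E {1..p - q} = E (p - q) + sum E {1..<p - q}" if "\<not> b < a"
  proof -
    have "{1..p - q} = insert (p - q) {1..<p - q}" using pq that by auto
    then show ?thesis by simp
  qed
  have last: "basis (ps @ [int n * q + a, int n * p + b] @ qs) = E (p - q)"
    by (simp add: E_def t x algebra_simps)
  have last': "E (p - q) = basis (ps @ [x, t] @ qs)" if "a = b"
    using that by (simp add: E_def t x algebra_simps)
  show ?thesis
    unfolding E_def[symmetric] set eq
    using hecke_basis[OF assms(1) a b, of p q qs]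
    unfolding re emp last t[symmetric] x[symmetric]
    by (auto simp: ins last' tm.scale_right_distrib tm.scale_left_diff_distrib algebra_simps)
qed

lemma hecke_equal:
  assumes "length ps = i"
  shows "T i (basis (ps @ [t, t] @ qs)) = smul v (basis (ps @ [t, t] @ qs))"
proof -
  obtain p a where t: "t = int n * p + a" and a: "0 \<le> a" "a < int n" by (rule degree_cases)
  show ?thesis using hecke_basis[OF assms a a, of p p qs] by (simp add: t)
qed

lemma split_at_two:
  assumes "Suc i < length t"
  obtains ps a b qs where "t = ps @ [a, b] @ qs" "length ps = i"
proof
  show "t = take i t @ [t ! i, t ! Suc i] @ drop (i + 2) t"
    using assms by (simp add: Cons_nth_drop_Suc flip: id_take_nth_drop) 
  show "length (take i t) = i" using assms by simp
qed

lemma hecke_embed_basis: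
  assumes "length ps = i" "Suc r < length t"
  shows "T (i + r) (basis (ps @ t @ qs)) = tens (basis ps) (tens (T r (basis t)) (basis qs))"
proof -
  obtain us a b ws where t: "t = us @ [a, b] @ ws" "length us = r"
    using assms(2) by (rule split_at_two)
  obtain p a' where a: "a = int n * p + a'" "0 \<le> a'" "a' < int n" by (rule degree_cases)
  obtain q b' where b: "b = int n * q + b'" "0 \<le> b'" "b' < int n" by (rule degree_cases)
  have "length (ps @ us) = i + r" using assms t by simp
  from hecke_basis[OF this a(2,3) b(2,3), of p q "ws @ qs"] hecke_basis[OF t(2) a(2,3) b(2,3), of p q ws]
  show ?thesis by (simp add: t a(1) b(1) tens_simps)
qed

lemma hecke_tens_left:
  assumes "u \<in> tensor_power N" "Suc r < N"
  shows "T r (tens u w) = tens (T r u) w"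
proof (rule linop_eqI'[where w = w])
  show "T r (tens u (basis t)) = tens (T r u) (basis t)" for t
  proof (rule linop_eqI[OF _ _ assms(1)[unfolded tensor_power_supp]])
    show "length s = N \<Longrightarrow> T r (tens (basis s) (basis t)) = tens (T r (basis s)) (basis t)" for s
      using hecke_embed_basis[of "[]" 0 r s t] assms(2) by simp
  qed (intro linop_intros)+
qed (intro linop_intros)+

lemma hecke_tens_right:
  assumes "u \<in> tensor_power N" "w \<in> tensor_power M" "Suc r < M"
  shows "T (N + r) (tens u w) = tens u (T r w)"
proof (rule linop_eqI[OF _ _ assms(2)[unfolded tensor_power_supp]])
  show "T (N + r) (tens u (basis t)) = tens u (T r (basis t))" if "length t = M" for t
  proof (rule linop_eqI[OF _ _ assms(1)[unfolded tensor_power_supp]])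
    show "length s = N \<Longrightarrow> T (N + r) (tens (basis s) (basis t)) = tens (basis s) (T r (basis t))" for s
      using hecke_embed_basis[of s N r t "[]"] that assms(3) by simp
  qed (intro linop_intros)+
qed (intro linop_intros)+

lemma supp_lin:
  assumes "supp P w" "\<And>t. P t \<Longrightarrow> supp Q (f t)"
  shows "supp Q (lin f w)"
  using supp_linop[OF linop_lin assms(1), of Q f] assms(2) by simp

lemma hecke_power:
  assumes "w \<in> tensor_power N"
  shows "T i w \<in> tensor_power N"
proof -
  let ?P = "\<lambda>t. length t = N"
  have w: "supp ?P w" using assms by (simp add: tensor_power_supp)
  have "supp ?P (R_mat n v i w)"
    unfolding R_mat_def Let_def by (rule supp_lin[OF w]) (auto intro!: supp_add supp_smul)
  then have "supp ?P (swap_Y n i (R_mat n v i w))"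
    unfolding swap_Y_def Let_def by (rule supp_lin) auto
  moreover have "supp ?P (div_diff n i w)"
    unfolding div_diff_def Let_def by (rule supp_lin[OF w]) (intro supp_diff supp_sum, auto)
  ultimately show ?thesis
    unfolding hecke_def tensor_power_supp by (intro supp_add supp_smul)
qed

lemma Y_power: "w \<in> tensor_power N \<Longrightarrow> Y_pow n i j w \<in> tensor_power N"
  unfolding tensor_power_supp
  by (rule supp_linop[OF linop_Y_pow]) (auto simp: Y_basis)

end

context wedge_setup
begin

subsection \<open>The affine Hecke relations\<close>

lemma Y_tens_left:
  assumes "u \<in> tensor_power N" "k < N"
  shows "Y_pow n k j (tens u w) = tens (Y_pow n k j u) w"
proof (rule linop_eqI'[where w = w])
  show "Y_pow n k j (tens u (basis t)) = tens (Y_pow n k j u) (basis t)" for t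
    by (rule linop_eqI[OF _ _ assms(1)[unfolded tensor_power_supp]])
      (use assms(2) in \<open>auto intro!: linop_intros simp: Y_basis nth_append list_update_append\<close>)
qed (intro linop_intros)+

lemma Y_tens_right:
  assumes "u \<in> tensor_power N"
  shows "Y_pow n (N + k) j (tens u w) = tens u (Y_pow n k j w)"
proof (rule linop_eqI'[where w = w])
  show "Y_pow n (N + k) j (tens u (basis t)) = tens u (Y_pow n k j (basis t))" for t
    by (rule linop_eqI[OF _ _ assms(1)[unfolded tensor_power_supp]])
      (auto intro!: linop_intros simp: Y_basis nth_append list_update_append)
qed (intro linop_intros)+

lemma Y_Y_same:
  assumes "w \<in> tensor_power N" "i < N"
  shows "Y_pow n i j (Y_pow n i k w) = Y_pow n i (j + k) w"
  by (rule linop_eqI[OF _ _ assms(1)[unfolded tensor_power_supp]])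
    (use assms(2) in \<open>auto intro!: linop_intros simp: Y_basis algebra_simps\<close>)

lemma Y_Y_commute: "i \<noteq> k \<Longrightarrow> Y_pow n i j (Y_pow n k l w) = Y_pow n k l (Y_pow n i j w)"
  by (rule linop_eqI'[where w = w]) (auto intro!: linop_intros simp: Y_basis list_update_swap)

lemma Y_0:
  "Y_pow n i 0 w = w"
  by (rule linop_eqI'[where w = w]) (auto intro!: linop_intros simp: Y_basis)

lemma Y_inv:
  assumes "w \<in> tensor_power N" "i < N"
  shows "Y_pow n i (- j) (Y_pow n i j w) = w"
  using Y_Y_same[OF assms] by (simp add: Y_0)

lemma Y_eq_0_iff:
  assumes "w \<in> tensor_power N" "i < N"
  shows "Y_pow n i j w = 0 \<longleftrightarrow> w = 0"
  using Y_inv[OF assms, of j] linop_zero[OF linop_Y_pow] by metis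

lemma list_induct2_ext:
  assumes "linop f" "linop g" "w \<in> tensor_power N" "Suc i < N"
    and "\<And>ps a b qs. length ps = i \<Longrightarrow> f (basis (ps @ [a, b] @ qs)) = g (basis (ps @ [a, b] @ qs))"
  shows "f w = g w"
proof (rule linop_eqI[OF assms(1,2) assms(3)[unfolded tensor_power_supp]])
  fix t :: "int list" assume "length t = N"
  then obtain ps a b qs where "t = ps @ [a, b] @ qs" "length ps = i"
    using split_at_two[of i t] assms(4) by metis
  then show "f (basis t) = g (basis t)" using assms(5) by simp
qed

lemma Y_pair:
  assumes "length ps = i"
  shows "Y_pow n i j (basis (ps @ [a, b] @ qs)) = basis (ps @ [a + int n * j, b] @ qs)"
    and "Y_pow n (Suc i) j (basis (ps @ [a, b] @ qs)) = basis (ps @ [a, b + int n * j] @ qs)"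
  using assms by (auto simp: Y_basis nth_append list_update_append)

lemma hecke_Y_both:
  assumes "w \<in> tensor_power N" "Suc i < N"
  shows "T i (Y_pow n i j (Y_pow n (Suc i) j w)) = Y_pow n i j (Y_pow n (Suc i) j (T i w))"
proof (rule list_induct2_ext[OF _ _ assms])
  fix ps qs :: "int list" and a b assume ps: "length ps = i"
  obtain p a' where a: "a = int n * p + a'" "0 \<le> a'" "a' < int n" by (rule degree_cases)
  obtain q b' where b: "b = int n * q + b'" "0 \<le> b'" "b' < int n" by (rule degree_cases)
  have sh: "int n * p + a' + int n * j = int n * (p + j) + a'" "int n * q + b' + int n * j = int n * (q + j) + b'"
    by (simp_all add: distrib_left)
  have re: "(\<Sum>l\<in>{x + j..<y + j}. basis (ps @ [int n * l + a', int n * (p + j + (q + j) - l) + b'] @ qs))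
     = (\<Sum>l\<in>{x..<y}. basis (ps @ [int n * (l + j) + a', int n * (p + (q + j) - l) + b'] @ qs))" for x y
    by (rule sum.reindex_bij_witness[of _ "\<lambda>l. l + j" "\<lambda>l. l - j"]) (auto simp: algebra_simps)
  show "T i (Y_pow n i j (Y_pow n (Suc i) j (basis (ps @ [a, b] @ qs))))
      = Y_pow n i j (Y_pow n (Suc i) j (T i (basis (ps @ [a, b] @ qs))))"
    unfolding a(1) b(1) Y_pair[OF ps] sh hecke_basis[OF ps a(2,3) b(2,3)] re
    by (simp add: Y_simps Y_pair[OF ps, simplified] algebra_simps)
qed (intro linop_intros)+

text \<open>The Bernstein-Lusztig cross relation of the affine Hecke algebra.\<close>

lemma hecke_Y_Suc:
  assumes "w \<in> tensor_power N" "Suc i < N"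
  shows "T i (Y (Suc i) w) = Y i (T i w) + smul h (Y (Suc i) w)"
proof (rule list_induct2_ext[OF _ _ assms])
  fix ps qs :: "int list" and a b assume ps: "length ps = i"
  obtain p a' where a: "a = int n * p + a'" "0 \<le> a'" "a' < int n" by (rule degree_cases)
  obtain q b' where b: "b = int n * q + b'" "0 \<le> b'" "b' < int n" by (rule degree_cases)
  have sh: "int n * q + b' + int n * 1 = int n * (q + 1) + b'" by (simp add: distrib_left)
  define F where "F l = basis (ps @ [int n * l + a', int n * (p + (q + 1) - l) + b'] @ qs)" for l
  have re: "Y i (\<Sum>l\<in>{x..<y}. basis (ps @ [int n * l + a', int n * (p + q - l) + b'] @ qs))
      = sum F {x + 1..<y + 1}" for x y
    unfolding Y_simps Y_pair[OF ps]
    by (rule sum.reindex_bij_witness[of _ "\<lambda>l. l - 1" "\<lambda>l. l + 1"])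
      (auto simp: F_def algebra_simps)
  \<comment> \<open>Raising the degree q extends the range of the sum at its end, while
    multiplication by Y at position i shifts the whole range; the two ranges differ by the single
    term at p, which is the correction h Y w.\<close>
  have tele: "sum F {p..<q + 1} - sum F {q + 1..<p} = sum F {p + 1..<q + 1} - sum F {q + 1..<p + 1} + F p"
  proof (cases "p \<le> q")
    case True
    then have "{p..<q + 1} = insert p {p + 1..<q + 1}" by auto
    then show ?thesis using True by simp
  next
    case False
    then have "{q + 1..<p + 1} = insert p {q + 1..<p}" by auto
    then show ?thesis using False by simp
  qed
  have Fp: "basis (ps @ [int n * p + a', int n * (q + 1) + b'] @ qs) = F p"
    by (simp add: F_def)
  show "T i (Y (Suc i) (basis (ps @ [a, b] @ qs))) =
      Y i (T i (basis (ps @ [a, b] @ qs))) + smul h (Y (Suc i) (basis (ps @ [a, b] @ qs)))"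
    unfolding a(1) b(1) Y_pair[OF ps] sh hecke_basis[OF ps a(2,3) b(2,3)] 
    unfolding F_def[symmetric] tele Fp
    unfolding Y_simps(1,2,5) re
    by (simp add: Y_simps Y_pair[OF ps, simplified] tm.scale_right_distrib distrib_left add_ac)
qed (intro linop_intros)+

text \<open>Follows from \<open>hecke_Y_Suc\<close> at the vector with the second variable divided
  out, since the product of both variables commutes with T.\<close>

lemma hecke_Y:
  assumes w: "w \<in> tensor_power N" and i: "Suc i < N"
  shows "T i (Y i w) = Y (Suc i) (T i w) - smul h (Y (Suc i) w)"
proof -
  let ?u = "Y_pow n (Suc i) (-1) w"
  have u: "?u \<in> tensor_power N" using w by (rule Y_power)
  have wu: "w = Y (Suc i) ?u" using Y_inv[OF w, of "Suc i" "-1"] i by simp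
  have "Y (Suc i) (T i w) = Y (Suc i) (Y i (T i ?u)) + smul h (Y (Suc i) w)"
    using hecke_Y_Suc[OF u i] unfolding wu[symmetric] by (simp add: Y_simps)
  also have "Y (Suc i) (Y i (T i ?u)) = T i (Y i w)"
    using hecke_Y_both[OF u i, of 1] unfolding wu[symmetric] by (simp add: Y_Y_commute[of i "Suc i"])
  finally show ?thesis by simp
qed

lemma hecke_Y_other:
  assumes "w \<in> tensor_power N" "Suc i < N" "k \<noteq> i" "k \<noteq> Suc i" "k < N"
  shows "T i (Y_pow n k j w) = Y_pow n k j (T i w)"
proof (rule linop_eqI[OF _ _ assms(1)[unfolded tensor_power_supp]])
  fix t :: "int list" assume len: "length t = N"
  then obtain ps a b qs where t: "t = ps @ [a, b] @ qs" "length ps = i"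
    using split_at_two[of i t] assms(2) by metis
  have emb: "T i (basis (us @ [a, b] @ ws)) = tens (basis us) (tens (T 0 (basis [a, b])) (basis ws))"
    if "length us = i" for us ws
    using hecke_embed_basis[OF that, of 0 "[a, b]" ws] by simp
  have pw: "basis us \<in> tensor_power (length us)" for us
    by (intro tensor_power_intros) simp
  show "T i (Y_pow n k j (basis t)) = Y_pow n k j (T i (basis t))"
  proof (cases "k < i")
    case True
    then have "Y_pow n k j (basis t) = basis (ps[k := ps ! k + int n * j] @ [a, b] @ qs)"
      using t by (simp add: Y_basis nth_append list_update_append)
    then show ?thesis
      using emb[of "ps[k := ps ! k + int n * j]" qs] emb[of ps qs] t True Y_tens_left[OF pw[of ps], of k j]
      by (simp add: Y_basis)
  next
    case False
    then obtain l where k: "k = i + (2 + l)" using assms(3,4)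
      by (metis Suc_lessI add_2_eq_Suc add_Suc_right less_iff_Suc_add linorder_less_linear add.commute)
    then have "Y_pow n k j (basis t) = basis (ps @ [a, b] @ qs[l := qs ! l + int n * j])"
      using t by (simp add: Y_basis nth_append list_update_append)
    moreover have "T 0 (basis [a, b]) \<in> tensor_power 2"
      by (intro hecke_power tensor_power_intros) simp
    ultimately show ?thesis
      using emb[of ps qs] emb[of ps "qs[l := qs ! l + int n * j]"] t Y_tens_right[OF pw[of ps], of "2 + l" j]
        Y_tens_right[of _ 2 l j] k
      by (simp add: Y_basis)
  qed
qed (intro linop_intros)+

text \<open>Reduces an identity that is insensitive to multiplication by the variables to indices of
  degree 0, where T is just the R-matrix followed by a trivial swap.\<close>

lemma int_shift_induct:
  assumes "\<And>x. P (x + int n) \<longleftrightarrow> P x" "\<And>a. 0 \<le> a \<Longrightarrow> a < int n \<Longrightarrow> P a"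
  shows "P (x :: int)"
proof -
  obtain p a where x: "x = int n * p + a" "0 \<le> a" "a < int n" by (rule degree_cases)
  have "P (int n * p + a) \<longleftrightarrow> P a"
  proof (induction p rule: int_induct[where k = 0])
    case (step1 i)
    then show ?case using assms(1)[of "int n * i + a"] by (simp add: algebra_simps)
  next
    case (step2 i)
    then show ?case using assms(1)[of "int n * (i - 1) + a"] by (simp add: algebra_simps)
  qed simp
  then show ?thesis using assms(2)[OF x(2,3)] x(1) by simp
qed

lemma hecke_residue:
  assumes "length ps = i" "0 \<le> a" "a < int n" "0 \<le> b" "b < int n"
  shows "T i (basis (ps @ a # b # qs)) =
    (if a = b then smul v (basis (ps @ a # b # qs))
     else if a < b then basis (ps @ b # a # qs) + smul h (basis (ps @ a # b # qs))
     else basis (ps @ b # a # qs))"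
  using hecke_basis[OF assms, of 0 0 qs] by simp

lemma vv [simp]: "v * inverse v = 1" "inverse v * v = 1"
  "v * (inverse v * c) = c" "inverse v * (v * c) = c"
  by (simp_all flip: mult.assoc)

text \<open>The defect \<open>Q\<close> of the relation commutes with both variables by the cross
  relations, so it vanishes once it does on pairs of residues.\<close>

lemma hecke_quadratic:
  assumes w: "w \<in> tensor_power N" and i: "Suc i < N"
  shows "T i (T i w) = w + smul h (T i w)"
proof (rule list_induct2_ext[OF _ _ assms])
  fix ps qs :: "int list" and a b assume ps: "length ps = i"
  define Q where "Q w = T i (T i w) - (w + smul h (T i w))" for w
  define M where "M = Suc (Suc (i + length qs))"
  have M: "Suc i < M" by (simp add: M_def)
  have bM: "basis (ps @ [a, b] @ qs) \<in> tensor_power M" for a b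
    by (intro tensor_power_intros) (simp add: M_def ps)
  have QM: "w \<in> tensor_power M \<Longrightarrow> Q w \<in> tensor_power M" for w
    unfolding Q_def by (intro tensor_power_intros hecke_power)
  have Q1: "Q (Y (Suc i) w) = Y (Suc i) (Q w)" if "w \<in> tensor_power M" for w
    by (simp add: Q_def hecke_Y_Suc[OF _ M] hecke_Y[OF _ M] T_simps Y_simps that hecke_power
      tm.scale_right_distrib tm.scale_right_diff_distrib)
  have Q0: "Q (Y i w) = Y i (Q w)" if "w \<in> tensor_power M" for w
    by (simp add: Q_def hecke_Y_Suc[OF _ M] hecke_Y[OF _ M] T_simps Y_simps that hecke_power
      tm.scale_right_distrib tm.scale_right_diff_distrib)
  have "Q (basis (ps @ [a, b] @ qs)) = 0"
  proof (rule int_shift_induct[where x = a])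
    show "Q (basis (ps @ [x + int n, b] @ qs)) = 0 \<longleftrightarrow> Q (basis (ps @ [x, b] @ qs)) = 0" for x
      using Q0[OF bM, of x b] Y_pair(1)[OF ps, of 1 x b qs] Y_eq_0_iff[OF QM[OF bM[of x b]], of i 1] M
      by simp
    fix a assume a: "0 \<le> a" "a < int n"
    show "Q (basis (ps @ [a, b] @ qs)) = 0"
    proof (rule int_shift_induct[where x = b])
      show "Q (basis (ps @ [a, x + int n] @ qs)) = 0 \<longleftrightarrow> Q (basis (ps @ [a, x] @ qs)) = 0" for x
        using Q1[OF bM, of a x] Y_pair(2)[OF ps, of 1 a x qs] Y_eq_0_iff[OF QM[OF bM[of a x]], of "Suc i" 1] M
        by simp
      fix b assume b: "0 \<le> b" "b < int n"
      consider "a = b" | "a < b" | "b < a" by linarith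
      then show "Q (basis (ps @ [a, b] @ qs)) = 0"
        by cases (auto simp: Q_def hecke_residue[OF ps] a b T_simps lookup_add lookup_minus algebra_simps
          intro!: poly_mapping_eqI)
    qed
  qed
  then show "T i (T i (basis (ps @ [a, b] @ qs))) = basis (ps @ [a, b] @ qs) + smul h (T i (basis (ps @ [a, b] @ qs)))"
    by (simp add: Q_def)
qed (intro linop_intros)+

text \<open>The defect \<open>D\<close> intertwines the three variables with the reversed ones.
  Hence its vanishing is again a question about residues, settled by the relative order of a, b,
  c.\<close>

lemma hecke_braid:
  assumes w: "w \<in> tensor_power N" and i: "Suc (Suc i) < N"
  shows "T i (T (Suc i) (T i w)) = T (Suc i) (T i (T (Suc i) w))"
proof (rule linop_eqI[OF _ _ w[unfolded tensor_power_supp]])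
  fix t :: "int list" assume t: "length t = N"
  define D where "D w = T i (T (Suc i) (T i w)) - T (Suc i) (T i (T (Suc i) w))" for w
  have i': "Suc i < N" and i'': "i < N" using i by simp_all
  have DN: "w \<in> tensor_power N \<Longrightarrow> D w \<in> tensor_power N" for w
    unfolding D_def by (intro tensor_power_intros hecke_power)
  note cross = hecke_Y_Suc[OF _ i'] hecke_Y_Suc[OF _ i] hecke_Y[OF _ i'] hecke_Y[OF _ i]
    hecke_Y_other[OF _ i', of _ "Suc (Suc i)"] hecke_Y_other[OF _ i, of _ i]
    hecke_quadratic[OF _ i'] hecke_quadratic[OF _ i] T_simps Y_simps hecke_power Y_power i i' i''
    tm.scale_right_distrib tm.scale_right_diff_distrib
  have D0: "D (Y i w) = Y (Suc (Suc i)) (D w)" and D1: "D (Y (Suc i) w) = Y (Suc i) (D w)"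
    and D2: "D (Y (Suc (Suc i)) w) = Y i (D w)" if "w \<in> tensor_power N" for w
    using that by (simp_all add: D_def cross algebra_simps)
  obtain ps a b qs' where t': "t = ps @ [a, b] @ qs'" and ps: "length ps = i"
    using split_at_two[of i t] i t by (metis Suc_lessD)
  obtain c qs where qs': "qs' = c # qs"
    using t i by (cases qs') (auto simp: t' ps)
  have bN: "basis (ps @ [a, b, c] @ qs) \<in> tensor_power N" for a b c
    by (intro tensor_power_intros) (use t in \<open>simp add: t' qs'\<close>)
  have Yt: "Y i (basis (ps @ [a, b, c] @ qs)) = basis (ps @ [a + int n, b, c] @ qs)"
    "Y (Suc i) (basis (ps @ [a, b, c] @ qs)) = basis (ps @ [a, b + int n, c] @ qs)"
    "Y (Suc (Suc i)) (basis (ps @ [a, b, c] @ qs)) = basis (ps @ [a, b, c + int n] @ qs)" for a b c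
    using ps by (auto simp: Y_basis nth_append list_update_append)
  have "D (basis (ps @ [a, b, c] @ qs)) = 0"
  proof (rule int_shift_induct[where x = a])
    show "D (basis (ps @ [x + int n, b, c] @ qs)) = 0 \<longleftrightarrow> D (basis (ps @ [x, b, c] @ qs)) = 0" for x
      using D0[OF bN, of x b c] Yt(1)[of x b c] Y_eq_0_iff[OF DN[OF bN[of x b c]], of "Suc (Suc i)" 1] i by simp
    fix a assume a: "0 \<le> a" "a < int n"
    show "D (basis (ps @ [a, b, c] @ qs)) = 0"
    proof (rule int_shift_induct[where x = b])
      show "D (basis (ps @ [a, x + int n, c] @ qs)) = 0 \<longleftrightarrow> D (basis (ps @ [a, x, c] @ qs)) = 0" for x
        using D1[OF bN, of a x c] Yt(2)[of a x c] Y_eq_0_iff[OF DN[OF bN[of a x c]], of "Suc i" 1] i by simp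
      fix b assume b: "0 \<le> b" "b < int n"
      show "D (basis (ps @ [a, b, c] @ qs)) = 0"
      proof (rule int_shift_induct[where x = c])
        show "D (basis (ps @ [a, b, x + int n] @ qs)) = 0 \<longleftrightarrow> D (basis (ps @ [a, b, x] @ qs)) = 0" for x
          using D2[OF bN, of a b x] Yt(3)[of a b x] Y_eq_0_iff[OF DN[OF bN[of a b x]], of i 1] i by simp
        fix c assume c: "0 \<le> c" "c < int n"
        have T1: "T (Suc i) (basis (ps @ x # y # z # qs)) =
            (if y = z then smul v (basis (ps @ x # y # z # qs))
             else if y < z then basis (ps @ x # z # y # qs) + smul h (basis (ps @ x # y # z # qs))
             else basis (ps @ x # z # y # qs))"
          if "0 \<le> y" "y < int n" "0 \<le> z" "z < int n" for x y z
          using hecke_residue[of "ps @ [x]" "Suc i" y z qs] that ps by simp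
        have "D (basis (ps @ a # b # c # qs)) = 0"
          unfolding D_def
          by (rule poly_mapping_eqI)
            (cases a b rule: linorder_cases; cases b c rule: linorder_cases; cases a c rule: linorder_cases;
              simp add: hecke_residue[OF ps] T1 a b c T_simps lookup_add lookup_minus algebra_simps)
        then show "D (basis (ps @ [a, b, c] @ qs)) = 0" by simp
      qed
    qed
  qed
  then show "T i (T (Suc i) (T i (basis t))) = T (Suc i) (T i (T (Suc i) (basis t)))"
    by (simp add: D_def t' qs')
qed (intro linop_intros)+

lemma hecke_commute:
  assumes w: "w \<in> tensor_power N" and "Suc i < k" "Suc k < N"
  shows "T i (T k w) = T k (T i w)"
proof (rule linop_eqI[OF _ _ w[unfolded tensor_power_supp]])
  fix t :: "int list" assume t: "length t = N"
  define u z where "u = basis (take k t)" and "z = basis (drop k t)"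
  have u: "u \<in> tensor_power k" and z: "z \<in> tensor_power (N - k)"
    unfolding u_def z_def using t assms by (auto intro!: tensor_power_intros)
  have "basis t = tens u z" by (simp add: u_def z_def)
  then show "T i (T k (basis t)) = T k (T i (basis t))"
    using hecke_tens_left[OF u assms(2)] hecke_tens_right[OF u z, of 0]
      hecke_tens_right[OF hecke_power[OF u, of i] z, of 0] assms by simp
qed (intro linop_intros)+

section \<open>Inverse generators\<close>

definition T_inv :: "nat \<Rightarrow> tensor \<Rightarrow> tensor" where
  "T_inv i w = T i w - smul h w"

lemma linop_T_inv [linop_intros]: "linop f \<Longrightarrow> linop (\<lambda>w. T_inv i (f w))"
  unfolding T_inv_def by (intro linop_intros)

lemma T_inv_power: "w \<in> tensor_power N \<Longrightarrow> T_inv i w \<in> tensor_power N"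
  unfolding T_inv_def by (intro tensor_power_intros hecke_power)

lemma T_T_inv: "w \<in> tensor_power N \<Longrightarrow> Suc i < N \<Longrightarrow> T i (T_inv i w) = w"
  and T_inv_T: "w \<in> tensor_power N \<Longrightarrow> Suc i < N \<Longrightarrow> T_inv i (T i w) = w"
  by (simp_all add: T_inv_def T_simps hecke_quadratic)

lemma T_inv_Y: "w \<in> tensor_power N \<Longrightarrow> Suc i < N \<Longrightarrow> T_inv i (Y (Suc i) w) = Y i (T i w)"
  by (simp add: T_inv_def hecke_Y_Suc)

subsection \<open>Power sums\<close>

text \<open>Defined on all tensor degrees at once, so that it satisfies the Leibniz rule
  \<open>psum_tens\<close> without a degree index.\<close>

definition psum :: "int \<Rightarrow> tensor \<Rightarrow> tensor" where
  "psum j = lin (\<lambda>t. \<Sum>i<length t. basis (t[i := t ! i + int n * j]))"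

lemma linop_psum': "linop (psum j)"
  unfolding psum_def by (rule linop_lin)

lemmas linop_psum [linop_intros] = linop_comp[OF linop_psum']
lemmas psum_simps = linop_simps[OF linop_psum']

lemma psum_basis: "psum j (basis t) = (\<Sum>i<length t. basis (t[i := t ! i + int n * j]))"
  by (simp add: psum_def)

lemma psum_eq_power_sum: "w \<in> tensor_power N \<Longrightarrow> psum j w = power_sum n N j w"
  unfolding tensor_power_supp power_sum_def
  by (rule linop_eqI[where P = "\<lambda>t. length t = N"]) (auto intro!: linop_intros simp: psum_basis Y_basis)

lemma psum_power: "w \<in> tensor_power N \<Longrightarrow> psum j w \<in> tensor_power N"
  by (auto simp: psum_eq_power_sum power_sum_def intro!: tensor_power_intros Y_power)

lemma psum_tens: "psum j (tens u w) = tens (psum j u) w + tens u (psum j w)"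
proof (rule linop_eqI'[where w = w])
  show "psum j (tens u (basis t)) = tens (psum j u) (basis t) + tens u (psum j (basis t))" for t
  proof (rule linop_eqI'[where w = u])
    fix s
    let ?B = "\<lambda>i. basis ((s @ t)[i := (s @ t) ! i + int n * j])"
    have "(\<Sum>i<length s + length t. ?B i) = (\<Sum>i<length s. ?B i) + (\<Sum>i<length t. ?B (length s + i))"
      using sum.atLeastLessThan_concat[of 0 "length s" "length s + length t" ?B]
        sum.shift_bounds_nat_ivl[of ?B 0 "length s" "length t"]
      by (simp add: lessThan_atLeast0 add.commute)
    then show "psum j (tens (basis s) (basis t)) = tens (psum j (basis s)) (basis t) + tens (basis s) (psum j (basis t))"
      by (simp add: psum_basis tens_simps nth_append list_update_append)
  qed (intro linop_intros)+
qed (intro linop_intros)+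

lemma psum_single: "psum j (basis [x]) = basis [x + int n * j]"
  by (simp add: psum_basis)

lemma psum_Nil [simp]: "psum j (basis []) = 0"
  by (simp add: psum_basis)

text \<open>Newton's recursion expresses a power sum of two variables by the two previous ones, the
  first power sum and the product of the variables, all compatible with T. Negative powers are
  positive ones divided by a power of the product.\<close>

lemma hecke_Y_pair_sum:
  assumes w: "w \<in> tensor_power N" and i: "Suc i < N"
  shows "T i (Y_pow n i j w + Y_pow n (Suc i) j w) = Y_pow n i j (T i w) + Y_pow n (Suc i) j (T i w)"
proof -
  define E where "E j w = Y_pow n i j w + Y_pow n (Suc i) j w" for j w
  have EN: "u \<in> tensor_power N \<Longrightarrow> E j u \<in> tensor_power N" for j u
    unfolding E_def by (intro tensor_power_intros Y_power)
  note same = Y_Y_same[of _ N i] Y_Y_same[of _ N "Suc i"]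
  have rec: "E (j + 1) u = E 1 (E j u) - Y i (Y (Suc i) (E (j - 1) u))" if "u \<in> tensor_power N" for j u
    using that i Y_Y_commute[of "Suc i" i]
    by (simp add: E_def Y_simps same Y_power add.commute[of 1])
  have E1: "T i (E 1 u) = E 1 (T i u)" if "u \<in> tensor_power N" for u
    using that i by (simp add: E_def T_simps hecke_Y hecke_Y_Suc)
  have nat: "T i (E (int k) u) = E (int k) (T i u) \<and> T i (E (int k + 1) u) = E (int k + 1) (T i u)"
    if "u \<in> tensor_power N" for k u
  proof (induction k)
    case 0
    show ?case using that E1 by (simp add: E_def Y_0 T_simps)
  next
    case (Suc k)
    have "T i (E (int k + 1 + 1) u) = E (int k + 1 + 1) (T i u)"
      using Suc rec[of u "int k + 1"] rec[of "T i u" "int k + 1"] that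
      by (simp add: T_simps E1 EN hecke_Y_both[OF _ i] hecke_power)
    with Suc show ?case by (simp add: add_ac)
  qed
  have neg: "E (- j) u = Y_pow n i (- j) (Y_pow n (Suc i) (- j) (E j u))" if "u \<in> tensor_power N" for j u
    using that i Y_Y_commute[of "Suc i" i] 
    by (simp add: E_def Y_simps same Y_power Y_inv[of _ N] Y_0 Y_Y_commute[of i "Suc i" "-j" "-j"])
  show ?thesis
  proof (cases "j \<ge> 0")
    case True
    then show ?thesis using nat[OF w, of "nat j"] by (simp add: E_def)
  next
    case False
    then have "T i (E (- j) w) = E (- j) (T i w)" using nat[OF w, of "nat (- j)"] by simp
    then have "T i (E (- (- j)) w) = E (- (- j)) (T i w)"
      using neg[OF w, of "- j"] neg[OF hecke_power[OF w], of "- j"] hecke_Y_both[OF EN[OF w] i] by simp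
    then show ?thesis by (simp add: E_def)
  qed
qed

lemma hecke_psum:
  assumes w: "w \<in> tensor_power N" and i: "Suc i < N"
  shows "T i (psum j w) = psum j (T i w)"
proof -
  let ?I = "{..<N} - {i, Suc i}"
  have split: "{..<N} = insert i (insert (Suc i) ?I)" using i by auto
  have eq: "psum j u = (Y_pow n i j u + Y_pow n (Suc i) j u) + (\<Sum>k\<in>?I. Y_pow n k j u)"
    if "u \<in> tensor_power N" for u
    using that by (subst psum_eq_power_sum[OF that], unfold power_sum_def, subst split) (simp add: add_ac)
  show ?thesis
    unfolding eq[OF w] eq[OF hecke_power[OF w]] linop_add[OF linop_hecke, of i "_ + _"]
      hecke_Y_pair_sum[OF w i] linop_sum[OF linop_hecke]
    using hecke_Y_other[OF w i] by simp
qed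

end

subsection \<open>Antisymmetrisers for a Hecke algebra action\<close>

text \<open>
  The Hecke generators satisfy these axioms with \<open>q = v\<close>, their inverses with \<open>q = 1 / v\<close>.  The
  inverses produce the factors \<open>[N]\<^sup>+\<close>, the generators themselves the factors \<open>[N]\<^sup>-\<close>.
\<close>

locale hecke_action =
  fixes P :: "nat \<Rightarrow> tensor \<Rightarrow> tensor" and q e :: complex
  assumes q_nonzero [simp]: "q \<noteq> 0" and e_eq: "e = - inverse q"
    and linop_P': "linop (P i)"
    and P_power: "w \<in> tensor_power M \<Longrightarrow> P i w \<in> tensor_power M"
    and P_quadratic: "w \<in> tensor_power M \<Longrightarrow> Suc i < M \<Longrightarrow> P i (P i w) = w + smul (q - inverse q) (P i w)"
    and P_braid: "w \<in> tensor_power M \<Longrightarrow> Suc (Suc i) < M \<Longrightarrow>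
      P i (P (Suc i) (P i w)) = P (Suc i) (P i (P (Suc i) w))"
    and P_commute: "w \<in> tensor_power M \<Longrightarrow> Suc i < k \<Longrightarrow> Suc k < M \<Longrightarrow> P i (P k w) = P k (P i w)"
begin

lemmas linop_P [linop_intros] = linop_comp[OF linop_P']
lemmas P_simps = linop_simps[OF linop_P']

lemma linop_foldr': "linop (\<lambda>w. foldr P is w)"
  by (induction "is") (auto intro!: linop_intros)

lemmas linop_foldr [linop_intros] = linop_comp[OF linop_foldr']

lemma foldr_power: "w \<in> tensor_power M \<Longrightarrow> foldr P is w \<in> tensor_power M"
  by (induction "is") (auto intro: P_power)

lemma foldr_commute:
  assumes "w \<in> tensor_power M" "\<And>k. k \<in> set is \<Longrightarrow> Suc i < k \<and> Suc k < M"
  shows "P i (foldr P is w) = foldr P is (P i w)"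
  using assms(2) by (induction "is") (simp_all add: P_commute[OF foldr_power[OF assms(1)]])

lemma chain_far:
  "w \<in> tensor_power M \<Longrightarrow> Suc i < a \<Longrightarrow> N < M \<Longrightarrow> P i (foldr P [a..<N] w) = foldr P [a..<N] (P i w)"
  by (rule foldr_commute) auto

text \<open>Letters of the chain before i commute with P at i + 1; at the adjacent letters i, i + 1
  the braid relation turns it into P at i, which commutes with the remaining letters.\<close>

lemma chain_shift:
  assumes w: "w \<in> tensor_power M" and N: "N < M" "Suc i < N" and a: "a \<le> i"
  shows "P (Suc i) (foldr P [a..<N] w) = foldr P [a..<N] (P i w)"
  using a
proof (induction a rule: inc_induct)
  case base
  have "[i..<N] = i # Suc i # [Suc (Suc i)..<N]" using N by (simp add: upt_conv_Cons)
  then show ?case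
    using N by (simp add: P_braid[OF foldr_power[OF w], symmetric] chain_far[OF w])
next
  case (step a)
  have "[a..<N] = a # [Suc a..<N]" using N step by (simp add: upt_conv_Cons)
  then show ?case
    using step N by (simp add: P_commute[OF foldr_power[OF w], symmetric])
qed

lemma chain'_far:
  "w \<in> tensor_power M \<Longrightarrow> Suc i < a \<Longrightarrow> N < M \<Longrightarrow>
    foldr P (rev [a..<N]) (P i w) = P i (foldr P (rev [a..<N]) w)"
  by (rule foldr_commute[symmetric]) auto

lemma chain'_shift:
  assumes w: "w \<in> tensor_power M" and N: "N < M" "Suc i < N" and a: "a \<le> i"
  shows "foldr P (rev [a..<N]) (P (Suc i) w) = P i (foldr P (rev [a..<N]) w)"
  using a w
proof (induction a arbitrary: w rule: inc_induct)
  case base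
  have "[i..<N] = i # Suc i # [Suc (Suc i)..<N]" using N by (simp add: upt_conv_Cons)
  then show ?case
    using N base by (simp add: P_braid[symmetric, of _ M] chain'_far[of _ M] P_power)
next
  case (step a)
  have "[a..<N] = a # [Suc a..<N]" using N step by (simp add: upt_conv_Cons)
  moreover have "P a (P (Suc i) w) = P (Suc i) (P a w)"
    using step N by (intro P_commute[of _ M]) auto
  ultimately show ?case
    using step N by (simp add: P_power)
qed

text \<open>
  \<open>C N\<close> is the sum over the minimal left coset representatives of \<open>S\<^sub>N\<close> in \<open>S\<^sub>N\<^sub>+\<^sub>1\<close>, \<open>C' N\<close> the one
  over right cosets.  That \<open>A\<close> and \<open>A'\<close> agree makes \<open>A\<close> an eigenvector from both sides.
\<close>

definition C :: "nat \<Rightarrow> tensor \<Rightarrow> tensor" where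
  "C N w = (\<Sum>a\<le>N. smul (e ^ (N - a)) (foldr P [a..<N] w))"

definition C' :: "nat \<Rightarrow> tensor \<Rightarrow> tensor" where
  "C' N w = (\<Sum>a\<le>N. smul (e ^ (N - a)) (foldr P (rev [a..<N]) w))"

primrec A :: "nat \<Rightarrow> tensor \<Rightarrow> tensor" where
  "A 0 w = w" | "A (Suc N) w = C N (A N w)"

primrec A' :: "nat \<Rightarrow> tensor \<Rightarrow> tensor" where
  "A' 0 w = w" | "A' (Suc N) w = A' N (C' N w)"

definition qn :: "nat \<Rightarrow> complex" where "qn N = (\<Sum>k<N. (e ^ 2) ^ k)"
definition qf :: "nat \<Rightarrow> complex" where "qf N = (\<Prod>i=1..N. qn i)"

lemma linop_C' [linop_intros]: "linop f \<Longrightarrow> linop (\<lambda>w. C N (f w))" "linop f \<Longrightarrow> linop (\<lambda>w. C' N (f w))"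
  unfolding C_def C'_def by (intro linop_intros; assumption)+

lemma linop_A [linop_intros]: "linop (\<lambda>w. A N w)"
  by (induction N) (auto intro!: linop_intros)

lemma linop_A' [linop_intros]: "linop (\<lambda>w. A' N w)"
proof (induction N)
  case (Suc N)
  have "linop (\<lambda>w. C' N w)" by (intro linop_intros)
  from linop_comp[OF Suc this] show ?case by simp
qed (auto intro!: linop_intros)

lemma C_power: "w \<in> tensor_power M \<Longrightarrow> C N w \<in> tensor_power M"
  by (auto simp: C_def intro!: tensor_power_intros foldr_power)

lemma A_power: "w \<in> tensor_power M \<Longrightarrow> A N w \<in> tensor_power M"
  by (induction N) (auto simp: C_power)

lemma e_sq: "e * (q - inverse q) + 1 = e ^ 2"
  by (simp add: e_eq power2_eq_square right_diff_distrib)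

lemma sum_split_two:
  fixes f :: "nat \<Rightarrow> 'a::comm_monoid_add"
  assumes "i < N"
  shows "sum f {..N} = (\<Sum>a\<in>{..N} - {i, Suc i}. f a) + (f i + f (Suc i))"
proof -
  have "{..N} = insert i (insert (Suc i) ({..N} - {i, Suc i}))" using assms by auto
  then have "sum f {..N} = sum f (insert i (insert (Suc i) ({..N} - {i, Suc i})))" by simp
  also have "\<dots> = (\<Sum>a\<in>{..N} - {i, Suc i}. f a) + (f i + f (Suc i))"
    by (subst sum.insert, simp, simp, subst sum.insert, simp, simp, simp add: add_ac)
  finally show ?thesis .
qed

text \<open>P at i passes through the summands with a < i (as i - 1) and with a > i + 1, where z
  absorbs it. It maps the two summands a = i and a = i + 1 to combinations of each other, and the
  quadratic relation makes their weighted sum an eigenvector.\<close>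

lemma C_absorb:
  assumes z: "z \<in> tensor_power M" and N: "N < M"
    and zP: "\<And>j. Suc j < N \<Longrightarrow> P j z = smul e z" and i: "i < N"
  shows "P i (C N z) = smul e (C N z)"
proof -
  define f where "f a = foldr P [a..<N] z" for a
  have other: "P i (f a) = smul e (f a)" if "a \<in> {..N} - {i, Suc i}" for a
  proof (cases "a < i")
    case True
    then obtain i' where i': "i = Suc i'" by (cases i) auto
    have "P i (f a) = foldr P [a..<N] (P i' z)"
      unfolding f_def i' using True i i' N by (intro chain_shift[OF z]) auto
    also have "\<dots> = smul e (f a)"
      using zP[of i'] i i' by (simp add: f_def linop_smul[OF linop_foldr'])
    finally show ?thesis .
  next
    case False
    then have "Suc i < a" "Suc i < N" using that i by auto
    then show ?thesis
      using zP[of i] N by (simp add: f_def chain_far[OF z] linop_smul[OF linop_foldr'])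
  qed
  have fi: "f i = P i (f (Suc i))" using i by (simp add: f_def upt_conv_Cons)
  have fS: "f (Suc i) \<in> tensor_power M" by (simp add: f_def foldr_power z)
  obtain m where m: "N - i = Suc m" "N - Suc i = m" using i by (metis Suc_diff_Suc)
  have "P i (smul (e ^ Suc m) (f i) + smul (e ^ m) (f (Suc i)))
      = smul e (smul (e ^ Suc m) (f i) + smul (e ^ m) (f (Suc i)))" 
  proof -
    have "P i (f i) = f (Suc i) + smul (q - inverse q) (f i)"
      unfolding fi using P_quadratic[OF fS] i N by simp
    then have "P i (smul (e ^ Suc m) (f i) + smul (e ^ m) (f (Suc i)))
        = smul (e ^ Suc m) (f (Suc i)) + smul (e ^ m * (e * (q - inverse q) + 1)) (f i)"
      by (simp add: P_simps fi[symmetric]) (rule poly_mapping_eqI, simp add: lookup_add lookup_minus algebra_simps)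
    also have "\<dots> = smul e (smul (e ^ Suc m) (f i) + smul (e ^ m) (f (Suc i)))"
      unfolding e_sq by (rule poly_mapping_eqI) (simp add: lookup_add lookup_minus algebra_simps power2_eq_square)
    finally show ?thesis .
  qed
  then show ?thesis
    unfolding C_def f_def[symmetric] sum_split_two[OF i] m
    unfolding P_simps(1,6) tm.scale_right_distrib[of e "sum _ _"] tm.scale_sum_right
    using other by (simp add: P_simps(2) mult.commute)
qed

lemma A_absorb_left:
  "w \<in> tensor_power M \<Longrightarrow> N \<le> M \<Longrightarrow> Suc i < N \<Longrightarrow> P i (A N w) = smul e (A N w)"
  by (induction N arbitrary: i) (auto intro!: C_absorb[where M = M] A_power)

lemma A'_absorb_right:
  assumes "w \<in> tensor_power M" "N \<le> M" "Suc i < N"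
  shows "A' N (P i w) = smul e (A' N w)"
  using assms
proof (induction N arbitrary: i w)
  case (Suc N)
  note w = \<open>w \<in> tensor_power M\<close>
  have i: "i < N" and N: "N < M" using Suc by auto
  define f where "f a = A' N (foldr P (rev [a..<N]) w)" for a
  define g where "g a = A' N (foldr P (rev [a..<N]) (P i w))" for a
  have other: "g a = smul e (f a)" if "a \<in> {..N} - {i, Suc i}" for a
  proof (cases "a < i")
    case True
    then obtain i' where i': "i = Suc i'" by (cases i) auto
    have "g a = A' N (P i' (foldr P (rev [a..<N]) w))"
      unfolding g_def i' using True i i' N by (subst chain'_shift[OF w]) auto
    also have "\<dots> = smul e (f a)"
      unfolding f_def using i i' N by (intro Suc.IH foldr_power w) auto
    finally show ?thesis .
  next
    case False
    then have "Suc i < a" "Suc i < N" using that i by auto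
    then show ?thesis
      unfolding f_def g_def using N by (simp add: chain'_far[OF w] Suc.IH foldr_power w)
  qed
  obtain m where m: "N - i = Suc m" "N - Suc i = m" using i by (metis Suc_diff_Suc)
  have gS: "g (Suc i) = f i" using i by (simp add: f_def g_def upt_conv_Cons)
  have gi: "g i = f (Suc i) + smul (q - inverse q) (f i)"
    using i N by (simp add: f_def g_def upt_conv_Cons P_quadratic[OF w] linop_simps[OF linop_foldr']
      linop_simps[OF linop_A'])
  have "smul (e ^ Suc m) (g i) + smul (e ^ m) (g (Suc i))
        = smul (e ^ Suc m) (f (Suc i)) + smul (e ^ m * (e * (q - inverse q) + 1)) (f i)"
    unfolding gi gS by (rule poly_mapping_eqI) (simp add: lookup_add lookup_minus algebra_simps)
  also have "\<dots> = smul e (smul (e ^ Suc m) (f i) + smul (e ^ m) (f (Suc i)))"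
    unfolding e_sq by (rule poly_mapping_eqI) (simp add: lookup_add lookup_minus algebra_simps power2_eq_square)
  finally have two: "smul (e ^ (N - i)) (g i) + smul (e ^ (N - Suc i)) (g (Suc i))
      = smul e (smul (e ^ (N - i)) (f i) + smul (e ^ (N - Suc i)) (f (Suc i)))"
    unfolding m .
  have eq: "A' (Suc N) u = (\<Sum>a\<le>N. smul (e ^ (N - a)) (A' N (foldr P (rev [a..<N]) u)))" for u
    by (simp add: C'_def linop_simps[OF linop_A'])
  show ?case
    unfolding eq f_def[symmetric] g_def[symmetric] sum_split_two[OF i] two
    unfolding tm.scale_right_distrib[of e "sum _ _"] tm.scale_sum_right
    using other by (simp add: mult.commute)
qed simp

lemma foldr_eigen:
  assumes "\<And>j. j \<in> set is \<Longrightarrow> P j z = smul e z"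
  shows "foldr P is z = smul (e ^ length is) z"
  using assms by (induction "is") (simp_all add: P_simps mult.commute)

lemma qn_rev: "(\<Sum>a\<le>N. e ^ (N - a) * e ^ (N - a)) = qn (Suc N)"
proof -
  have "(\<Sum>a\<le>N. e ^ (N - a) * e ^ (N - a)) = (\<Sum>k\<le>N. (e ^ 2) ^ k)"
    by (rule sum.reindex_bij_witness[of _ "\<lambda>a. N - a" "\<lambda>a. N - a"])
      (auto simp: power2_eq_square power_mult_distrib)
  then show ?thesis by (simp add: qn_def lessThan_Suc_atMost)
qed

lemma C_eigen:
  assumes "\<And>j. j < N \<Longrightarrow> P j z = smul e z"
  shows "C N z = smul (qn (Suc N)) z"
proof -
  have "C N z = (\<Sum>a\<le>N. smul (e ^ (N - a) * e ^ (N - a)) z)"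
    unfolding C_def by (intro sum.cong refl) (subst foldr_eigen, auto simp: assms)
  then show ?thesis by (simp add: tm.scale_sum_left[symmetric] qn_rev)
qed

lemma C'_eigen:
  assumes "\<And>j. j < N \<Longrightarrow> P j z = smul e z"
  shows "C' N z = smul (qn (Suc N)) z"
proof -
  have "C' N z = (\<Sum>a\<le>N. smul (e ^ (N - a) * e ^ (N - a)) z)"
    unfolding C'_def by (intro sum.cong refl) (subst foldr_eigen, auto simp: assms)
  then show ?thesis by (simp add: tm.scale_sum_left[symmetric] qn_rev)
qed

lemma qf_Suc: "qf (Suc N) = qf N * qn (Suc N)"
  by (simp add: qf_def)

lemma A_eigen:
  assumes "\<And>j. Suc j < N \<Longrightarrow> P j z = smul e z"
  shows "A N z = smul (qf N) z"
  using assms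
proof (induction N)
  case (Suc N)
  then have "A N z = smul (qf N) z" by simp
  moreover have "C N z = smul (qn (Suc N)) z" using Suc.prems by (intro C_eigen) simp
  ultimately show ?case
    using linop_smul[OF linop_C'(1)[OF linop_id]] by (simp add: qf_Suc)
qed (simp add: qf_def)

lemma A'_eigen:
  assumes "\<And>j. Suc j < N \<Longrightarrow> P j z = smul e z"
  shows "A' N z = smul (qf N) z"
  using assms
proof (induction N)
  case (Suc N)
  then have "A' N z = smul (qf N) z" by simp
  moreover have "C' N z = smul (qn (Suc N)) z" using Suc.prems by (intro C'_eigen) simp
  ultimately show ?case
    by (simp add: linop_smul[OF linop_A'] qf_Suc mult.commute)
qed (simp add: qf_def)

lemma foldr_absorbed:
  assumes "linop f" "w \<in> tensor_power M" "\<And>j u. j \<in> set is \<Longrightarrow> u \<in> tensor_power M \<Longrightarrow> f (P j u) = smul e (f u)"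
  shows "f (foldr P is w) = smul (e ^ length is) (f w)"
  using assms(3) by (induction "is") (simp_all add: foldr_power assms(2) mult.commute)

text \<open>Stated for an arbitrary linear f that absorbs the generators: f is \<open>A'\<close>
  here, and later the antisymmetriser of a longer tensor that has w as a factor.\<close>

lemma A_absorbed:
  assumes "linop f" "w \<in> tensor_power M" "\<And>j u. Suc j < N \<Longrightarrow> u \<in> tensor_power M \<Longrightarrow> f (P j u) = smul e (f u)"
  shows "f (A N w) = smul (qf N) (f w)"
  using assms(3)
proof (induction N)
  case (Suc N)
  have "f (foldr P [a..<N] (A N w)) = smul (e ^ (N - a)) (f (A N w))" for a
    using foldr_absorbed[OF assms(1) A_power[OF assms(2)], of "[a..<N]" N] Suc.prems by simp
  then have "f (C N (A N w)) = (\<Sum>a\<le>N. smul (e ^ (N - a) * e ^ (N - a)) (f (A N w)))"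
    by (simp add: C_def linop_simps[OF assms(1)])
  also have "\<dots> = smul (qn (Suc N)) (f (A N w))"
    by (simp add: tm.scale_sum_left[symmetric] qn_rev)
  finally show ?case using Suc by (simp add: qf_Suc mult.commute)
qed (simp add: qf_def)

text \<open>The product of \<open>A'\<close> and \<open>A\<close> is evaluated twice: the left
  factor absorbs the right one, and the right one is an eigenvector of the left. Both give the
  factor \<open>qf N\<close>, which can be cancelled.\<close>

lemma A_eq_A':
  assumes w: "w \<in> tensor_power M" and N: "N \<le> M" and "qf N \<noteq> 0"
  shows "A N w = A' N w"
proof -
  have "A' N (A N w) = smul (qf N) (A' N w)"
    by (rule A_absorbed[OF linop_A' w]) (rule A'_absorb_right[OF _ N])
  moreover have "A' N (A N w) = smul (qf N) (A N w)"
    by (rule A'_eigen) (rule A_absorb_left[OF w N])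
  ultimately show ?thesis using assms(3) by (simp add: tm.scale_left_imp_eq)
qed

lemma A_absorb_right:
  assumes "w \<in> tensor_power M" "N \<le> M" "qf N \<noteq> 0" "Suc i < N"
  shows "A N (P i w) = smul e (A N w)"
  using assms A'_absorb_right by (simp add: A_eq_A'[of _ M] P_power)

end

subsection \<open>Canonical reduced words\<close>

text \<open>
  \<open>reduced_word\<close> chooses an arbitrary shortest word.  Left multiplication by a generator turns a
  canonical word into a canonical word by braid relations, possibly after cancelling one letter;
  hence every shortest word acts like the canonical one.
\<close>

primrec cwords :: "nat \<Rightarrow> nat list set" where
  "cwords 0 = {[]}"
| "cwords (Suc N) = (\<lambda>(a, u). [a..<N] @ u) ` ({..N} \<times> cwords N)"

lemma word_perm_Nil [simp]: "word_perm [] = id"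
  and word_perm_Cons [simp]: "word_perm (i # is) = transpose i (Suc i) \<circ> word_perm is"
  by (simp_all add: word_perm_def)

lemma word_perm_append: "word_perm (u @ w) = word_perm u \<circ> word_perm w"
  by (induction u) (auto simp: comp_assoc)

lemma word_perm_permutes: "(\<And>i. i \<in> set is \<Longrightarrow> Suc i < N) \<Longrightarrow> word_perm is permutes {..<N}"
proof (induction "is")
  case (Cons i "is")
  have "Suc i < N" using Cons.prems[of i] by simp
  then have "transpose i (Suc i) permutes {..<N}" by (intro permutes_swap_id) auto
  moreover have "word_perm is permutes {..<N}" using Cons by simp
  ultimately show ?case unfolding word_perm_Cons by (intro permutes_compose)
qed (simp add: permutes_id)

lemma word_perm_upt:
  assumes "a \<le> N"
  shows "word_perm [a..<N] x = (if x = N then a else if a \<le> x \<and> x < N then Suc x else x)"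
  using assms
proof (induction a rule: inc_induct)
  case (step a)
  then have "[a..<N] = a # [Suc a..<N]" by (simp add: upt_conv_Cons)
  with step show ?case by (auto simp: transpose_def)
qed simp

lemma cwords_letters: "u \<in> cwords N \<Longrightarrow> i \<in> set u \<Longrightarrow> Suc i < N"
  by (induction N arbitrary: u) (fastforce dest: Suc_lessD)+

lemma Nil_cwords: "[] \<in> cwords N"
proof (induction N)
  case (Suc N)
  then have "(\<lambda>(a, u). [a..<N] @ u) (N, []) \<in> cwords (Suc N)"
    unfolding cwords.simps by (intro imageI) simp
  then show ?case by simp
qed simp

lemma cwords_permutes: "u \<in> cwords N \<Longrightarrow> word_perm u permutes {..<N}"
  by (rule word_perm_permutes) (rule cwords_letters)

text \<open>The image of N names the chain; dividing by the cycle of that chain leaves a permutation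
  that fixes N.\<close>

lemma cwords_surj: "\<sigma> permutes {..<N} \<Longrightarrow> \<exists>u\<in>cwords N. word_perm u = \<sigma>"
proof (induction N arbitrary: \<sigma>)
  case 0
  then show ?case by simp
next
  case (Suc N)
  define a c where "a = \<sigma> N" and "c = word_perm [a..<N]"
  have a: "a \<le> N" using permutes_in_image[OF Suc.prems, of N] by (simp add: a_def)
  have c: "c permutes {..<Suc N}" unfolding c_def by (rule word_perm_permutes) auto
  have cN: "c N = a" using word_perm_upt[OF a, of N] by (simp add: c_def)
  have "inv c \<circ> \<sigma> permutes {..<Suc N}" by (intro permutes_compose Suc.prems permutes_inv c)
  moreover have "(inv c \<circ> \<sigma>) N = N" using cN permutes_inverses(2)[OF c, of N] by (simp add: a_def)
  ultimately have "inv c \<circ> \<sigma> permutes {..<N}"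
    by (elim permutes_superset) (auto simp: less_Suc_eq)
  then obtain u where u: "u \<in> cwords N" "word_perm u = inv c \<circ> \<sigma>" using Suc.IH by blast
  then have "word_perm ([a..<N] @ u) = \<sigma>"
    unfolding word_perm_append c_def[symmetric] 
    using permutes_inv_o(1)[OF c] by (simp add: comp_assoc[symmetric])
  moreover have "[a..<N] @ u \<in> cwords (Suc N)" using a u by auto
  ultimately show ?case by blast
qed

lemma cwords_inj: "u \<in> cwords N \<Longrightarrow> u' \<in> cwords N \<Longrightarrow> word_perm u = word_perm u' \<Longrightarrow> u = u'"
proof (induction N arbitrary: u u')
  case (Suc N)
  from Suc.prems obtain a x b y where u: "u = [a..<N] @ x" "a \<le> N" "x \<in> cwords N"
    and u': "u' = [b..<N] @ y" "b \<le> N" "y \<in> cwords N" by auto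
  have fixN: "word_perm x N = N" "word_perm y N = N"
    using cwords_permutes[OF u(3)] cwords_permutes[OF u'(3)] by (auto simp: permutes_def)
  have "word_perm u N = a" "word_perm u' N = b"
    using fixN word_perm_upt[OF u(2), of N] word_perm_upt[OF u'(2), of N]
    by (simp_all add: u(1) u'(1) word_perm_append)
  with Suc.prems have "a = b" by simp
  moreover have "word_perm [a..<N] permutes {..<Suc N}" by (rule word_perm_permutes) auto
  then have "inj (word_perm [a..<N])" by (rule permutes_inj)
  ultimately have "word_perm x = word_perm y"
    using Suc.prems(3) by (auto simp: u(1) u'(1) word_perm_append fun_eq_iff inj_eq)
  with Suc.IH[OF u(3) u'(3)] \<open>a = b\<close> show ?case by (simp add: u(1) u'(1))
qed simp

lemma cwords_bij: "bij_betw word_perm (cwords N) {\<sigma>. \<sigma> permutes {..<N}}"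
  by (auto simp: bij_betw_def inj_on_def intro: cwords_inj cwords_permutes dest!: cwords_surj)

context hecke_action
begin

text \<open>In both alternatives the longer word is expressed by the shorter one, so braid relations
  suffice. The shortening alternative never has to be evaluated on operators in
  \<open>cword_shortest\<close>.\<close>

lemma cword_step:
  assumes "u \<in> cwords N" "Suc i < N"
  shows "\<exists>u'\<in>cwords N. word_perm u' = transpose i (Suc i) \<circ> word_perm u \<and>
    (length u' = Suc (length u) \<and> (\<forall>M\<ge>N. \<forall>w\<in>tensor_power M. P i (foldr P u w) = foldr P u' w) \<or>
     length u = Suc (length u') \<and> (\<forall>M\<ge>N. \<forall>w\<in>tensor_power M. P i (foldr P u' w) = foldr P u w))"
  using assms
proof (induction N arbitrary: u i)
  case (Suc N)
  from Suc.prems obtain a x where u: "u = [a..<N] @ x" "a \<le> N" "x \<in> cwords N" and i: "i < N" by auto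
  have lift: ?case
    if mem: "x' \<in> cwords N" and perm: "word_perm ([a..<N] @ x') = transpose i (Suc i) \<circ> word_perm u"
      and len: "length x' = Suc (length x) \<and> (\<forall>M\<ge>N. \<forall>w\<in>tensor_power M. P k (foldr P x w) = foldr P x' w) \<or>
        length x = Suc (length x') \<and> (\<forall>M\<ge>N. \<forall>w\<in>tensor_power M. P k (foldr P x' w) = foldr P x w)"
      and mv: "\<And>M y w. M \<ge> Suc N \<Longrightarrow> w \<in> tensor_power M \<Longrightarrow>
        P i (foldr P ([a..<N] @ y) w) = foldr P [a..<N] (P k (foldr P y w))" for x' k
  proof -
    have mem': "[a..<N] @ x' \<in> cwords (Suc N)" using mem u(2) by auto
    from len consider
      (up) "length x' = Suc (length x)" "\<forall>M\<ge>N. \<forall>w\<in>tensor_power M. P k (foldr P x w) = foldr P x' w"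
      | (down) "length x = Suc (length x')" "\<forall>M\<ge>N. \<forall>w\<in>tensor_power M. P k (foldr P x' w) = foldr P x w"
      by blast
    then show ?case
    proof cases
      case up
      have "P i (foldr P u w) = foldr P ([a..<N] @ x') w" if "M \<ge> Suc N" "w \<in> tensor_power M" for M w
        using mv[OF that, of x] up(2) that by (auto simp: u(1) dest: Suc_leD)
      moreover have "length ([a..<N] @ x') = Suc (length u)" using u(2) by (simp add: u(1) up(1))
      ultimately show ?thesis using mem' perm by blast
    next
      case down
      have "P i (foldr P ([a..<N] @ x') w) = foldr P u w" if "M \<ge> Suc N" "w \<in> tensor_power M" for M w
        using mv[OF that, of x'] down(2) that by (auto simp: u(1) dest: Suc_leD)
      moreover have "length u = Suc (length ([a..<N] @ x'))" using u(2) by (simp add: u(1) down(1))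
      ultimately show ?thesis using mem' perm by blast
    qed
  qed
  \<comment> \<open>Position of the letter relative to the chain: it commutes past it, extends it by
    one letter, cancels its first letter, or passes through it as i - 1.\<close>
  consider "Suc i < a" | "Suc i = a" | "a = i" | "a < i" by linarith
  then show ?case
  proof cases
    case 1
    then have "Suc i < N" using u by simp
    from Suc.IH[OF u(3) this] obtain x' where x': "x' \<in> cwords N" "word_perm x' = transpose i (Suc i) \<circ> word_perm x"
      "length x' = Suc (length x) \<and> (\<forall>M\<ge>N. \<forall>w\<in>tensor_power M. P i (foldr P x w) = foldr P x' w) \<or>
       length x = Suc (length x') \<and> (\<forall>M\<ge>N. \<forall>w\<in>tensor_power M. P i (foldr P x' w) = foldr P x w)" by blast
    have "transpose i (Suc i) \<circ> word_perm [a..<N] = word_perm [a..<N] \<circ> transpose i (Suc i)"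
      using 1 u(2) by (auto simp: fun_eq_iff word_perm_upt transpose_def)
    then have "word_perm ([a..<N] @ x') = transpose i (Suc i) \<circ> word_perm u"
      by (simp add: u(1) word_perm_append x'(2) comp_assoc[symmetric])
    moreover have "P i (foldr P ([a..<N] @ y) w) = foldr P [a..<N] (P i (foldr P y w))"
      if "M \<ge> Suc N" "w \<in> tensor_power M" for y w M
      using chain_far[OF foldr_power[OF that(2)], of i a N y] that 1 by simp
    ultimately show ?thesis by (intro lift[OF x'(1) _ x'(3)])
  next
    case 2
    then have eq: "[i..<N] = i # [a..<N]" using i by (simp add: upt_conv_Cons)
    have mem: "[i..<N] @ x \<in> cwords (Suc N)" using u i by auto
    show ?thesis using u mem by (intro bexI[OF _ mem]) (simp add: eq comp_assoc)
  next
    case 3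
    then have eq: "[a..<N] = i # [Suc i..<N]" using i by (simp add: upt_conv_Cons)
    have mem: "[Suc i..<N] @ x \<in> cwords (Suc N)" using u i by auto
    show ?thesis using u by (intro bexI[OF _ mem]) (simp add: eq comp_assoc[symmetric])
  next
    case 4
    then obtain k where k: "i = Suc k" by (cases i) auto
    then have "Suc k < N" using i by simp
    from Suc.IH[OF u(3) this] obtain x' where x': "x' \<in> cwords N" "word_perm x' = transpose k (Suc k) \<circ> word_perm x"
      "length x' = Suc (length x) \<and> (\<forall>M\<ge>N. \<forall>w\<in>tensor_power M. P k (foldr P x w) = foldr P x' w) \<or>
       length x = Suc (length x') \<and> (\<forall>M\<ge>N. \<forall>w\<in>tensor_power M. P k (foldr P x' w) = foldr P x w)" by blast
    have "transpose i (Suc i) \<circ> word_perm [a..<N] = word_perm [a..<N] \<circ> transpose k (Suc k)"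
      using 4 u(2) i k by (auto simp: fun_eq_iff word_perm_upt transpose_def)
    then have "word_perm ([a..<N] @ x') = transpose i (Suc i) \<circ> word_perm u"
      by (simp add: u(1) word_perm_append x'(2) comp_assoc[symmetric])
    moreover have "P i (foldr P ([a..<N] @ y) w) = foldr P [a..<N] (P k (foldr P y w))"
      if "M \<ge> Suc N" "w \<in> tensor_power M" for y w M
      using chain_shift[OF foldr_power[OF that(2)], of N k a y] that 4 i k by simp
    ultimately show ?thesis by (intro lift[OF x'(1) _ x'(3)])
  qed
qed simp

text \<open>Prepending a letter changes the canonical length by one in either direction. A word
  attains the canonical length only if every letter lengthens, and then each step is an identity of
  operators.\<close>

lemma cword_shortest:
  assumes "\<And>i. i \<in> set is \<Longrightarrow> Suc i < N" "u \<in> cwords N" "word_perm u = word_perm is"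
  shows "length u \<le> length is \<and>
    (length u = length is \<longrightarrow> (\<forall>M\<ge>N. \<forall>w\<in>tensor_power M. foldr P is w = foldr P u w))"
  using assms
proof (induction "is" arbitrary: u)
  case Nil
  have "[] \<in> cwords N" by (rule Nil_cwords)
  with Nil have "u = []" by (intro cwords_inj[of _ N]) auto
  then show ?case by simp
next
  case (Cons i "is")
  obtain x where x: "x \<in> cwords N" "word_perm x = word_perm is"
    using cwords_surj[OF word_perm_permutes[of "is" N]] Cons.prems(1) by auto
  note IH = Cons.IH[OF _ x] 
  have i: "Suc i < N" using Cons.prems(1) by simp
  obtain u' where u': "u' \<in> cwords N" "word_perm u' = transpose i (Suc i) \<circ> word_perm x"
    "length u' = Suc (length x) \<and> (\<forall>M\<ge>N. \<forall>w\<in>tensor_power M. P i (foldr P x w) = foldr P u' w) \<or>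
     length x = Suc (length u') \<and> (\<forall>M\<ge>N. \<forall>w\<in>tensor_power M. P i (foldr P u' w) = foldr P x w)"
    using cword_step[OF x(1) i] by blast
  have "u' = u" using Cons.prems u' x by (intro cwords_inj[of _ N]) auto
  then show ?case using IH u'(3) Cons.prems(1) by auto
qed

lemma A_eq_cwords: "A N w = (\<Sum>u\<in>cwords N. smul (e ^ length u) (foldr P u w))"
proof (induction N)
  case (Suc N)
  have fin: "finite (cwords N)" by (induction N) auto
  have inj: "inj_on (\<lambda>(a, u). [a..<N] @ u) ({..N} \<times> cwords N)"
  proof (rule inj_onI, clarsimp)
    fix a u b u' assume *: "a \<le> N" "b \<le> N" "u \<in> cwords N" "u' \<in> cwords N" "[a..<N] @ u = [b..<N] @ u'"
    have "word_perm u N = N" "word_perm u' N = N"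
      using cwords_permutes[OF *(3)] cwords_permutes[OF *(4)] by (auto simp: permutes_def)
    then have "a = b"
      using arg_cong[OF *(5), of "\<lambda>x. word_perm x N"] *(1,2) by (simp add: word_perm_append word_perm_upt)
    with *(5) show "a = b \<and> u = u'" by simp
  qed
  have "(\<Sum>u\<in>cwords (Suc N). smul (e ^ length u) (foldr P u w))
      = (\<Sum>x\<in>{..N} \<times> cwords N. smul (e ^ length ([fst x..<N] @ snd x)) (foldr P ([fst x..<N] @ snd x) w))"
    unfolding cwords.simps sum.reindex[OF inj] by (simp add: case_prod_unfold)
  also have "\<dots> = (\<Sum>a\<le>N. \<Sum>u\<in>cwords N. smul (e ^ (N - a) * e ^ length u) (foldr P [a..<N] (foldr P u w)))"
    by (simp only: sum.cartesian_product case_prod_unfold power_add length_append length_upt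
        foldr_append o_apply)
  finally show ?case
    unfolding A.simps C_def Suc linop_simps[OF linop_foldr'] tm.scale_sum_right by simp
qed simp

end

section \<open>Generators and their inverses as two Hecke actions, with their quantum
  integers\<close>

context wedge_setup
begin

lemma powr_not_1: "r > 0 \<Longrightarrow> v ^ r \<noteq> 1" for r :: nat
  using not_root by blast

lemma v_sq: "v ^ 2 \<noteq> 1" and inv_v_sq: "(inverse v) ^ 2 \<noteq> 1"
  using powr_not_1[of 2] by (auto simp: power_inverse)

lemma v_sum_nonzero: "v + inverse v \<noteq> 0"
proof
  assume "v + inverse v = 0"
  then have "v * (v + inverse v) = 0" by simp
  then have "v ^ 2 = -1" by (simp add: distrib_left power2_eq_square eq_neg_iff_add_eq_0)
  then have "v ^ 4 = 1" using power_mult[of v 2 2] by simp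
  then show False using powr_not_1[of 4] by simp
qed

lemma T_inv_braid:
  assumes w: "w \<in> tensor_power N" and i: "Suc (Suc i) < N"
  shows "T_inv i (T_inv (Suc i) (T_inv i w)) = T_inv (Suc i) (T_inv i (T_inv (Suc i) w))"
proof -
  have i': "Suc i < N" using i by simp
  define z where "z = T_inv i (T_inv (Suc i) (T_inv i w))"
  have z: "z \<in> tensor_power N" unfolding z_def by (intro T_inv_power w)
  have "w = T i (T (Suc i) (T i z))"
    unfolding z_def using w i i' by (simp add: T_T_inv[of _ N] T_inv_power)
  also have "\<dots> = T (Suc i) (T i (T (Suc i) z))" by (rule hecke_braid[OF z i])
  finally show ?thesis
    unfolding z_def[symmetric] using z i i' by (simp add: T_inv_T[of _ N] hecke_power)
qed

lemma T_inv_commute: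
  assumes w: "w \<in> tensor_power N" and "Suc i < k" "Suc k < N"
  shows "T_inv i (T_inv k w) = T_inv k (T_inv i w)"
  using hecke_commute[OF assms] by (simp add: T_inv_def T_simps) (rule poly_mapping_eqI, simp add: lookup_minus lookup_add algebra_simps)

sublocale H: hecke_action T v "- inverse v"
  by unfold_locales
    (simp_all add: linop_hecke hecke_power hecke_quadratic hecke_braid, rule hecke_commute)

sublocale Hi: hecke_action T_inv "inverse v" "- v"
proof unfold_locales
  show "linop (T_inv i)" for i using linop_T_inv[OF linop_id] by simp
  show "T_inv i (T_inv i w) = w + smul (inverse v - inverse (inverse v)) (T_inv i w)"
    if "w \<in> tensor_power M" "Suc i < M" for w M i
  proof -
    have "T_inv i (T_inv i w) = T i (T_inv i w) - smul h (T_inv i w)" by (simp add: T_inv_def)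
    also have "\<dots> = w - smul h (T_inv i w)" using that by (simp add: T_T_inv)
    finally show ?thesis by (simp add: tm.scale_left_diff_distrib)
  qed
qed (simp_all add: T_inv_power T_inv_braid, rule T_inv_commute)

lemma qn_minus: "H.qn N = qint_minus v N"
proof -
  have "(- inverse v) ^ 2 \<noteq> 1" using inv_v_sq by simp
  then have "H.qn N = (((- inverse v) ^ 2) ^ N - 1) / ((- inverse v) ^ 2 - 1)"
    unfolding H.qn_def by (rule geometric_sum)
  moreover have "v powi (- 2 * int N) = ((- inverse v) ^ 2) ^ N"
    by (simp add: power_int_minus power_int_mult power_inverse)
  moreover have "v powi (- 2) = (- inverse v) ^ 2"
    by (simp add: power_int_minus power_inverse)
  ultimately show ?thesis by (simp add: qint_minus_def)
qed

lemma qn_plus: "Hi.qn N = qint_plus v N"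
proof -
  have "(- v) ^ 2 \<noteq> 1" using v_sq by simp
  then have "Hi.qn N = (((- v) ^ 2) ^ N - 1) / ((- v) ^ 2 - 1)"
    unfolding Hi.qn_def by (rule geometric_sum)
  moreover have "v powi (2 * int N) = ((- v) ^ 2) ^ N"
    by (simp add: power_int_mult)
  ultimately show ?thesis by (simp add: qint_plus_def)
qed

lemma qint_minus_nonzero: "N > 0 \<Longrightarrow> qint_minus v N \<noteq> 0"
proof -
  assume N: "N > 0"
  have "v powi (- 2 * int N) = inverse (v ^ (2 * N))"
    by (simp add: power_int_minus power_int_mult power_mult)
  moreover have "v ^ (2 * N) \<noteq> 1" using N by (intro powr_not_1) simp
  moreover have "v powi (- 2) \<noteq> 1" using v_sq by (simp add: power_int_minus)
  ultimately show ?thesis by (simp add: qint_minus_def)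
qed

lemma qfact_nonzero: "H.qf N \<noteq> 0" and qfact_eq: "H.qf N = qfact_minus v N"
  by (auto simp: H.qf_def qfact_minus_def qn_minus qint_minus_nonzero)

subsection \<open>The antisymmetriser and the wedge product\<close>

lemma antisym_eq:
  assumes w: "w \<in> tensor_power M" and N: "N \<le> M"
  shows "antisym n v N w = smul (1 / H.qf N) (H.A N w)"
proof -
  have "smul ((- v) powi (- int (perm_length N (word_perm u)))) (hecke_perm n v N (word_perm u) w)
      = smul ((- inverse v) ^ length u) (foldr T u w)" if u: "u \<in> cwords N" for u
  proof -
    let ?r = "reduced_word N (word_perm u)"
    let ?Q = "\<lambda>is. (\<forall>i\<in>set is. Suc i < N) \<and> word_perm is = word_perm u"
    \<comment> \<open>The canonical word bounds the length of the chosen word from above,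
      \<open>cword_shortest\<close> from below; at equal length both act alike.\<close>
    have "?Q u" using cwords_letters[OF u] by auto
    then have r: "?Q ?r" "length ?r \<le> length u"
      unfolding reduced_word_def using arg_min_nat_lemma[of ?Q u length] by auto
    then have "length ?r = length u" "foldr T ?r w = foldr T u w"
      using H.cword_shortest[of ?r N u] u w N by auto
    then show ?thesis
      by (simp add: perm_length_def hecke_perm_def hecke_word_def power_int_minus power_inverse[symmetric])
  qed
  then show ?thesis
    unfolding antisym_def H.A_eq_cwords qfact_eq
    by (subst sum.reindex_bij_betw[OF cwords_bij, symmetric]) simp
qed

text \<open>
  One antisymmetriser for all tensor degrees at once, so that the wedge product carries no index.
\<close>

definition AS :: "tensor \<Rightarrow> tensor" where
  "AS = lin (\<lambda>t. antisym n v (length t) (basis t))"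

lemma linop_AS': "linop AS"
  unfolding AS_def by (rule linop_lin)

lemmas linop_AS [linop_intros] = linop_comp[OF linop_AS']
lemmas AS_simps = linop_simps[OF linop_AS']

lemma AS_A: "w \<in> tensor_power N \<Longrightarrow> AS w = smul (1 / H.qf N) (H.A N w)"
  unfolding tensor_power_supp
  by (rule linop_eqI[where P = "\<lambda>t. length t = N"])
    (auto intro!: linop_intros antisym_eq tensor_power_intros simp: AS_def)

lemma AS_antisym: "w \<in> tensor_power N \<Longrightarrow> AS w = antisym n v N w"
  by (simp add: AS_A antisym_eq)

lemma AS_power: "w \<in> tensor_power N \<Longrightarrow> AS w \<in> tensor_power N"
  by (simp add: AS_A H.A_power tensor_power_intros)

lemma T_AS: "w \<in> tensor_power N \<Longrightarrow> Suc i < N \<Longrightarrow> T i (AS w) = smul (- inverse v) (AS w)"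
  by (simp add: AS_A T_simps H.A_absorb_left[of _ N] mult.commute)

lemma AS_T: "w \<in> tensor_power N \<Longrightarrow> Suc i < N \<Longrightarrow> AS (T i w) = smul (- inverse v) (AS w)"
  by (simp add: AS_A[of _ N] hecke_power H.A_absorb_right[OF _ _ qfact_nonzero] mult.commute)

lemma AS_T_inv: "w \<in> tensor_power N \<Longrightarrow> Suc i < N \<Longrightarrow> AS (T_inv i w) = smul (- v) (AS w)"
  by (simp add: T_inv_def AS_simps AS_T[of _ N]) (simp add: tm.scale_left_diff_distrib)

lemma AS_eigen:
  assumes "w \<in> tensor_power N" "\<And>i. Suc i < N \<Longrightarrow> T i w = smul (- inverse v) w"
  shows "AS w = w"
  using H.A_eigen[of N w] assms by (simp add: AS_A qfact_nonzero)

lemma AS_basis_power: "AS (basis t) \<in> tensor_power (length t)"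
  by (intro AS_power tensor_power_intros) simp

lemma AS_AS [simp]: "AS (AS w) = AS w"
proof (rule linop_eqI'[where w = w])
  show "AS (AS (basis t)) = AS (basis t)" for t
    by (rule AS_eigen[OF AS_basis_power]) (rule T_AS[where N = "length t"], auto intro: tensor_power_intros)
qed (intro linop_intros)+

text \<open>The large antisymmetriser absorbs every generator of the left factor, hence its
  antisymmetriser. Together with \<open>AS_tens_right\<close> this makes the wedge product
  associative.\<close>

lemma AS_tens_left: "AS (tens (AS u) w) = AS (tens u w)"
proof (rule linop_eqI'[where w = u])
  fix s
  show "AS (tens (AS (basis s)) w) = AS (tens (basis s) w)"
  proof (rule linop_eqI'[where w = w])
    fix t
    have s: "basis s \<in> tensor_power (length s)" and t: "basis t \<in> tensor_power (length t)"
      by (auto intro: tensor_power_intros)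
    have "AS (tens (H.A (length s) (basis s)) (basis t)) = smul (H.qf (length s)) (AS (tens (basis s) (basis t)))"
    proof (rule H.A_absorbed[OF _ s])
      fix j u assume "Suc j < length s" "u \<in> tensor_power (length s)"
      then show "AS (tens (T j u) (basis t)) = smul (- inverse v) (AS (tens u (basis t)))"
        using AS_T[OF tens_power[OF _ t], of u "length s" j] by (simp add: hecke_tens_left)
    qed (intro linop_intros)+
    then show "AS (tens (AS (basis s)) (basis t)) = AS (tens (basis s) (basis t))"
      by (simp add: AS_A[OF s] tens_simps AS_simps qfact_nonzero)
  qed (intro linop_intros)+
qed (intro linop_intros)+

lemma AS_tens_right: "AS (tens u (AS w)) = AS (tens u w)"
proof (rule linop_eqI'[where w = u])
  fix s
  show "AS (tens (basis s) (AS w)) = AS (tens (basis s) w)"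
  proof (rule linop_eqI'[where w = w])
    fix t
    have s: "basis s \<in> tensor_power (length s)" and t: "basis t \<in> tensor_power (length t)"
      by (auto intro: tensor_power_intros)
    have "AS (tens (basis s) (H.A (length t) (basis t))) = smul (H.qf (length t)) (AS (tens (basis s) (basis t)))"
    proof (rule H.A_absorbed[OF _ t])
      fix j u assume "Suc j < length t" "u \<in> tensor_power (length t)"
      then show "AS (tens (basis s) (T j u)) = smul (- inverse v) (AS (tens (basis s) u))"
        using AS_T[OF tens_power[OF s], of u "length t" "length s + j"] by (simp add: hecke_tens_right[OF s])
    qed (intro linop_intros)+
    then show "AS (tens (basis s) (AS (basis t))) = AS (tens (basis s) (basis t))"
      by (simp add: AS_A[OF t] tens_simps AS_simps qfact_nonzero)
  qed (intro linop_intros)+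
qed (intro linop_intros)+

definition wdg :: "tensor \<Rightarrow> tensor \<Rightarrow> tensor" (infixl "\<odot>" 70) where
  "u \<odot> w = AS (tens u w)"

abbreviation W :: "int list \<Rightarrow> tensor" where "W t \<equiv> AS (basis t)"

lemma linop_wdg_left': "linop (\<lambda>u. u \<odot> w)" and linop_wdg_right': "linop (\<lambda>w. u \<odot> w)"
  unfolding wdg_def by (intro linop_intros)+

lemmas linop_wdg_left [linop_intros] = linop_comp[OF linop_wdg_left']
lemmas linop_wdg_right [linop_intros] = linop_comp[OF linop_wdg_right']
lemmas wdg_simps = linop_simps[OF linop_wdg_left'] linop_simps[OF linop_wdg_right']

lemma wdg_assoc: "(u \<odot> w) \<odot> z = u \<odot> (w \<odot> z)"
  by (simp add: wdg_def AS_tens_left AS_tens_right tens_assoc)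

lemma AS_wdg [simp]: "AS (u \<odot> w) = u \<odot> w"
  and wdg_AS_left [simp]: "AS u \<odot> w = u \<odot> w"
  and wdg_AS_right [simp]: "u \<odot> AS w = u \<odot> w"
  by (simp_all add: wdg_def AS_tens_left AS_tens_right)

lemma wdg_Nil_left [simp]: "basis [] \<odot> w = AS w"
  and wdg_Nil_right [simp]: "w \<odot> basis [] = AS w"
  by (simp_all add: wdg_def)

lemma W_append: "W (s @ t) = basis s \<odot> basis t"
  by (simp add: wdg_def)

lemma wdg_basis_append: "(u \<odot> basis s) \<odot> basis t = u \<odot> basis (s @ t)"
  by (metis W_append wdg_AS_right wdg_assoc)

lemma wdg_power: "u \<in> tensor_power N \<Longrightarrow> w \<in> tensor_power M \<Longrightarrow> u \<odot> w \<in> tensor_power (N + M)"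
  unfolding wdg_def by (intro AS_power tens_power)

lemma AS_psum: "AS (psum j w) = psum j (AS w)"
proof (rule linop_eqI'[where w = w])
  fix t :: "int list"
  let ?N = "length t"
  have t: "basis t \<in> tensor_power ?N" by (intro tensor_power_intros) simp
  have "foldr T is (psum j (basis t)) = psum j (foldr T is (basis t))" if "\<And>i. i \<in> set is \<Longrightarrow> Suc i < ?N" for "is"
    using that by (induction "is") (auto simp: hecke_psum[OF H.foldr_power[OF t]])
  then have "H.A ?N (psum j (basis t)) = psum j (H.A ?N (basis t))"
    by (simp add: H.A_eq_cwords psum_simps cwords_letters)
  then show "AS (psum j (basis t)) = psum j (AS (basis t))"
    by (simp add: AS_A[OF t] AS_A[OF psum_power[OF t]] psum_simps)
qed (intro linop_intros)+

lemma psum_wdg: "psum j (u \<odot> w) = psum j u \<odot> w + u \<odot> psum j w"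
  by (simp add: wdg_def AS_psum[symmetric] psum_tens AS_simps)

lemma wedge_space_iff: "w \<in> wedge_space n v N \<longleftrightarrow> w \<in> tensor_power N \<and> AS w = w"
proof
  assume "w \<in> wedge_space n v N"
  then obtain u where "u \<in> tensor_power N" "w = AS u"
    unfolding wedge_space_def by (auto simp: AS_antisym)
  then show "w \<in> tensor_power N \<and> AS w = w" by (simp add: AS_power)
next
  assume "w \<in> tensor_power N \<and> AS w = w"
  then show "w \<in> wedge_space n v N"
    unfolding wedge_space_def by (metis AS_antisym image_eqI)
qed

subsection \<open>Straightening\<close>

text \<open>Under the antisymmetriser T becomes - 1 / v. The summand s = 0 of
  \<open>hecke_less\<close> is the wedge itself; moving it to the left changes - 1 / v into -
  v.\<close>

lemma pair_less:
  assumes "t < x"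
  shows "smul (- v) (W [t, x]) = smul (if t mod int n = x mod int n then v else 1) (W [x, t])
    + smul h (\<Sum>s\<in>{s. 1 \<le> s \<and> t + int n * s < x}. W [t + int n * s, x - int n * s])"
proof -
  have tx: "basis [t, x] \<in> tensor_power 2" by (intro tensor_power_intros) simp
  let ?f = "\<lambda>s. W [t + int n * s, x - int n * s]"
  have fin: "finite {s. 1 \<le> s \<and> t + int n * s < x}"
  proof (rule finite_subset)
    show "{s. 1 \<le> s \<and> t + int n * s < x} \<subseteq> {1..x - t}"
    proof safe
      fix s :: int assume s: "1 \<le> s" "t + int n * s < x"
      then have "1 * s \<le> int n * s" using n_pos by (intro mult_right_mono) auto
      with s show "s \<in> {1..x - t}" unfolding atLeastAtMost_iff by linarith
    qed
  qed simp
  have "{s. 0 \<le> s \<and> t + int n * s < x} = insert 0 {s. 1 \<le> s \<and> t + int n * s < x}"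
    using assms by auto
  then have "(\<Sum>s\<in>{s. 0 \<le> s \<and> t + int n * s < x}. ?f s) = W [t, x] + (\<Sum>s\<in>{s. 1 \<le> s \<and> t + int n * s < x}. ?f s)"
    using fin by simp
  moreover have "smul (- inverse v) (W [t, x]) = smul (if t mod int n = x mod int n then v else 1) (W [x, t])
      + smul h (\<Sum>s\<in>{s. 0 \<le> s \<and> t + int n * s < x}. ?f s)"
    using AS_T[OF tx, of 0] hecke_less[of "[]" 0 t x "[]"] assms by (simp add: AS_simps split del: if_split)
  ultimately have "smul (- inverse v) (W [t, x]) = smul (if t mod int n = x mod int n then v else 1) (W [x, t])
      + smul h (W [t, x] + (\<Sum>s\<in>{s. 1 \<le> s \<and> t + int n * s < x}. ?f s))" by simp
  then show ?thesis
    by (simp add: tm.scale_right_distrib tm.scale_left_diff_distrib algebra_simps split del: if_split)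
qed

lemma pair_greater:
  assumes "x < t"
  shows "W [t, x] = smul (if t mod int n = x mod int n then - 1 else - v) (W [x, t])
    + smul (v * h) (\<Sum>s\<in>{s. 1 \<le> s \<and> x < t - int n * s}. W [t - int n * s, x + int n * s])"
proof -
  have tx: "basis [t, x] \<in> tensor_power 2" by (intro tensor_power_intros) simp
  let ?c = "if t mod int n = x mod int n then inverse v else 1"
  let ?S = "\<Sum>s\<in>{s. 1 \<le> s \<and> x < t - int n * s}. W [t - int n * s, x + int n * s]"
  have "smul (- inverse v) (W [t, x]) = smul ?c (W [x, t]) - smul h ?S"
    using AS_T[OF tx, of 0] hecke_greater[of "[]" 0 x t "[]"] assms by (simp add: AS_simps split del: if_split)
  then have "smul (- v) (smul (- inverse v) (W [t, x])) = smul (- v) (smul ?c (W [x, t]) - smul h ?S)" by simp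
  moreover have "smul (- v) (smul (- inverse v) (W [t, x])) = W [t, x]"
    unfolding tm.scale_scale by simp
  moreover have "smul (- v) (smul ?c (W [x, t]) - smul h ?S)
      = smul (if t mod int n = x mod int n then - 1 else - v) (W [x, t]) + smul (v * h) ?S"
    unfolding tm.scale_right_diff_distrib tm.scale_scale by (auto simp: mult.commute)
  ultimately show ?thesis by simp
qed

text \<open>T would act on this wedge by v and by - 1 / v, which are different.\<close>

lemma pair_equal: "W [t, t] = 0"
proof -
  have tx: "basis [t, t] \<in> tensor_power 2" by (intro tensor_power_intros) simp
  have "smul (- inverse v) (W [t, t]) = smul v (W [t, t])"
    using AS_T[OF tx, of 0] hecke_equal[of "[]" 0 t "[]"] by (simp add: AS_simps)
  then have "smul (v + inverse v) (W [t, t]) = 0"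
    by (simp add: tm.scale_left_distrib) (metis add.left_inverse add.commute)
  then show ?thesis using v_sum_nonzero by simp
qed

text \<open>Straightening moves two indices towards each other by the same amount, so it preserves
  all three conditions. They are the invariants behind every degree argument below.\<close>

definition box :: "int \<Rightarrow> int \<Rightarrow> int \<Rightarrow> nat \<Rightarrow> int list \<Rightarrow> bool" where
  "box a b \<sigma> N t \<longleftrightarrow> length t = N \<and> set t \<subseteq> {a..<b} \<and> sum_list t = \<sigma>"

text \<open>
  Straightening terminates since rewriting an adjacent descent either decreases the sum of squares
  or keeps it and increases \<open>wsum\<close>, which is bounded.
\<close>

fun wsum :: "int list \<Rightarrow> int" where
  "wsum [] = 0" | "wsum (x # xs) = wsum xs + sum_list xs"

lemma wsum_append: "wsum (xs @ ys) = wsum xs + wsum ys + int (length xs) * sum_list ys"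
  by (induction xs) (auto simp: algebra_simps)

lemma wsum_bound: "(\<And>x. x \<in> set xs \<Longrightarrow> 0 \<le> x) \<Longrightarrow> wsum xs \<le> int (length xs) * sum_list xs"
proof (induction xs)
  case (Cons x xs)
  then have "wsum xs \<le> int (length xs) * sum_list xs" "0 \<le> x" by auto
  moreover have "0 \<le> int (length xs) * x" using \<open>0 \<le> x\<close> by simp
  moreover have "int (length (x # xs)) * sum_list (x # xs)
      = int (length xs) * sum_list xs + (sum_list xs + x) + int (length xs) * x"
    by (simp add: algebra_simps)
  ultimately show ?case unfolding wsum.simps by linarith
qed simp

lemma not_sorted_wrt_adjacent:
  "\<not> sorted_wrt (<) t \<Longrightarrow> \<exists>ps a b qs. t = ps @ [a, b] @ qs \<and> b \<le> (a :: int)"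
proof (induction t)
  case (Cons x t)
  show ?case
  proof (cases "sorted_wrt (<) t")
    case True
    then obtain y t' where t: "t = y # t'" using Cons.prems by (cases t) auto
    have "y \<le> x"
    proof (rule ccontr)
      assume "\<not> y \<le> x"
      then have "sorted_wrt (<) (x # t)" using True t by auto
      with Cons.prems show False by simp
    qed
    then have "x # t = [] @ [x, y] @ t' \<and> y \<le> x" using t by simp
    then show ?thesis by blast
  next
    case False
    then obtain ps a b qs where "t = ps @ [a, b] @ qs \<and> b \<le> a" using Cons.IH by blast
    then have "x # t = (x # ps) @ [a, b] @ qs \<and> b \<le> a" by simp
    then show ?thesis by blast
  qed
qed simp

lemma W_pair_expand: "W (ps @ [a, b] @ qs) = (basis ps \<odot> W [a, b]) \<odot> basis qs"
  by (metis W_append append_assoc wdg_AS_left wdg_AS_right wdg_basis_append)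

lemma W_pair_sum:
  assumes "W [a, b] = smul c (W [b, a]) + smul d (\<Sum>s\<in>S. W [f s, g s])"
  shows "W (ps @ [a, b] @ qs) = smul c (W (ps @ [b, a] @ qs)) + smul d (\<Sum>s\<in>S. W (ps @ [f s, g s] @ qs))"
  unfolding W_pair_expand assms by (simp only: wdg_simps)

lemma straighten:
  assumes "box a b \<sigma> N t"
  shows "W t \<in> tm.span {W s |s. sorted_wrt (<) s \<and> box a b \<sigma> N s}" (is "_ \<in> ?S")
proof -
  define f where "f t = nat (\<Sum>x\<leftarrow>t. x ^ 2)" for t :: "int list"
  \<comment> \<open>The gap between \<open>wsum\<close> and its upper bound
    \<open>wsum_bound\<close>; indices are shifted by a to make them nonnegative, as that bound
    requires.\<close>
  define g where "g t = nat (int N * (\<sigma> - int N * a) - wsum (map (\<lambda>x. x - a) t))" for t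
  have sl: "sum_list (map (\<lambda>x. x - a) xs) = sum_list xs - int (length xs) * a" for xs
    by (induction xs) (auto simp: algebra_simps)
  have "wf (measures [f, g])" by simp
  then show ?thesis using assms
  proof (induction t rule: wf_induct_rule)
    case (less t)
    show ?case
    proof (cases "sorted_wrt (<) t")
      case True
      then show ?thesis using less.prems by (intro tm.span_base) auto
    next
      case False
      then obtain ps x y qs where t: "t = ps @ [x, y] @ qs" and yx: "y \<le> x"
        using not_sorted_wrt_adjacent by blast
      show ?thesis
      proof (cases "x = y")
        case True
        then show ?thesis using pair_equal by (simp add: t W_pair_expand wdg_simps tm.span_zero del: append_Cons)
      next
        case False
        then have yx: "y < x" using yx by simp
        have swap: "W (ps @ [y, x] @ qs) \<in> ?S"
        proof (rule less.IH)
          show bx: "box a b \<sigma> N (ps @ [y, x] @ qs)" using less.prems by (auto simp: t box_def)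
          have "g (ps @ [y, x] @ qs) < g t"
          proof -
            let ?m = "map (\<lambda>x. x - a)"
            have "wsum (?m (ps @ [y, x] @ qs)) = wsum (?m t) + (x - y)"
              by (simp add: t wsum_append algebra_simps)
            moreover have "wsum (?m (ps @ [y, x] @ qs)) \<le> int N * (\<sigma> - int N * a)"
              using wsum_bound[of "?m (ps @ [y, x] @ qs)"] bx
              by (force simp: box_def sl simp del: map_append)
            ultimately show ?thesis using yx by (simp add: g_def)
          qed
          moreover have "f (ps @ [y, x] @ qs) = f t" by (simp add: f_def t algebra_simps)
          ultimately show "(ps @ [y, x] @ qs, t) \<in> measures [f, g]" by simp
        qed
        have inner: "W (ps @ [x - d, y + d] @ qs) \<in> ?S" if d: "0 < d" "y < x - d" for d
        proof (rule less.IH)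
          show "box a b \<sigma> N (ps @ [x - d, y + d] @ qs)"
            using less.prems d by (auto simp: t box_def)
          have "(x - d) ^ 2 + (y + d) ^ 2 = x ^ 2 + y ^ 2 - 2 * (d * (x - y - d))"
            by (simp add: power2_eq_square algebra_simps)
          moreover have "d * (x - y - d) > 0"
            by (rule mult_pos_pos) (use d in linarith)+
          ultimately have lt: "(x - d) ^ 2 + (y + d) ^ 2 < x ^ 2 + y ^ 2" by linarith
          define q where "q xs = (\<Sum>x\<leftarrow>xs. x ^ 2)" for xs :: "int list"
          have qa: "q (ps @ [c, d] @ qs) = q ps + q qs + (c ^ 2 + d ^ 2)" for c d
            by (simp add: q_def)
          have qn: "q xs \<ge> 0" for xs unfolding q_def by (intro sum_list_nonneg) auto
          have "q (ps @ [x - d, y + d] @ qs) < q t" unfolding t qa using lt by linarith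
          then have "f (ps @ [x - d, y + d] @ qs) < f t"
            unfolding f_def q_def[symmetric] using qn[of "ps @ [x - d, y + d] @ qs"] by linarith
          then show "(ps @ [x - d, y + d] @ qs, t) \<in> measures [f, g]" by simp
        qed
        have inner': "W (ps @ [x - int n * s, y + int n * s] @ qs) \<in> ?S"
          if "s \<in> {s. 1 \<le> s \<and> y < x - int n * s}" for s
        proof (rule inner)
          show "0 < int n * s" by (rule mult_pos_pos) (use that n_pos in simp_all)
          show "y < x - int n * s" using that by simp
        qed
        show ?thesis
          unfolding t W_pair_sum[OF pair_greater[OF yx]]
          by (intro tm.span_add tm.span_scale tm.span_sum swap inner')
      qed
    qed
  qed
qed

lemma straighten_supp:
  assumes "supp (box a b \<sigma> N) w"
  shows "AS w \<in> tm.span {W s |s. sorted_wrt (<) s \<and> box a b \<sigma> N s}"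
  by (subst basis_expansion[of w]) 
    (use assms straighten in \<open>auto simp: AS_simps supp_def intro!: tm.span_sum tm.span_scale\<close>)

lemma sorted_full:
  assumes "sorted_wrt (<) s" "set s \<subseteq> {a..<b}" "int (length s) = b - a"
  shows "s = [a..b - 1]"
proof -
  have d: "sorted s" "distinct s" using assms(1) by (auto simp: strict_sorted_iff)
  have "card (set s) = card {a..<b}" using assms(3) distinct_card[OF d(2)] by simp
  then have "set s = {a..<b}" using assms(2) by (intro card_subset_eq) simp_all
  also have "\<dots> = set [a..b - 1]" by auto
  finally show ?thesis by (intro sorted_distinct_set_unique d) simp_all
qed

lemma sorted_too_long:
  assumes "sorted_wrt (<) s" "set s \<subseteq> {a..<b}" "a \<le> b"
  shows "int (length s) \<le> b - a"
proof -
  have "distinct s" using assms(1) by (simp add: strict_sorted_iff)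
  then have "length s = card (set s)" by (simp add: distinct_card)
  also have "\<dots> \<le> card {a..<b}" using assms(2) by (intro card_mono) auto
  finally show ?thesis using assms(3) by simp
qed

text \<open>Pigeonhole: no increasing list of that length fits into the interval, so the span in
  \<open>straighten\<close> is zero.\<close>

lemma W_too_long:
  assumes "set t \<subseteq> {a..<b}" "a \<le> b" "int (length t) > b - a"
  shows "W t = 0"
proof -
  have "\<not> (sorted_wrt (<) s \<and> box a b (sum_list t) (length t) s)" for s
    using sorted_too_long[of s a b] assms(2,3) by (auto simp: box_def)
  then have eq: "{W s |s. sorted_wrt (<) s \<and> box a b (sum_list t) (length t) s} = {}" by simp
  have "box a b (sum_list t) (length t) t" using assms by (simp add: box_def)
  from straighten[OF this] show ?thesis unfolding eq by simp
qed

text \<open>The only increasing list that fills the interval is the run, and it has a different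
  sum.\<close>

lemma W_wrong_sum:
  assumes "set t \<subseteq> {a..<b}" "int (length t) = b - a" "sum_list t \<noteq> sum_list [a..b - 1]"
  shows "W t = 0"
proof -
  have "\<not> (sorted_wrt (<) s \<and> box a b (sum_list t) (length t) s)" for s
    using sorted_full[of s a b] assms(2,3) by (auto simp: box_def)
  then have eq: "{W s |s. sorted_wrt (<) s \<and> box a b (sum_list t) (length t) s} = {}" by simp
  have "box a b (sum_list t) (length t) t" using assms by (simp add: box_def)
  from straighten[OF this] show ?thesis unfolding eq by simp
qed

lemma supp_box_full:
  assumes "supp (box a b \<sigma> N) w" "int N = b - a"
  obtains \<mu> where "AS w = smul \<mu> (W [a..b - 1])"
proof -
  have "s = [a..b - 1]" if "sorted_wrt (<) s" "box a b \<sigma> N s" for s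
    using sorted_full[of s a b] assms(2) that by (auto simp: box_def)
  then have "{W s |s. sorted_wrt (<) s \<and> box a b \<sigma> N s} \<subseteq> {W [a..b - 1]}" by auto
  then have "AS w \<in> tm.span {W [a..b - 1]}"
    using straighten_supp[OF assms(1)] tm.span_mono by blast
  then show ?thesis using that by (auto simp: tm.span_singleton)
qed

lemma supp_box_hecke:
  assumes "supp (box a b \<sigma> N) w" "Suc i < N"
  shows "supp (box a b \<sigma> N) (T i w)"
proof (rule supp_linop[OF linop_hecke assms(1)])
  fix t assume t: "box a b \<sigma> N t"
  then obtain ps x y qs where p: "t = ps @ [x, y] @ qs" "length ps = i"
    using split_at_two[of i t] assms(2) by (metis box_def)
  have ns: "s \<ge> 0 \<Longrightarrow> int n * s \<ge> 0" for s using n_pos by simp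
  consider "x = y" | "x < y" | "y < x" by linarith
  then show "supp (box a b \<sigma> N) (T i (basis t))"
  proof cases
    case 1
    then show ?thesis using t p hecke_equal[of ps i x qs] by (auto intro!: supp_intros)
  next
    case 2
    show ?thesis unfolding p(1) hecke_less[OF p(2) 2]
    proof (intro supp_intros)
      show "supp (box a b \<sigma> N) (basis (ps @ [y, x] @ qs))" using t by (auto simp: box_def p)
      show "supp (box a b \<sigma> N) (basis (ps @ [x + int n * s, y - int n * s] @ qs))"
        if s: "s \<in> {s. 0 \<le> s \<and> x + int n * s < y}" for s
      proof -
        obtain d where d: "d = int n * s" by simp
        have "0 \<le> d" unfolding d by (rule ns) (use s in simp)
        moreover have "x + d < y" using s unfolding d by simp
        ultimately show ?thesis using t unfolding d[symmetric] by (auto simp: box_def p)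
      qed
    qed
  next
    case 3
    show ?thesis unfolding p(1) hecke_greater[OF p(2) 3]
    proof (intro supp_intros)
      show "supp (box a b \<sigma> N) (basis (ps @ [y, x] @ qs))" using t by (auto simp: box_def p)
      show "supp (box a b \<sigma> N) (basis (ps @ [x - int n * s, y + int n * s] @ qs))"
        if s: "s \<in> {s. 1 \<le> s \<and> y < x - int n * s}" for s
      proof -
        obtain d where d: "d = int n * s" by simp
        have "0 \<le> d" unfolding d by (rule ns) (use s in simp)
        moreover have "y < x - d" using s unfolding d by simp
        ultimately show ?thesis using t unfolding d[symmetric] by (auto simp: box_def p)
      qed
    qed
  qed
qed

text \<open>Controls the individual components of an antisymmetrised tensor, which are what the
  coordinate functionals see.\<close>

lemma supp_box_AS:
  assumes "supp (box a b \<sigma> N) w"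
  shows "supp (box a b \<sigma> N) (AS w)"
proof -
  have w: "w \<in> tensor_power N"
    using assms by (auto simp: tensor_power_supp box_def elim: supp_mono)
  have "supp (box a b \<sigma> N) (foldr T is w)" if "\<And>i. i \<in> set is \<Longrightarrow> Suc i < N" for "is"
    using that by (induction "is") (auto intro: supp_box_hecke assms)
  then show ?thesis
    unfolding AS_A[OF w] H.A_eq_cwords by (intro supp_intros) (auto simp: cwords_letters)
qed

end

context wedge_setup
begin

subsection \<open>Wedges of consecutive vectors\<close>

abbreviation run :: "int \<Rightarrow> int \<Rightarrow> int list" where "run a b \<equiv> [a..b - 1]"

lemma run_append: "a \<le> b \<Longrightarrow> b \<le> c \<Longrightarrow> run a b @ run b c = run a c"
  using upto_split1[of a b "c - 1"] by (cases "b = c") auto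

lemma run_snoc: "a \<le> b \<Longrightarrow> run a (b + 1) = run a b @ [b]"
  using upto_rec2[of a b] by simp

lemma run_Cons: "a < b \<Longrightarrow> run a b = a # run (a + 1) b"
  using upto_rec1[of a "b - 1"] by simp

lemma run_append': "a \<le> b \<Longrightarrow> b \<le> c \<Longrightarrow> run a b @ run b c @ qs = run a c @ qs"
  using run_append[of a b c] by simp

lemma run_resplit:
  "a \<le> b \<Longrightarrow> b \<le> c \<Longrightarrow> a \<le> b' \<Longrightarrow> b' \<le> c \<Longrightarrow> run a b @ run b c @ qs = run a b' @ run b' c @ qs"
  by (simp only: run_append append_assoc[symmetric])

lemma wdg_kill: "W t = 0 \<Longrightarrow> u \<odot> basis (ps @ t @ qs) = 0"
proof -
  assume "W t = 0"
  have "u \<odot> basis (ps @ t @ qs) = ((u \<odot> basis ps) \<odot> W t) \<odot> basis qs"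
    by (simp only: wdg_AS_right wdg_basis_append append_assoc)
  then show ?thesis by (simp add: \<open>W t = 0\<close> wdg_simps)
qed

lemma kill_after: "a \<le> x \<Longrightarrow> x < b \<Longrightarrow> W (run a b @ [x]) = 0"
  by (rule W_too_long[of _ a b]) auto

lemma kill_before: "a \<le> x \<Longrightarrow> x < b \<Longrightarrow> W (x # run a b) = 0"
  by (rule W_too_long[of _ a b]) auto

lemma psum_run:
  assumes "p \<le> q"
  shows "psum j (basis (run p q)) = (\<Sum>y\<in>{p..<q}. basis (run p y @ (y + int n * j) # run (y + 1) q))"
  using assms
proof (induction q rule: int_ge_induct)
  case (step q)
  have eq: "basis (run p (q + 1)) = tens (basis (run p q)) (basis [q])"
    using run_snoc[of p q] step.hyps by simp
  have "psum j (basis (run p (q + 1)))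
      = (\<Sum>y\<in>{p..<q}. basis ((run p y @ (y + int n * j) # run (y + 1) q) @ [q]))
        + basis (run p q @ [q + int n * j])"
    unfolding eq psum_tens unfolding step.IH psum_single tens_simps tens_basis ..
  also have "(\<Sum>y\<in>{p..<q}. basis ((run p y @ (y + int n * j) # run (y + 1) q) @ [q]))
      = (\<Sum>y\<in>{p..<q}. basis (run p y @ (y + int n * j) # run (y + 1) (q + 1)))"
    by (intro sum.cong refl) (use run_snoc[of _ q] in simp)
  also have "\<dots> + basis (run p q @ [q + int n * j])
      = (\<Sum>y\<in>insert q {p..<q}. basis (run p y @ (y + int n * j) # run (y + 1) (q + 1)))"
    by simp
  also have "insert q {p..<q} = {p..<q + 1}" using step by auto
  finally show ?case .
qed simp

lemma shift_pos: "j > 0 \<Longrightarrow> 0 < int n * j"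
  using n_pos by simp

text \<open>A raised vector meets its own copy among the next nj vectors: these lie in the rest of
  the run or in the run that follows it.\<close>

lemma psum_run_tail:
  assumes "p \<le> q" "j > 0"
  shows "(u \<odot> psum j (basis (run p q))) \<odot> basis (run q (q + int n * j) @ qs) = 0"
proof -
  obtain d where d: "d = int n * j" by simp
  then have d0: "d > 0" using assms shift_pos by simp
  have "(u \<odot> basis (run p y @ (y + d) # run (y + 1) q)) \<odot> basis (run q (q + d) @ qs) = 0"
    if "y \<in> {p..<q}" for y
  proof -
    have "run (y + 1) q @ run q (q + d) @ qs = run (y + 1) (y + d + 1) @ run (y + d + 1) (q + d) @ qs"
      by (rule run_resplit) (use that d0 in auto)
    then have "(u \<odot> basis (run p y @ (y + d) # run (y + 1) q)) \<odot> basis (run q (q + d) @ qs)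
        = u \<odot> basis (run p y @ ((y + d) # run (y + 1) (y + d + 1)) @ (run (y + d + 1) (q + d) @ qs))"
      by (simp only: wdg_basis_append append_assoc append_Cons)
    also have "\<dots> = 0" using d0 by (intro wdg_kill kill_before) auto
    finally show ?thesis .
  qed
  then show ?thesis
    unfolding d[symmetric] psum_run[OF assms(1)] by (simp add: wdg_simps)
qed

text \<open>
  \<open>e\<^sub>b \<and> e\<^sub>a = cc (b - a) e\<^sub>a \<and> e\<^sub>b\<close> for \<open>a < b\<close>, up to terms that vanish next to a suitable wedge of
  consecutive vectors.
\<close>

definition cc :: "int \<Rightarrow> complex" where
  "cc d = (if int n dvd d then - 1 else - v)"

lemma cc_nonzero: "cc d \<noteq> 0"
  by (simp add: cc_def)

lemma mod_eq_dvd: "x mod int n = y mod int n \<longleftrightarrow> int n dvd (x - y)"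
  by (rule mod_eq_dvd_iff)

lemma pair_greater':
  assumes "x < t"
  shows "W [t, x] = smul (cc (t - x)) (W [x, t])
    + smul (v * h) (\<Sum>s\<in>{s. 1 \<le> s \<and> x < t - int n * s}. W [t - int n * s, x + int n * s])"
  using pair_greater[OF assms] by (simp add: cc_def mod_eq_dvd)

lemma shift_inner:
  assumes "s \<in> {s. 1 \<le> s \<and> x < t - int n * s}"
  obtains d where "d = int n * s" "0 < d" "x < t - d"
  using assms shift_pos[of s] by auto

text \<open>Every inner pair of the straightening relation starts with a vector that already occurs
  in the run before it.\<close>

lemma exchange_after_run:
  assumes "k < x"
  shows "u \<odot> basis (run (k + 1) x @ [x, k] @ qs) = smul (cc (x - k)) (u \<odot> basis (run (k + 1) x @ [k, x] @ qs))"
proof -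
  have "u \<odot> basis (run (k + 1) x @ [x - int n * s, k + int n * s] @ qs) = 0"
    if "s \<in> {s. 1 \<le> s \<and> k < x - int n * s}" for s
  proof -
    from that obtain d where d: "d = int n * s" "0 < d" "k < x - d" by (rule shift_inner)
    have "u \<odot> basis ([] @ (run (k + 1) x @ [x - d]) @ ([k + d] @ qs)) = 0"
      using d by (intro wdg_kill kill_after) auto
    then show ?thesis by (simp add: d(1))
  qed
  then have "u \<odot> W (run (k + 1) x @ [x - int n * s, k + int n * s] @ qs) = 0"
    if "s \<in> {s. 1 \<le> s \<and> k < x - int n * s}" for s
    using that by (simp only: wdg_AS_right)
  then have "u \<odot> W (run (k + 1) x @ [x, k] @ qs) = smul (cc (x - k)) (u \<odot> W (run (k + 1) x @ [k, x] @ qs))"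
    unfolding W_pair_sum[OF pair_greater'[OF assms]] wdg_simps by simp
  then show ?thesis by (simp only: wdg_AS_right)
qed

lemma exchange_before_run:
  assumes "k < x"
  shows "u \<odot> basis ([x, k] @ run (k + 1) x @ qs) = smul (cc (x - k)) (u \<odot> basis ([k, x] @ run (k + 1) x @ qs))"
proof -
  have "u \<odot> W ([] @ [x - int n * s, k + int n * s] @ run (k + 1) x @ qs) = 0"
    if "s \<in> {s. 1 \<le> s \<and> k < x - int n * s}" for s
  proof -
    from that obtain d where d: "d = int n * s" "0 < d" "k < x - d" by (rule shift_inner)
    have "u \<odot> basis ([x - d] @ ((k + d) # run (k + 1) x) @ qs) = 0"
      using d by (intro wdg_kill kill_before) auto
    then show ?thesis by (simp only: wdg_AS_right) (simp add: d(1))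
  qed
  then have "u \<odot> W ([] @ [x, k] @ run (k + 1) x @ qs) = smul (cc (x - k)) (u \<odot> W ([] @ [k, x] @ run (k + 1) x @ qs))"
    unfolding W_pair_sum[OF pair_greater'[OF assms]] wdg_simps by simp
  then show ?thesis by (simp only: wdg_AS_right append_Nil)
qed

lemma move_left:
  assumes "k + 1 \<le> b"
  shows "u \<odot> basis (run (k + 1) b @ k # qs) = smul (\<Prod>x\<in>{k + 1..<b}. cc (x - k)) (u \<odot> basis (run k b @ qs))"
  using assms
proof (induction b arbitrary: qs rule: int_ge_induct)
  case base
  then show ?case using run_Cons[of k "k + 1"] by simp
next
  case (step b)
  have "u \<odot> basis (run (k + 1) (b + 1) @ k # qs) = u \<odot> basis (run (k + 1) b @ [b, k] @ qs)"
    using run_snoc[of "k + 1" b] step by simp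
  also have "\<dots> = smul (cc (b - k)) (u \<odot> basis (run (k + 1) b @ [k, b] @ qs))"
    using step by (intro exchange_after_run) simp
  also have "u \<odot> basis (run (k + 1) b @ [k, b] @ qs)
      = smul (\<Prod>x\<in>{k + 1..<b}. cc (x - k)) (u \<odot> basis (run k b @ b # qs))"
    using step.IH[of "b # qs"] by simp
  also have "run k b @ b # qs = run k (b + 1) @ qs" using run_snoc[of k b] step by simp
  finally have "u \<odot> basis (run (k + 1) (b + 1) @ k # qs)
      = smul (cc (b - k) * (\<Prod>x\<in>{k + 1..<b}. cc (x - k))) (u \<odot> basis (run k (b + 1) @ qs))"
    by simp
  also have "cc (b - k) * (\<Prod>x\<in>{k + 1..<b}. cc (x - k)) = (\<Prod>x\<in>insert b {k + 1..<b}. cc (x - k))"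
    by simp
  also have "insert b {k + 1..<b} = {k + 1..<b + 1}" using step by auto
  finally show ?case .
qed

lemma move_right:
  assumes "p \<le> x"
  shows "u \<odot> basis (x # run p x @ qs) = smul (\<Prod>y\<in>{p..<x}. cc (x - y)) (u \<odot> basis (run p (x + 1) @ qs))"
  using assms
proof (induction p arbitrary: u rule: int_le_induct)
  case base
  then show ?case using run_Cons[of x "x + 1"] by simp
next
  case (step p)
  have "u \<odot> basis (x # run (p - 1) x @ qs) = u \<odot> basis ([x, p - 1] @ run (p - 1 + 1) x @ qs)"
    using run_Cons[of "p - 1" x] step by simp
  also have "\<dots> = smul (cc (x - (p - 1))) (u \<odot> basis ([p - 1, x] @ run (p - 1 + 1) x @ qs))"
    using step by (intro exchange_before_run) simp
  also have "u \<odot> basis ([p - 1, x] @ run (p - 1 + 1) x @ qs) = (u \<odot> basis [p - 1]) \<odot> basis (x # run p x @ qs)"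
    unfolding wdg_basis_append by simp
  also have "\<dots> = smul (\<Prod>y\<in>{p..<x}. cc (x - y)) ((u \<odot> basis [p - 1]) \<odot> basis (run p (x + 1) @ qs))"
    by (rule step.IH)
  also have "(u \<odot> basis [p - 1]) \<odot> basis (run p (x + 1) @ qs) = u \<odot> basis (run (p - 1) (x + 1) @ qs)"
    unfolding wdg_basis_append using run_Cons[of "p - 1" "x + 1"] step by simp
  finally have "u \<odot> basis (x # run (p - 1) x @ qs)
      = smul (cc (x - (p - 1)) * (\<Prod>y\<in>{p..<x}. cc (x - y))) (u \<odot> basis (run (p - 1) (x + 1) @ qs))"
    by simp
  also have "cc (x - (p - 1)) * (\<Prod>y\<in>{p..<x}. cc (x - y)) = (\<Prod>y\<in>insert (p - 1) {p..<x}. cc (x - y))"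
    by simp
  also have "insert (p - 1) {p..<x} = {p - 1..<x}" using step by auto
  finally show ?case .
qed

text \<open>Each block of n consecutive distances contains one multiple of n, with factor - 1, and n
  - 1 other distances with factor - v.\<close>

lemma cc_block: "(\<Prod>i=1..int n * int j. cc i) = ((- v) ^ (n - 1) * (- 1)) ^ j"
proof (induction j)
  case (Suc j)
  obtain a m where a: "a = int n * int j" and m: "m = int n" by simp
  have n: "m > 0" and a0: "a \<ge> 0" using n_pos by (simp_all add: a m)
  have am: "int n * int (Suc j) = a + m" by (simp add: a m algebra_simps)
  have set: "{1..a + m} = {1..a} \<union> insert (a + m) {a + 1..a + m - 1}"
    using n a0 by auto
  have "cc i = - v" if i: "i \<in> {a + 1..a + m - 1}" for i
  proof -
    have "\<not> int n dvd i - a" using i by (intro zdvd_not_zless) (auto simp: m)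
    moreover have "int n dvd a" by (simp add: a)
    ultimately have "\<not> int n dvd i" by (metis dvd_diff)
    then show ?thesis by (simp add: cc_def)
  qed
  then have "(\<Prod>i\<in>{a + 1..a + m - 1}. cc i) = (- v) ^ card {a + 1..a + m - 1}" by simp
  also have "card {a + 1..a + m - 1} = n - 1" by (simp add: m)
  finally have inner: "(\<Prod>i\<in>{a + 1..a + m - 1}. cc i) = (- v) ^ (n - 1)" .
  have "(\<Prod>i=1..a + m. cc i) = (\<Prod>i=1..a. cc i) * (cc (a + m) * (\<Prod>i\<in>{a + 1..a + m - 1}. cc i))"
    unfolding set using n a0 by (subst prod.union_disjoint) auto
  also have "cc (a + m) = - 1" by (simp add: cc_def a m)
  finally show ?case unfolding am inner Suc[folded a] by simp
qed simp

text \<open>The exchange factor over the distances 1, ..., nj - 1: the product in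
  \<open>cc_block\<close> divided by the factor - 1 of the distance nj.\<close>

definition \<eta> :: "nat \<Rightarrow> complex" where
  "\<eta> j = - (((- v) ^ (n - 1) * (- 1)) ^ j)"

lemma eta_prod:
  assumes "j > 0"
  shows "(\<Prod>y\<in>{k + 1..<k + int n * int j}. cc (k + int n * int j - y)) = \<eta> j"
proof -
  obtain d where d: "d = int n * int j" by simp
  then have d0: "d > 0" using shift_pos[of "int j"] assms by simp
  have "(\<Prod>y\<in>{k + 1..<k + d}. cc (k + d - y)) = (\<Prod>i\<in>{1..d - 1}. cc i)"
    by (rule prod.reindex_bij_witness[of _ "\<lambda>i. k + d - i" "\<lambda>y. k + d - y"]) auto
  moreover have "(\<Prod>i=1..d. cc i) = cc d * (\<Prod>i\<in>{1..d - 1}. cc i)"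
  proof -
    have "{1..d} = insert d {1..d - 1}" using d0 by auto
    then show ?thesis by simp
  qed
  moreover have "cc d = - 1" by (simp add: cc_def d)
  ultimately show ?thesis unfolding d \<eta>_def cc_block[symmetric] by simp
qed

text \<open>Only the raised first vector survives; it lands in the hole at k' after crossing its nj
  - 1 neighbours.\<close>

lemma psum_hole:
  assumes k': "k' = k + int n * int j" and j: "j > 0" and b: "k' < b"
  shows "(u \<odot> psum (int j) (basis (run k k' @ run (k' + 1) b))) \<odot> basis (run b (b + int n * int j))
    = smul (\<eta> j) (u \<odot> basis (run (k + 1) (b + int n * int j)))"
proof -
  obtain d where d: "d = int n * int j" by simp
  then have d0: "d > 0" using shift_pos[of "int j"] j by simp
  have k'd: "k' = k + d" using k' d by simp
  let ?tail = "run b (b + d)"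
  have hole: "basis (run k k' @ run (k' + 1) b) = tens (basis [k]) (tens (basis (run (k + 1) k')) (basis (run (k' + 1) b)))"
    using run_Cons[of k k'] k'd d0 by simp
  have le: "k + 1 \<le> k'" "k' + 1 \<le> b" using k'd d0 b by auto
  have ps: "psum (int j) (basis (run k k' @ run (k' + 1) b))
      = basis (k' # run (k + 1) k' @ run (k' + 1) b)
        + ((\<Sum>y\<in>{k + 1..<k'}. basis (k # run (k + 1) y @ (y + d) # run (y + 1) k' @ run (k' + 1) b))
        + (\<Sum>y\<in>{k' + 1..<b}. basis (k # run (k + 1) k' @ run (k' + 1) y @ (y + d) # run (y + 1) b)))"
    unfolding hole psum_tens
    unfolding psum_single psum_run[OF le(1)] psum_run[OF le(2)] tens_simps tens_basis
      d[symmetric] k'd[symmetric] by simp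
  have 1: "(u \<odot> basis (k' # run (k + 1) k' @ run (k' + 1) b)) \<odot> basis ?tail
      = smul (\<eta> j) (u \<odot> basis (run (k + 1) (b + d)))"
  proof -
    have "(u \<odot> basis (k' # run (k + 1) k' @ run (k' + 1) b)) \<odot> basis ?tail
      = u \<odot> basis (k' # run (k + 1) k' @ (run (k' + 1) b @ ?tail))"
      unfolding wdg_basis_append by simp
    also have "\<dots> = smul (\<Prod>y\<in>{k + 1..<k'}. cc (k' - y)) (u \<odot> basis (run (k + 1) (k' + 1) @ (run (k' + 1) b @ ?tail)))"
      using k'd d0 by (intro move_right) simp
    also have "run (k + 1) (k' + 1) @ (run (k' + 1) b @ ?tail) = run (k + 1) (b + d)"
      using k'd d0 b by (subst run_append, simp, simp, subst run_append, auto)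
    finally show ?thesis using eta_prod[OF j, of k] by (simp add: k')
  qed
  \<comment> \<open>A vector between k and k' is raised beyond the hole. The d factors with indices
    in y + 1, ..., y + d then miss k' and contain y + d twice, so their sum is wrong.\<close>
  have 2: "(u \<odot> basis (k # run (k + 1) y @ (y + d) # run (y + 1) k' @ run (k' + 1) b)) \<odot> basis ?tail = 0"
    if y: "y \<in> {k + 1..<k'}" for y
  proof -
    have e: "run (k' + 1) b @ ?tail @ [] = run (k' + 1) (y + d + 1) @ run (y + d + 1) (b + d) @ []"
      by (rule run_resplit) (use y k'd d0 b in auto)
    have "(u \<odot> basis (k # run (k + 1) y @ (y + d) # run (y + 1) k' @ run (k' + 1) b)) \<odot> basis ?tail
      = u \<odot> basis ((k # run (k + 1) y) @ ((y + d) # run (y + 1) k' @ run (k' + 1) (y + d + 1)) @ run (y + d + 1) (b + d))"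
      unfolding wdg_basis_append using e by simp
    also have "\<dots> = 0"
    proof (intro wdg_kill W_wrong_sum[of _ "y + 1" "y + d + 1"])
      have "run (y + 1) (y + d + 1) = run (y + 1) k' @ k' # run (k' + 1) (y + d + 1)"
        using y k'd run_append[of "y + 1" k' "y + d + 1"] run_Cons[of k' "y + d + 1"] by simp
      then show "sum_list ((y + d) # run (y + 1) k' @ run (k' + 1) (y + d + 1)) \<noteq> sum_list [y + 1..y + d + 1 - 1]"
        using y k'd by simp
    qed (use y k'd d0 in auto)
    finally show ?thesis .
  qed
  \<comment> \<open>Behind the hole the run has no gap, so y + d is a repetition.\<close>
  have 3: "(u \<odot> basis (k # run (k + 1) k' @ run (k' + 1) y @ (y + d) # run (y + 1) b)) \<odot> basis ?tail = 0"
    if y: "y \<in> {k' + 1..<b}" for y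
  proof -
    have e: "run (y + 1) b @ ?tail @ [] = run (y + 1) (y + d + 1) @ run (y + d + 1) (b + d) @ []"
      by (rule run_resplit) (use y k'd d0 b in auto)
    have "(u \<odot> basis (k # run (k + 1) k' @ run (k' + 1) y @ (y + d) # run (y + 1) b)) \<odot> basis ?tail
      = u \<odot> basis ((k # run (k + 1) k' @ run (k' + 1) y) @ ((y + d) # run (y + 1) (y + d + 1)) @ run (y + d + 1) (b + d))"
      unfolding wdg_basis_append using e by simp
    also have "\<dots> = 0" using d0 by (intro wdg_kill kill_before) auto
    finally show ?thesis .
  qed
  show ?thesis
    unfolding ps d[symmetric] using 1 2 3 by (simp add: wdg_simps)
qed

text \<open>The run and the tensor z together have as many factors as the interval from a to c has
  integers, so only the sum of the full run survives.\<close>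

lemma run_box_wrong:
  assumes z: "supp (box a c \<sigma> N) z" and ab: "a \<le> b" "int N = c - b" and s: "\<sigma> \<noteq> sum_list (run b c)"
  shows "u \<odot> basis (run a b) \<odot> z = 0"
proof -
  have bc: "b \<le> c" using ab by linarith
  have "u \<odot> basis (run a b) \<odot> z = (\<lambda>z. 0) z"
  proof (rule linop_eqI[OF _ _ z])
    fix t assume t: "box a c \<sigma> N t"
    have "u \<odot> basis (run a b) \<odot> basis t = u \<odot> basis ([] @ (run a b @ t) @ [])"
      by (simp add: wdg_basis_append)
    also have "\<dots> = 0"
    proof (intro wdg_kill W_wrong_sum[of _ a c])
      show "sum_list (run a b @ t) \<noteq> sum_list [a..c - 1]"
        using s t run_append[OF ab(1) bc] by (metis add_left_cancel box_def sum_list_append)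
    qed (use t ab bc in \<open>auto simp: box_def\<close>)
    finally show "u \<odot> basis (run a b) \<odot> basis t = 0" .
  qed (intro linop_intros)+
  then show ?thesis by simp
qed

lemma run_box_full:
  assumes z: "supp (box a c \<sigma> N) z" and ab: "a \<le> b" "int N = c - b"
  obtains \<mu> where "\<And>u. u \<odot> basis (run a b) \<odot> z = smul \<mu> (u \<odot> basis (run a c))"
proof -
  have bc: "b \<le> c" using ab by linarith
  have "supp (box a c (sum_list (run a b) + \<sigma>) (length (run a b) + N)) (tens (basis (run a b)) z)"
  proof (rule supp_tens[where P = "\<lambda>s. s = run a b" and Q = "box a c \<sigma> N"])
    show "supp (\<lambda>s. s = run a b) (basis (run a b))" by simp
    show "box a c (sum_list (run a b) + \<sigma>) (length (run a b) + N) (s @ t)"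
      if "s = run a b" "box a c \<sigma> N t" for s t using that bc ab by (auto simp: box_def)
  qed (rule z)
  then obtain \<mu> where mu: "AS (tens (basis (run a b)) z) = smul \<mu> (W (run a c))"
    by (rule supp_box_full) (use ab in auto)
  have "u \<odot> basis (run a b) \<odot> z = smul \<mu> (u \<odot> basis (run a c))" for u
  proof -
    have "u \<odot> basis (run a b) \<odot> z = u \<odot> AS (tens (basis (run a b)) z)"
      unfolding wdg_assoc by (simp only: wdg_def AS_tens_right)
    then show ?thesis unfolding mu by (simp add: wdg_simps)
  qed
  then show ?thesis using that by blast
qed

end

subsection \<open>Operators that remove one factor\<close>

context wedge_setup
begin

abbreviation low :: "int \<Rightarrow> tensor \<Rightarrow> bool" where
  "low a \<equiv> supp (\<lambda>t. set t \<subseteq> {a..})"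

lemma low_AS: "low a w \<Longrightarrow> low a (AS w)"
proof (erule supp_linop[OF linop_AS'])
  fix t :: "int list" assume t: "set t \<subseteq> {a..}"
  define b where "b = Max (insert a (set t)) + 1"
  have "\<forall>x\<in>set t. x < b" by (auto simp: b_def zle_add1_eq_le intro!: Max_ge)
  with t have "supp (box a b (sum_list t) (length t)) (basis t)" by (auto simp: box_def)
  from supp_box_AS[OF this] show "low a (W t)"
    by (rule supp_mono) (auto simp: box_def)
qed

lemma low_wdg: "low a u \<Longrightarrow> low a w \<Longrightarrow> low a (u \<odot> w)"
  unfolding wdg_def by (intro low_AS supp_tens[of "\<lambda>t. set t \<subseteq> {a..}" u "\<lambda>t. set t \<subseteq> {a..}"]) auto

lemma box_wrong:
  assumes "supp (box a c \<sigma> N) z" "int N = c - a" "\<sigma> \<noteq> sum_list (run a c)"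
  shows "AS z = 0"
  using run_box_wrong[OF assms(1) _ assms(2,3), of "basis []"] by simp

lemma psum_run_box:
  assumes "j > 0"
  shows "supp (box l (l + 2 * int (n * j)) (sum_list (run l (l + int (n * j))) + int (n * j)) (n * j))
    (psum (int j) (basis (run l (l + int (n * j)))))"
proof -
  obtain d where d: "d = n * j" by simp
  have le: "l \<le> l + int d" by simp
  have "box l (l + 2 * int d) (sum_list (run l (l + int d)) + int d) d (run l y @ (y + int d) # run (y + 1) (l + int d))"
    if y: "y \<in> {l..<l + int d}" for y
  proof -
    have "run l (l + int d) = run l y @ y # run (y + 1) (l + int d)"
      using y run_append[of l y "l + int d"] run_Cons[of y "l + int d"] by simp
    then show ?thesis using y by (auto simp: box_def)
  qed
  then show ?thesis
    unfolding d[symmetric] psum_run[OF le] using d by (intro supp_sum) simp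
qed

end

text \<open>
  \<open>R \<kappa>\<close> removes a factor \<open>e\<^sub>\<kappa>\<close>, from the left end or from the right end, with the normalisation
  for which the coefficients in \<open>R_rule\<close> do not depend on the number of factors of \<open>u\<close>.
\<close>

locale removal_pre = wedge_setup +
  fixes R :: "int \<Rightarrow> tensor \<Rightarrow> tensor" and c :: "int \<Rightarrow> int \<Rightarrow> nat \<Rightarrow> complex"
  assumes linop_R': "linop (R \<kappa>)"
    and R_wedge: "AS w = w \<Longrightarrow> AS (R \<kappa> w) = R \<kappa> w"
    and R_low: "supp (\<lambda>t. set t \<subseteq> {a..}) w \<Longrightarrow> \<kappa> < a \<Longrightarrow> R \<kappa> w = 0"
    and R_box: "supp (box a b \<sigma> (Suc N)) w \<Longrightarrow> supp (box a b (\<sigma> - \<kappa>) N) (R \<kappa> w)"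
    and R_rule: "u \<in> tensor_power N \<Longrightarrow> AS u = u \<Longrightarrow> supp (\<lambda>t. set t \<subseteq> {a..}) u \<Longrightarrow> \<kappa> < x \<Longrightarrow>
      \<kappa> - int B < a \<Longrightarrow>
      R \<kappa> (u \<odot> basis [x]) = (\<Sum>d\<le>B. smul (c \<kappa> x d) (R (\<kappa> - int d) u \<odot> basis [x - int d]))"
    and R_psum: "R \<kappa> (psum j w) = psum j (R \<kappa> w) + R (\<kappa> - int n * j) w"
    and c_nonzero: "c \<kappa> x 0 \<noteq> 0"
    and c_periodic: "c (\<kappa> - int n * int i) x 0 = c \<kappa> x 0"
begin

lemmas linop_R [linop_intros] = linop_comp[OF linop_R']
lemmas R_simps = linop_simps[OF linop_R']

lemma R_iter:
  assumes st: "\<And>l. l \<ge> L \<Longrightarrow> R \<kappa> (u \<odot> basis (run M (l + 1))) = smul (c \<kappa> l 0) (R \<kappa> (u \<odot> basis (run M l)) \<odot> basis [l])"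
    and "L \<le> l"
  shows "R \<kappa> (u \<odot> basis (run M l)) = smul (\<Prod>x\<in>{L..<l}. c \<kappa> x 0) (R \<kappa> (u \<odot> basis (run M L)) \<odot> basis (run L l))"
  using assms(2)
proof (induction l rule: int_ge_induct)
  case base
  show ?case by (simp add: R_wedge)
next
  case (step l)
  have "R \<kappa> (u \<odot> basis (run M (l + 1)))
      = smul (c \<kappa> l 0) (smul (\<Prod>x\<in>{L..<l}. c \<kappa> x 0) (R \<kappa> (u \<odot> basis (run M L)) \<odot> basis (run L l)) \<odot> basis [l])"
    unfolding st[OF step.hyps] step.IH ..
  also have "\<dots> = smul (c \<kappa> l 0 * (\<Prod>x\<in>{L..<l}. c \<kappa> x 0)) (R \<kappa> (u \<odot> basis (run M L)) \<odot> basis (run L (l + 1)))"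
    unfolding wdg_simps wdg_basis_append run_snoc[OF step.hyps] tm.scale_scale ..
  also have "c \<kappa> l 0 * (\<Prod>x\<in>{L..<l}. c \<kappa> x 0) = (\<Prod>x\<in>insert l {L..<l}. c \<kappa> x 0)" by simp
  also have "insert l {L..<l} = {L..<l + 1}" using step.hyps by auto
  finally show ?case .
qed

text \<open>Induction on \<kappa> - a. In \<open>R_rule\<close> a term with d > 0 contains R at
  \<kappa> - d, which by induction ends in a long run; the factor e with index l - d repeats a
  vector of that run.\<close>

lemma R_stable:
  assumes u: "u \<in> tensor_power N" "AS u = u" "low a u" and aM: "a \<le> M"
  shows "\<exists>L\<ge>M. \<kappa> < L \<and> (\<forall>l\<ge>L. R \<kappa> (u \<odot> basis (run M (l + 1))) = smul (c \<kappa> l 0) (R \<kappa> (u \<odot> basis (run M l)) \<odot> basis [l]))"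
proof (induction "nat (\<kappa> - a + 1)" arbitrary: \<kappa> rule: less_induct)
  case less
  define B where "B = nat (\<kappa> - a + 1)"
  define st where "st \<kappa> L \<longleftrightarrow> (\<forall>l\<ge>L. R \<kappa> (u \<odot> basis (run M (l + 1))) = smul (c \<kappa> l 0) (R \<kappa> (u \<odot> basis (run M l)) \<odot> basis [l]))" for \<kappa> L
  have "\<exists>L. st (\<kappa> - int d) L" if "d \<in> {1..B}" for d
  proof -
    have "nat (\<kappa> - int d - a + 1) < nat (\<kappa> - a + 1)" using that by (auto simp: B_def)
    from less.hyps[OF this] show ?thesis unfolding st_def by blast
  qed
  then obtain Lf where Lf: "\<And>d. d \<in> {1..B} \<Longrightarrow> st (\<kappa> - int d) (Lf d)" by metis
  define A where "A = {M, \<kappa> + 1} \<union> Lf ` {1..B}"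
  define L0 where "L0 = Max A"
  have A: "finite A" "M \<in> A" "\<kappa> + 1 \<in> A" "\<And>d. d \<in> {1..B} \<Longrightarrow> Lf d \<in> A"
    by (auto simp: A_def)
  have L0: "M \<le> L0" "\<kappa> + 1 \<le> L0" "\<And>d. d \<in> {1..B} \<Longrightarrow> Lf d \<le> L0"
    unfolding L0_def using A by (blast intro: Max_ge)+
  \<comment> \<open>The margin \<open>B\<close> keeps l - d at or beyond the threshold
    \<open>Lf d\<close> for every d \<le> B.\<close>
  have "R \<kappa> (u \<odot> basis (run M (l + 1))) = smul (c \<kappa> l 0) (R \<kappa> (u \<odot> basis (run M l)) \<odot> basis [l])"
    if l: "l \<ge> L0 + int B" for l
  proof -
    let ?w = "u \<odot> basis (run M l)"
    have Ml: "M \<le> l" and kl: "\<kappa> < l" using l L0 by auto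
    have pw: "?w \<in> tensor_power (N + length (run M l))"
      by (intro wdg_power u tensor_power_intros) simp
    have lw: "low a ?w" using u(3) aM by (intro low_wdg) auto
    have "R \<kappa> (u \<odot> basis (run M (l + 1))) = R \<kappa> (?w \<odot> basis [l])"
      unfolding run_snoc[OF Ml] wdg_basis_append ..
    also have "\<dots> = (\<Sum>d\<le>B. smul (c \<kappa> l d) (R (\<kappa> - int d) ?w \<odot> basis [l - int d]))"
      by (rule R_rule[OF pw _ lw kl]) (auto simp: B_def)
    also have "\<dots> = (\<Sum>d\<in>{0}. smul (c \<kappa> l d) (R (\<kappa> - int d) ?w \<odot> basis [l - int d]))"
    proof (intro sum.mono_neutral_right ballI)
      fix d assume "d \<in> {..B} - {0}"
      then have d: "d \<in> {1..B}" by auto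
      have "R (\<kappa> - int d) ?w = smul (\<Prod>x\<in>{Lf d..<l}. c (\<kappa> - int d) x 0)
          (R (\<kappa> - int d) (u \<odot> basis (run M (Lf d))) \<odot> basis (run (Lf d) l))"
        using Lf[OF d] L0(3)[OF d] l by (intro R_iter) (auto simp: st_def)
      moreover have "z \<odot> basis ([] @ (run (Lf d) l @ [l - int d]) @ []) = 0" for z
        using L0(3)[OF d] l d by (intro wdg_kill kill_after) auto
      ultimately show "smul (c \<kappa> l d) (R (\<kappa> - int d) ?w \<odot> basis [l - int d]) = 0"
        by (simp add: wdg_simps wdg_basis_append)
    qed auto
    finally show ?thesis by simp
  qed
  then show ?case using L0 by (intro exI[of _ "L0 + int B"]) auto
qed

text \<open>
  \<open>Q \<kappa> D xs\<close> is what \<open>R_rule\<close> leaves of \<open>e\<^sub>x\<^sub>s\<close> once \<open>R \<kappa>\<close> has been moved to the left of it and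
  has become \<open>R (\<kappa> - D)\<close>.
\<close>

primrec Q :: "int \<Rightarrow> nat \<Rightarrow> int list \<Rightarrow> tensor" where
  "Q \<kappa> D [] = (if D = 0 then basis [] else 0)"
| "Q \<kappa> D (x # xs) = (\<Sum>d\<le>D. smul (c (\<kappa> - int d) x (D - d)) (tens (basis [x - int (D - d)]) (Q \<kappa> d xs)))"

lemma Q_box: "box p q \<sigma> N xs \<Longrightarrow> supp (box (p - int D) q (\<sigma> - int D) N) (Q \<kappa> D xs)"
proof (induction xs arbitrary: D \<sigma> N)
  case Nil
  then show ?case by (auto simp: box_def)
next
  case (Cons x xs)
  then obtain N' where N': "N = Suc N'" by (auto simp: box_def)
  have bx: "box p q (\<sigma> - x) N' xs" using Cons.prems by (auto simp: box_def N')
  show ?case unfolding Q.simps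
  proof (intro supp_sum supp_smul)
    fix d assume d: "d \<in> {..D}"
    show "supp (box (p - int D) q (\<sigma> - int D) N) (tens (basis [x - int (D - d)]) (Q \<kappa> d xs))"
    proof (rule supp_tens[where P = "\<lambda>s. s = [x - int (D - d)]" and Q = "box (p - int d) q (\<sigma> - x - int d) N'"])
      show "supp (box (p - int d) q (\<sigma> - x - int d) N') (Q \<kappa> d xs)" by (rule Cons.IH[OF bx])
      fix s t assume "s = [x - int (D - d)]" "box (p - int d) q (\<sigma> - x - int d) N' t"
      then show "box (p - int D) q (\<sigma> - int D) N (s @ t)"
        using Cons.prems d by (force simp: box_def N')
    qed simp
  qed
qed

lemma R_expand:
  assumes "u \<in> tensor_power N" "AS u = u" "low a u" "\<And>x. x \<in> set xs \<Longrightarrow> \<kappa> < x \<and> a \<le> x" "\<kappa> - int B < a"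
  shows "R \<kappa> (u \<odot> basis xs) = (\<Sum>D\<le>B. R (\<kappa> - int D) u \<odot> Q \<kappa> D xs)"
  using assms
proof (induction xs arbitrary: u N)
  case Nil
  have "(\<Sum>D\<le>B. R (\<kappa> - int D) u \<odot> Q \<kappa> D []) = (\<Sum>D\<in>{0}. R (\<kappa> - int D) u \<odot> Q \<kappa> D [])"
    by (intro sum.mono_neutral_right) (auto simp: wdg_simps)
  then show ?case using Nil by (simp add: R_wedge)
next
  case (Cons x xs)
  let ?u = "u \<odot> basis [x]"
  define g where "g d e = smul (c (\<kappa> - int d) x e) (R (\<kappa> - int d - int e) u \<odot> basis [x - int e] \<odot> Q \<kappa> d xs)" for d e
  have pw: "?u \<in> tensor_power (N + 1)" using Cons.prems by (intro wdg_power tensor_power_intros) auto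
  have lw: "low a ?u" using Cons.prems(3,4) by (intro low_wdg) auto
  have "R \<kappa> (u \<odot> basis (x # xs)) = R \<kappa> (?u \<odot> basis xs)"
    by (simp add: wdg_basis_append)
  also have "\<dots> = (\<Sum>D\<le>B. R (\<kappa> - int D) ?u \<odot> Q \<kappa> D xs)"
    by (rule Cons.IH[OF pw _ lw]) (use Cons.prems in auto)
  also have "\<dots> = (\<Sum>d\<le>B. \<Sum>e\<le>B - d. g d e)"
  proof (intro sum.cong refl)
    fix d assume d: "d \<in> {..B}"
    have "R (\<kappa> - int d) ?u = (\<Sum>e\<le>B - d. smul (c (\<kappa> - int d) x e) (R (\<kappa> - int d - int e) u \<odot> basis [x - int e]))"
      using Cons.prems d by (intro R_rule[where N = N and a = a]) (force simp: of_nat_diff)+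
    then show "R (\<kappa> - int d) ?u \<odot> Q \<kappa> d xs = (\<Sum>e\<le>B - d. g d e)"
      by (simp add: wdg_simps g_def)
  qed
  \<comment> \<open>d is the shift caused by \<open>xs\<close> and e the one caused by x; collecting
    terms by D = d + e gives the recursion of \<open>Q\<close>.\<close>
  also have "\<dots> = (\<Sum>(d, e)\<in>{(d, e). d + e \<le> B}. g d e)"
    by (subst sum.Sigma) (auto intro!: sum.cong)
  also have "\<dots> = (\<Sum>D\<le>B. \<Sum>d\<le>D. g d (D - d))" by (rule sum.triangle_reindex_eq)
  also have "\<dots> = (\<Sum>D\<le>B. R (\<kappa> - int D) u \<odot> Q \<kappa> D (x # xs))"
  proof (intro sum.cong refl)
    fix D assume "D \<in> {..B}"
    have "g d (D - d) = smul (c (\<kappa> - int d) x (D - d)) (R (\<kappa> - int D) u \<odot> tens (basis [x - int (D - d)]) (Q \<kappa> d xs))"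
      if "d \<in> {..D}" for d
    proof -
      have e: "\<kappa> - int d - int (D - d) = \<kappa> - int D" using that by simp
      show ?thesis unfolding g_def e wdg_assoc by (simp only: wdg_def AS_tens_right)
    qed
    then show "(\<Sum>d\<le>D. g d (D - d)) = R (\<kappa> - int D) u \<odot> Q \<kappa> D (x # xs)"
      by (simp add: wdg_simps)
  qed
  finally show ?case .
qed

text \<open>
  Only the term \<open>D = nj\<close> of \<open>R_expand\<close> has the degree of a wedge of consecutive vectors, and
  straightening it yields a scalar \<open>\<mu>\<close> that is independent of \<open>u\<close>.
\<close>

lemma R_universal:
  assumes L: "L + int B \<le> l" "\<kappa> < L" and j: "j > 0"
  shows "\<exists>\<mu>. \<forall>N u a. u \<in> tensor_power N \<and> AS u = u \<and> low a u \<and> a \<le> l \<and> \<kappa> - int B < a \<and>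
      (\<forall>d\<le>B. \<exists>u'. R (\<kappa> - int d) u = u' \<odot> basis (run L l)) \<and> n * j \<le> B \<longrightarrow>
    R \<kappa> (u \<odot> psum (int j) (basis (run l (l + int (n * j))))) \<odot> basis (run (l + int (n * j)) (l + 2 * int (n * j)))
    = smul \<mu> (R (\<kappa> - int (n * j)) u \<odot> basis (run l (l + 2 * int (n * j))))"
proof -
  obtain J where J: "J = n * j" by simp
  define y where "y = psum (int j) (basis (run l (l + int J)))"
  define \<sigma> where "\<sigma> = sum_list (run l (l + int J)) + int J"
  have y: "supp (box l (l + 2 * int J) \<sigma> J) y"
    using psum_run_box[OF j, of l] by (simp only: y_def \<sigma>_def J)
  define tl where "tl = run (l + int J) (l + 2 * int J)"
  define z where "z D = tens (lin (Q \<kappa> D) y) (basis tl)" for D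
  \<comment> \<open>Indices are lowered by at most B, and B \<le> l - L, so they stay in the
    interval that starts at L.\<close>
  have z: "supp (box L (l + 2 * int J) (\<sigma> - int D + sum_list tl) (J + J)) (z D)" if D: "D \<le> B" for D
    unfolding z_def
  proof (rule supp_tens[where P = "box (l - int D) (l + 2 * int J) (\<sigma> - int D) J" and Q = "\<lambda>t. t = tl"])
    show "supp (box (l - int D) (l + 2 * int J) (\<sigma> - int D) J) (lin (Q \<kappa> D) y)"
      by (rule supp_lin[OF y]) (rule Q_box)
    show "supp (\<lambda>t. t = tl) (basis tl)" by simp
    show "box L (l + 2 * int J) (\<sigma> - int D + sum_list tl) (J + J) (s @ t)"
      if "box (l - int D) (l + 2 * int J) (\<sigma> - int D) J s" "t = tl" for s t
      using that D L by (force simp: box_def tl_def)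
  qed
  have sumtl: "\<sigma> - int D + sum_list tl = sum_list (run l (l + 2 * int J)) + (int J - int D)" for D
    using run_append[of l "l + int J" "l + 2 * int J"] by (simp add: \<sigma>_def tl_def flip: sum_list_append)
  have Ll: "L \<le> l" using L by simp
  have "\<exists>\<mu>. J \<le> B \<longrightarrow> (\<forall>u. u \<odot> basis (run L l) \<odot> z J = smul \<mu> (u \<odot> basis (run L (l + 2 * int J))))"
  proof (cases "J \<le> B")
    case True
    obtain \<mu> where "\<And>u. u \<odot> basis (run L l) \<odot> z J = smul \<mu> (u \<odot> basis (run L (l + 2 * int J)))"
      using run_box_full[OF z[OF True] Ll] by auto
    then show ?thesis by blast
  qed simp
  then obtain \<mu> where mu: "\<And>u. J \<le> B \<Longrightarrow> u \<odot> basis (run L l) \<odot> z J = smul \<mu> (u \<odot> basis (run L (l + 2 * int J)))"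
    by blast
  have "R \<kappa> (u \<odot> y) \<odot> basis tl = smul \<mu> (R (\<kappa> - int J) u \<odot> basis (run l (l + 2 * int J)))"
    if u: "u \<in> tensor_power N" "AS u = u" "low a u" "a \<le> l" "\<kappa> - int B < a"
      and run: "\<And>d. d \<le> B \<Longrightarrow> \<exists>u'. R (\<kappa> - int d) u = u' \<odot> basis (run L l)" and JB: "J \<le> B" for N u a
  proof -
    have "R \<kappa> (u \<odot> y) = (\<Sum>D\<le>B. R (\<kappa> - int D) u \<odot> lin (Q \<kappa> D) y)"
    proof (rule linop_eqI[OF _ _ y])
      fix t assume "box l (l + 2 * int J) \<sigma> J t"
      then have "\<And>x. x \<in> set t \<Longrightarrow> \<kappa> < x \<and> a \<le> x" using u(4) L by (force simp: box_def)
      from R_expand[OF u(1-3) this u(5)]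
      show "R \<kappa> (u \<odot> basis t) = (\<Sum>D\<le>B. R (\<kappa> - int D) u \<odot> lin (Q \<kappa> D) (basis t))" by simp
    qed (intro linop_intros)+
    then have "R \<kappa> (u \<odot> y) \<odot> basis tl = (\<Sum>D\<le>B. R (\<kappa> - int D) u \<odot> z D)"
      by (simp add: wdg_simps wdg_assoc z_def) (simp only: wdg_def AS_tens_right)
    also have "\<dots> = (\<Sum>D\<in>{J}. R (\<kappa> - int D) u \<odot> z D)"
    proof (intro sum.mono_neutral_right ballI)
      fix D assume D: "D \<in> {..B} - {J}"
      then obtain u' where u': "R (\<kappa> - int D) u = u' \<odot> basis (run L l)" using run by auto
      have "D \<le> B" using D by simp
      from z[OF this] show "R (\<kappa> - int D) u \<odot> z D = 0"
        unfolding u' by (rule run_box_wrong[OF _ Ll]) (use D sumtl[of D] in auto)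
    qed (use JB in auto)
    also have "\<dots> = smul \<mu> (R (\<kappa> - int J) u \<odot> basis (run l (l + 2 * int J)))"
    proof -
      obtain u' where u': "R (\<kappa> - int J) u = u' \<odot> basis (run L l)" using run JB by auto
      show ?thesis
        using mu[OF JB, of u'] run_append[OF Ll, of "l + 2 * int J"] by (simp add: u' wdg_basis_append)
    qed
    finally show ?thesis .
  qed
  then show ?thesis unfolding J[symmetric] y_def tl_def by blast
qed

text \<open>For a run the shifted terms vanish already for every x > k: removing k - d and appending
  x - d gives a list inside the interval of the run whose sum is off by x - k.\<close>

lemma vac_step:
  assumes "k < x"
  shows "R k (basis [] \<odot> basis (run A (x + 1))) = smul (c k x 0) (R k (basis [] \<odot> basis (run A x)) \<odot> basis [x])"
proof (cases "A \<le> k")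
  case True
  define B where "B = nat (k - A + 1)"
  let ?w = "W (run A x)"
  have lw: "low A ?w" by (rule low_AS) auto
  have bx: "supp (box A x (sum_list (run A x)) (Suc (nat (x - A - 1)))) ?w"
    using True assms by (intro supp_box_AS) (auto simp: box_def)
  have "R k (W (run A (x + 1))) = R k (?w \<odot> basis [x])"
    using run_snoc[of A x] True assms by (simp add: W_append)
  also have "\<dots> = (\<Sum>d\<le>B. smul (c k x d) (R (k - int d) ?w \<odot> basis [x - int d]))"
    by (rule R_rule[OF AS_basis_power _ lw assms]) (auto simp: B_def)
  also have "\<dots> = (\<Sum>d\<in>{0}. smul (c k x d) (R (k - int d) ?w \<odot> basis [x - int d]))"
  proof (intro sum.mono_neutral_right ballI)
    fix d assume d: "d \<in> {..B} - {0}"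
    have "R (k - int d) ?w \<odot> basis [x - int d] = 0"
    proof (cases "A \<le> k - int d")
      case True
      have "supp (box A x (sum_list (run A x) - (k - int d) + (x - int d)) (nat (x - A)))
          (tens (R (k - int d) ?w) (basis [x - int d]))"
      proof (rule supp_tens[OF R_box[OF bx], where Q = "\<lambda>t. t = [x - int d]"])
        show "box A x (sum_list (run A x) - (k - int d) + (x - int d)) (nat (x - A)) (s @ t)"
          if "box A x (sum_list (run A x) - (k - int d)) (nat (x - A - 1)) s" "t = [x - int d]" for s t
          using that True assms d by (auto simp: box_def)
      qed simp
      then show ?thesis
        unfolding wdg_def by (rule box_wrong) (use True assms in auto)
    next
      case False
      then show ?thesis using R_low[OF lw, of "k - int d"] by (simp add: wdg_simps)
    qed
    then show "smul (c k x d) (R (k - int d) ?w \<odot> basis [x - int d]) = 0" by simp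
  qed auto
  finally show ?thesis by simp
next
  case False
  have lw: "low A (W (run A x))" for x by (rule low_AS) auto
  have "R k (basis [] \<odot> basis (run A x)) = 0" for x using R_low[OF lw, of k] False by simp
  then show ?thesis by (simp only: wdg_simps tm.scale_zero_right)
qed

lemma vac_iter:
  assumes "k < L" "L \<le> l"
  shows "R k (W (run A l)) = smul (\<Prod>x\<in>{L..<l}. c k x 0) (R k (W (run A L)) \<odot> basis (run L l))"
  using R_iter[of L k "basis []" A l] vac_step assms by simp

end

text \<open>\<open>R_rule\<close> requires \<kappa> < x, so the removal of the last vector of a run
  is a separate initial value. It is recorded for runs whose ends differ by a multiple of n, the
  distance at which the hole and the raised vector meet.\<close>

locale removal = removal_pre +
  fixes \<alpha> :: "nat \<Rightarrow> complex"
  assumes R_top: "R (a + int n * int i) (AS (basis [a..a + int n * int i]))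
      = smul (\<alpha> i) (AS (basis [a..a + int n * int i - 1]))"
    and \<alpha>_nonzero: "\<alpha> i \<noteq> 0"
begin

lemma vac_value:
  assumes k: "k = A + int n * int i" and l: "k < l"
  shows "R k (W (run A l)) = smul (\<alpha> i * (\<Prod>x\<in>{k + 1..<l}. c k x 0)) (W (run A k @ run (k + 1) l))"
proof -
  have "R k (W (run A (k + 1))) = smul (\<alpha> i) (W (run A k))" using R_top[of A i] k by simp
  then show ?thesis
    using vac_iter[of k "k + 1" l A] l by (simp add: wdg_simps W_append mult.commute)
qed

text \<open>Removing the first vector by \<open>R\<close> costs a nonzero factor, so nonvanishing
  descends to the empty wedge. It permits the comparison of scalars in all evaluations.\<close>

lemma W_run_nonzero: "a \<le> b \<Longrightarrow> W (run a b) \<noteq> 0"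
proof (induction a rule: int_le_induct)
  case base
  have "W [] = basis []" by (rule AS_eigen[of _ 0]) (auto intro: tensor_power_intros)
  then show ?case using basis_nonzero by simp
next
  case (step a)
  show ?case
  proof
    assume "W (run (a - 1) b) = 0"
    then have "smul (\<alpha> 0 * (\<Prod>x\<in>{a..<b}. c (a - 1) x 0)) (W (run a b)) = 0"
      using vac_value[of "a - 1" "a - 1" 0 b] step by (simp add: R_simps)
    then show False using step \<alpha>_nonzero c_nonzero by simp
  qed
qed

text \<open>
  The value of the universal scalar, read off from \<open>u = e\<^sub>\<kappa>\<^sub>-\<^sub>n\<^sub>j \<and> \<dots> \<and> e\<^sub>l\<^sub>-\<^sub>1\<close>: there \<open>R \<kappa>\<close> makes a hole
  at \<open>\<kappa>\<close>, and the power sum fills it with \<open>e\<^sub>\<kappa>\<^sub>-\<^sub>n\<^sub>j\<close> at the cost of \<open>\<eta> j\<close>.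
\<close>

definition K :: "int \<Rightarrow> nat \<Rightarrow> complex" where
  "K \<kappa> j = 1 + \<eta> j * \<alpha> j / (\<alpha> 0 * (\<Prod>x\<in>{\<kappa> - int (n * j) + 1..\<kappa>}. c \<kappa> x 0))"

theorem R_correction:
  assumes u: "u \<in> tensor_power N" "AS u = u" "low a u" and aM: "a \<le> M" and j: "j > 0"
  shows "\<exists>L\<ge>M. \<forall>l\<ge>L.
    R \<kappa> (u \<odot> basis (run M l) \<odot> psum (int j) (basis (run l (l + int (n * j))))) \<odot> basis (run (l + int (n * j)) (l + 2 * int (n * j)))
    = smul (K \<kappa> j) (R (\<kappa> - int (n * j)) (u \<odot> basis (run M (l + int (n * j)))) \<odot> basis (run (l + int (n * j)) (l + 2 * int (n * j))))"
proof -
  obtain J where J: "J = n * j" by simp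
  have J0: "J > 0" using n_pos j by (simp add: J)
  \<comment> \<open>Large enough for both uses of \<open>R_universal\<close>: the first summand
    takes \<kappa> - B below a, the rest takes it below \<kappa>', where the test run
    begins.\<close>
  define B where "B = nat (\<kappa> - a + 1) + J + 1"
  define \<kappa>' where "\<kappa>' = \<kappa> - int J"
  have "\<exists>L\<ge>M. \<forall>l\<ge>L. R (\<kappa> - int d) (u \<odot> basis (run M (l + 1)))
      = smul (c (\<kappa> - int d) l 0) (R (\<kappa> - int d) (u \<odot> basis (run M l)) \<odot> basis [l])" for d
    using R_stable[OF u aM, of "\<kappa> - int d"] by blast
  then obtain Lf where Lf: "\<And>d l. l \<ge> Lf d \<Longrightarrow> R (\<kappa> - int d) (u \<odot> basis (run M (l + 1)))
      = smul (c (\<kappa> - int d) l 0) (R (\<kappa> - int d) (u \<odot> basis (run M l)) \<odot> basis [l])"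
    by metis
  define A where "A = {M, \<kappa> + 1} \<union> Lf ` {..B}"
  define L0 where "L0 = Max A"
  have A: "finite A" "M \<in> A" "\<kappa> + 1 \<in> A" "\<And>d. d \<le> B \<Longrightarrow> Lf d \<in> A"
    by (auto simp: A_def)
  have L0: "M \<le> L0" "\<kappa> + 1 \<le> L0" "\<And>d. d \<le> B \<Longrightarrow> Lf d \<le> L0"
    unfolding L0_def using A by (blast intro: Max_ge)+
  have main: "R \<kappa> (u \<odot> basis (run M l) \<odot> psum (int j) (basis (run l (l + int J)))) \<odot> basis (run (l + int J) (l + 2 * int J))
    = smul (K \<kappa> j) (R \<kappa>' (u \<odot> basis (run M (l + int J))) \<odot> basis (run (l + int J) (l + 2 * int J)))"
    if l: "l \<ge> L0 + int B" for l
  proof -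
    define b b' y tl where "b = l + int J" and "b' = l + 2 * int J" and "y = psum (int j) (basis (run l b))"
      and "tl = run b b'"
    note defs = b_def b'_def y_def tl_def
    have kL: "\<kappa> < L0" and Ll: "L0 \<le> l" and JB: "J \<le> B"
      using L0(2) l by (linarith, linarith, simp add: B_def)
    obtain \<mu> where mu: "R \<kappa> (w \<odot> y) \<odot> basis tl = smul \<mu> (R \<kappa>' w \<odot> basis (run l b'))"
      if "w \<in> tensor_power N" "AS w = w" "low a w" "a \<le> l" "\<kappa> - int B < a"
        "\<And>d. d \<le> B \<Longrightarrow> \<exists>u'. R (\<kappa> - int d) w = u' \<odot> basis (run L0 l)" for N w a
      using R_universal[OF l kL j] JB unfolding J[symmetric] defs \<kappa>'_def by blast
    let ?w = "u \<odot> basis (run M l)"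
    have w: "R \<kappa> (?w \<odot> y) \<odot> basis tl = smul \<mu> (R \<kappa>' ?w \<odot> basis (run l b'))"
    proof (rule mu)
      show "?w \<in> tensor_power (N + length (run M l))" by (intro wdg_power u tensor_power_intros) simp
      show "low a ?w" using u(3) aM by (intro low_wdg) auto
      show "a \<le> l" "\<kappa> - int B < a" using aM L0 Ll by (auto simp: B_def)
      show "\<exists>u'. R (\<kappa> - int d) ?w = u' \<odot> basis (run L0 l)" if "d \<le> B" for d
        using R_iter[OF Lf _, of L0 d l] L0(3)[OF that] Ll
        by (metis (no_types, lifting) linop_smul[OF linop_wdg_left'] order_trans)
    qed simp
    have vac: "R \<kappa> (W (run \<kappa>' l) \<odot> y) \<odot> basis tl = smul \<mu> (R \<kappa>' (W (run \<kappa>' l)) \<odot> basis (run l b'))"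
    proof (rule mu)
      show "W (run \<kappa>' l) \<in> tensor_power (length (run \<kappa>' l))" by (rule AS_basis_power)
      show "low (min a \<kappa>') (W (run \<kappa>' l))" by (rule low_AS) auto
      show "min a \<kappa>' \<le> l" "\<kappa> - int B < min a \<kappa>'" using aM L0 Ll by (auto simp: B_def \<kappa>'_def)
      show "\<exists>u'. R (\<kappa> - int d) (W (run \<kappa>' l)) = u' \<odot> basis (run L0 l)" if "d \<le> B" for d
        using vac_iter[of "\<kappa> - int d" L0 l \<kappa>'] kL Ll
        by (metis (no_types, lifting) linop_smul[OF linop_wdg_left'] le_less_trans diff_le_eq le_add_same_cancel1 of_nat_0_le_iff)
    qed simp
    have iJ: "int J = int n * int j" by (simp add: J)
    have kk: "\<kappa>' < \<kappa>" "\<kappa>' < l" "\<kappa> < l" "\<kappa> < b" "\<kappa>' < b" "l \<le> b" "b \<le> b'" "l \<le> b'"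
      using J0 kL Ll by (auto simp: defs \<kappa>'_def)
    \<comment> \<open>The part of the test run before l contributes nothing to the power sum. So its
      boundary term is the power sum of the whole run, and \<open>R_psum\<close> reduces R of it to
      a power sum of a run with a hole.\<close>
    have "basis [] \<odot> psum (int j) (basis (run \<kappa>' l)) \<odot> basis (run l b @ []) = 0"
      unfolding b_def iJ by (rule psum_run_tail) (use kk j in auto)
    then have zero: "psum (int j) (basis (run \<kappa>' l)) \<odot> basis (run l b) = 0" by simp
    have "W (run \<kappa>' b) = basis (run \<kappa>' l) \<odot> basis (run l b)"
      using run_append[of \<kappa>' l b] kk by (simp flip: W_append)
    then have "psum (int j) (W (run \<kappa>' b)) = W (run \<kappa>' l) \<odot> y"
      by (simp add: psum_wdg zero y_def)
    then have lhs: "R \<kappa> (W (run \<kappa>' l) \<odot> y) = psum (int j) (R \<kappa> (W (run \<kappa>' b))) + R \<kappa>' (W (run \<kappa>' b))"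
      using R_psum[of \<kappa> "int j" "W (run \<kappa>' b)"] by (simp add: \<kappa>'_def J)
    define P where "P x y = (\<Prod>z\<in>{x..<y}. c \<kappa>' z 0)" for x y
    have cper: "c \<kappa>' x 0 = c \<kappa> x 0" for x using c_periodic[of \<kappa> j x] by (simp add: \<kappa>'_def J)
    have Psplit: "P x z = P x y * P y z" if "x \<le> y" "y \<le> z" for x y z
      unfolding P_def using that
      by (subst prod.union_disjoint[symmetric]) (auto intro!: prod.cong)
    have Pnz: "P x y \<noteq> 0" for x y by (simp add: P_def c_nonzero)
    define V where "V = W (run (\<kappa>' + 1) b')"
    have V: "V \<noteq> 0" unfolding V_def by (rule W_run_nonzero) (use kk in simp)
    have k1: "R \<kappa> (W (run \<kappa>' b)) = smul (\<alpha> j * P (\<kappa> + 1) b) (W (run \<kappa>' \<kappa> @ run (\<kappa> + 1) b))"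
    proof -
      have "\<kappa> = \<kappa>' + int n * int j" by (simp add: \<kappa>'_def J)
      from vac_value[OF this kk(4)] show ?thesis by (simp only: P_def cper)
    qed
    have k2: "R \<kappa>' (W (run \<kappa>' x)) = smul (\<alpha> 0 * P (\<kappa>' + 1) x) (W (run (\<kappa>' + 1) x))" if "\<kappa>' < x" for x
      using vac_value[of \<kappa>' \<kappa>' 0 x] that by (simp add: P_def)
    have "basis [] \<odot> psum (int j) (basis (run \<kappa>' \<kappa> @ run (\<kappa> + 1) b)) \<odot> basis (run b (b + int n * int j))
        = smul (\<eta> j) (basis [] \<odot> basis (run (\<kappa>' + 1) (b + int n * int j)))"
      by (rule psum_hole) (use j kk in \<open>auto simp: \<kappa>'_def J\<close>)
    moreover have bb: "b + int n * int j = b'" by (simp add: defs J)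
    ultimately have hole: "psum (int j) (W (run \<kappa>' \<kappa> @ run (\<kappa> + 1) b)) \<odot> basis tl = smul (\<eta> j) V"
      by (simp add: tl_def V_def AS_psum[symmetric])
    have tail: "W (run (\<kappa>' + 1) b) \<odot> basis tl = V"
      using run_append[of "\<kappa>' + 1" b b'] kk by (simp add: V_def tl_def flip: W_append)
    have tail': "W (run (\<kappa>' + 1) l) \<odot> basis (run l b') = V"
      using run_append[of "\<kappa>' + 1" l b'] kk by (simp add: V_def flip: W_append)
    \<comment> \<open>Both sides for the test run are multiples of the one wedge \<open>V\<close>,
      so \<mu> can be solved for.\<close>
    have "smul (\<alpha> j * P (\<kappa> + 1) b * \<eta> j + \<alpha> 0 * P (\<kappa>' + 1) b) V = smul (\<mu> * (\<alpha> 0 * P (\<kappa>' + 1) l)) V"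
      using vac unfolding lhs k1 k2[OF kk(5)] k2[OF kk(2)]
      by (simp add: psum_simps wdg_simps hole tail tail' tm.scale_left_distrib del: wdg_AS_left wdg_AS_right)
    then have eq: "\<alpha> j * P (\<kappa> + 1) b * \<eta> j + \<alpha> 0 * P (\<kappa>' + 1) b = \<mu> * (\<alpha> 0 * P (\<kappa>' + 1) l)"
      using V by (simp add: tm.scale_right_imp_eq)
    have K: "K \<kappa> j = 1 + \<eta> j * \<alpha> j / (\<alpha> 0 * P (\<kappa>' + 1) (\<kappa> + 1))"
    proof -
      have "{\<kappa>' + 1..<\<kappa> + 1} = {\<kappa> - int (n * j) + 1..\<kappa>}" by (auto simp: \<kappa>'_def J)
      then show ?thesis by (simp only: K_def P_def cper)
    qed
    have "K \<kappa> j * P l b * (\<alpha> 0 * P (\<kappa>' + 1) l) = K \<kappa> j * (\<alpha> 0 * P (\<kappa>' + 1) (\<kappa> + 1)) * P (\<kappa> + 1) b"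
      using Psplit[of "\<kappa>' + 1" l b] Psplit[of "\<kappa>' + 1" "\<kappa> + 1" b] kk by (simp add: mult_ac)
    also have "K \<kappa> j * (\<alpha> 0 * P (\<kappa>' + 1) (\<kappa> + 1)) = \<alpha> 0 * P (\<kappa>' + 1) (\<kappa> + 1) + \<eta> j * \<alpha> j"
      unfolding K using Pnz \<alpha>_nonzero by (simp add: distrib_right)
    also have "\<dots> * P (\<kappa> + 1) b = \<mu> * (\<alpha> 0 * P (\<kappa>' + 1) l)"
      unfolding eq[symmetric] using Psplit[of "\<kappa>' + 1" "\<kappa> + 1" b] kk by (simp add: algebra_simps)
    finally have mu_eq: "\<mu> = K \<kappa> j * P l b"
      using Pnz \<alpha>_nonzero by simp
    \<comment> \<open>Prolonging from l to b costs \<open>P l b\<close>, which is exactly the factor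
      by which \<mu> differs from \<open>K \<kappa> j\<close>.\<close>
    have "R \<kappa>' (u \<odot> basis (run M b)) = smul (P l b) (R \<kappa>' ?w \<odot> basis (run l b))"
      using R_iter[OF Lf, of l J b] L0(3)[OF JB] Ll kk unfolding P_def \<kappa>'_def by simp
    then have "R \<kappa>' (u \<odot> basis (run M b)) \<odot> basis tl = smul (P l b) (R \<kappa>' ?w \<odot> basis (run l b'))"
      using run_append[of l b b'] kk by (simp add: wdg_simps wdg_basis_append tl_def)
    then show ?thesis
      using w unfolding mu_eq defs by (simp only: tm.scale_scale tl_def b_def b'_def)
  qed
  show ?thesis
    using main L0 unfolding J[symmetric] \<kappa>'_def by (intro exI[of _ "L0 + int B"]) auto
qed

end

text \<open>For an f that deletes the first factor: only the chain with a = 0 uses P at 0; the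
  others, with letters lowered by one, form the coset sum of one degree less.\<close>

lemma (in hecke_action) C_first:
  assumes f: "linop f" and z: "z \<in> tensor_power (Suc (Suc M))"
    and fP: "\<And>i w. w \<in> tensor_power (Suc (Suc M)) \<Longrightarrow> i < M \<Longrightarrow> f (P (Suc i) w) = P i (f w)"
  shows "f (C (Suc M) z) = smul (e ^ Suc M) (f (foldr P [0..<Suc M] z)) + C M (f z)"
proof -
  have ch: "f (foldr P [Suc a..<Suc M] z) = foldr P [a..<M] (f z)" for a
  proof -
    have "f (foldr P (map Suc is) z) = foldr P is (f z)" if "\<And>i. i \<in> set is \<Longrightarrow> i < M" for "is"
      using that by (induction "is") (auto simp: fP foldr_power[OF z])
    from this[of "[a..<M]"] show ?thesis by (simp add: map_Suc_upt del: upt_Suc)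
  qed
  have "f (C (Suc M) z) = (\<Sum>a\<le>Suc M. smul (e ^ (Suc M - a)) (f (foldr P [a..<Suc M] z)))"
    by (simp add: C_def linop_simps[OF f] del: upt_Suc sum.atMost_Suc)
  also have "\<dots> = smul (e ^ Suc M) (f (foldr P [0..<Suc M] z)) + (\<Sum>a\<le>M. smul (e ^ (M - a)) (f (foldr P [Suc a..<Suc M] z)))"
    by (subst sum.atMost_Suc_shift) (simp del: upt_Suc)
  finally show ?thesis unfolding ch C_def .
qed

text \<open>For an f that deletes the last factor: apart from the empty chain, every chain applies P
  at M first, and its other letters commute with f.\<close>

lemma (in hecke_action) C_last:
  assumes f: "linop f" and z: "z \<in> tensor_power (Suc (Suc M))"
    and fP: "\<And>i w. w \<in> tensor_power (Suc (Suc M)) \<Longrightarrow> i < M \<Longrightarrow> f (P i w) = P i (f w)"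
  shows "f (C (Suc M) z) = f z + smul e (C M (f (P M z)))"
proof -
  have ch: "f (foldr P [a..<M] w) = foldr P [a..<M] (f w)" if "w \<in> tensor_power (Suc (Suc M))" for a w
  proof -
    have "f (foldr P is w) = foldr P is (f w)" if "\<And>i. i \<in> set is \<Longrightarrow> i < M" for "is"
      using that by (induction "is") (auto simp: fP foldr_power[OF \<open>w \<in> _\<close>])
    from this[of "[a..<M]"] show ?thesis by simp
  qed
  have "smul (e ^ (Suc M - a)) (foldr P [a..<Suc M] z) = smul e (smul (e ^ (M - a)) (foldr P [a..<M] (P M z)))"
    if "a \<le> M" for a
    using that by (simp add: Suc_diff_le)
  then have "C (Suc M) z = z + smul e (\<Sum>a\<le>M. smul (e ^ (M - a)) (foldr P [a..<M] (P M z)))"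
    by (simp add: C_def tm.scale_sum_right del: upt_Suc tm.scale_scale)
  then show ?thesis
    by (simp add: linop_simps[OF f] C_def ch P_power[OF z])
qed

context wedge_setup
begin

subsection \<open>The first coordinate\<close>

text \<open>As u is already antisymmetric, only the coset sum remains of the antisymmetriser. With
  inverse generators the coset sum is again an eigenvector, so it equals its own antisymmetrisation,
  and absorbing the chains there produces the plus integer.\<close>

lemma wedge_coset:
  assumes u: "u \<in> tensor_power N" "AS u = u"
  shows "smul (qint_minus v (Suc N)) (u \<odot> basis [x]) = H.C N (tens u (basis [x]))"
    and "smul (qint_plus v (Suc N)) (u \<odot> basis [x]) = Hi.C N (tens u (basis [x]))"
proof -
  let ?z = "tens u (basis [x])"
  have x: "basis [x] \<in> tensor_power 1" by (intro tensor_power_intros) simp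
  have z: "?z \<in> tensor_power (Suc N)" using tens_power[OF u(1) x] by simp
  have Tz: "T j ?z = smul (- inverse v) ?z" if "Suc j < N" for j
    using T_AS[OF u(1) that] u(2) by (simp add: hecke_tens_left[OF u(1) that] tens_simps)
  then have "H.A N ?z = smul (H.qf N) ?z" by (rule H.A_eigen)
  then have A: "H.A (Suc N) ?z = smul (H.qf N) (H.C N ?z)"
    using linop_smul[OF H.linop_C'(1)[OF linop_id]] by simp
  have "H.qf (Suc N) \<noteq> 0" by (rule qfact_nonzero)
  then have "H.qf N \<noteq> 0" "H.qn (Suc N) \<noteq> 0" by (auto simp: H.qf_Suc)
  then show "smul (qint_minus v (Suc N)) (u \<odot> basis [x]) = H.C N ?z"
    unfolding wdg_def AS_A[OF z] A by (simp add: H.qf_Suc qn_minus)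
  let ?y = "Hi.C N ?z"
  have y: "?y \<in> tensor_power (Suc N)" by (rule Hi.C_power[OF z])
  have T1: "T_inv j ?z = smul (- v) ?z" if "Suc j < N" for j
    using Tz[OF that] by (simp add: T_inv_def tm.scale_left_diff_distrib)
  have "T j ?y = smul (- inverse v) ?y" if "Suc j < Suc N" for j
  proof -
    have "T_inv j ?y = smul (- v) ?y"
      by (rule Hi.C_absorb[OF z]) (use that T1 in auto)
    then have "T j (smul (- v) ?y) = ?y" using T_T_inv[OF y that] by simp
    then have "smul (- inverse v) (smul (- v) (T j ?y)) = smul (- inverse v) ?y" by (simp only: T_simps)
    then show ?thesis unfolding tm.scale_scale by simp
  qed
  then have "?y = AS ?y" using AS_eigen[OF y] by simp
  also have "AS ?y = (\<Sum>a\<le>N. smul ((- v) ^ (N - a)) (AS (foldr T_inv [a..<N] ?z)))"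
    by (simp add: Hi.C_def AS_simps)
  also have "\<dots> = (\<Sum>a\<le>N. smul ((- v) ^ (N - a) * (- v) ^ (N - a)) (AS ?z))"
  proof (intro sum.cong refl)
    fix a
    have "AS (foldr T_inv [a..<N] ?z) = smul ((- v) ^ length [a..<N]) (AS ?z)"
      by (rule Hi.foldr_absorbed[OF linop_AS' z]) (rule AS_T_inv, auto)
    then show "smul ((- v) ^ (N - a)) (AS (foldr T_inv [a..<N] ?z)) = smul ((- v) ^ (N - a) * (- v) ^ (N - a)) (AS ?z)"
      by simp
  qed
  also have "\<dots> = smul (Hi.qn (Suc N)) (AS ?z)"
    by (simp add: tm.scale_sum_left[symmetric] Hi.qn_rev)
  finally show "smul (qint_plus v (Suc N)) (u \<odot> basis [x]) = ?y"
    by (simp add: qn_plus wdg_def)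
qed

text \<open>Indexed by the removed vector e\<kappa> itself, whereas the starred operators use the
  opposite sign.\<close>

definition fc :: "int \<Rightarrow> tensor \<Rightarrow> tensor" where "fc \<kappa> = Phi_star (- \<kappa>)"
definition lc :: "int \<Rightarrow> tensor \<Rightarrow> tensor" where "lc \<kappa> = Psi_star (- \<kappa>)"

lemma linop_fc': "linop (fc \<kappa>)" and linop_lc': "linop (lc \<kappa>)"
  unfolding fc_def lc_def Phi_star_def Psi_star_def by (intro linop_intros)+

lemmas linop_fc [linop_intros] = linop_comp[OF linop_fc']
lemmas linop_lc [linop_intros] = linop_comp[OF linop_lc']
lemmas fc_simps = linop_simps[OF linop_fc']
lemmas lc_simps = linop_simps[OF linop_lc']

lemma fc_Nil [simp]: "fc \<kappa> (basis []) = 0"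
  and fc_Cons: "fc \<kappa> (basis (x # t)) = (if x = \<kappa> then basis t else 0)"
  and lc_Nil [simp]: "lc \<kappa> (basis []) = 0"
  and lc_snoc: "lc \<kappa> (basis (t @ [x])) = (if x = \<kappa> then basis t else 0)"
  by (simp_all add: fc_def lc_def Phi_star_def Psi_star_def)

lemma fc_tens_Cons: "fc \<kappa> (tens (basis [x]) z) = (if x = \<kappa> then z else 0)"
  by (cases "x = \<kappa>"; rule linop_eqI'[where w = z]) (auto intro!: linop_intros simp: fc_Cons)

lemma lc_tens_snoc: "lc \<kappa> (tens z (basis [x])) = (if x = \<kappa> then z else 0)"
  by (cases "x = \<kappa>"; rule linop_eqI'[where w = z]) (auto intro!: linop_intros simp: lc_snoc)

lemma fc_power: "w \<in> tensor_power (Suc N) \<Longrightarrow> fc \<kappa> w \<in> tensor_power N"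
  unfolding tensor_power_supp
  by (erule supp_linop[OF linop_fc']) (auto simp: length_Suc_conv fc_Cons)

lemma lc_power: "w \<in> tensor_power (Suc N) \<Longrightarrow> lc \<kappa> w \<in> tensor_power N"
  unfolding tensor_power_supp
  by (erule supp_linop[OF linop_lc']) (auto simp: length_Suc_conv_rev lc_snoc)

lemma T_basis_power: "length t = N \<Longrightarrow> basis t \<in> tensor_power N"
  by (rule tensor_power_intros)

lemma fc_T:
  assumes "w \<in> tensor_power (Suc N)" "Suc i < N"
  shows "fc \<kappa> (T (Suc i) w) = T i (fc \<kappa> w)"
proof (rule linop_eqI[OF _ _ assms(1)[unfolded tensor_power_supp]])
  fix t :: "int list" assume "length t = Suc N"
  then obtain x t' where t: "t = x # t'" "length t' = N" by (auto simp: length_Suc_conv)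
  have "T (1 + i) (tens (basis [x]) (basis t')) = tens (basis [x]) (T i (basis t'))"
    using t(2) assms(2) by (intro hecke_tens_right[of _ _ _ N] T_basis_power) auto
  then show "fc \<kappa> (T (Suc i) (basis t)) = T i (fc \<kappa> (basis t))"
    by (simp add: t(1) fc_tens_Cons fc_Cons T_simps)
qed (intro linop_intros)+

lemma lc_T:
  assumes "w \<in> tensor_power (Suc N)" "Suc i < N"
  shows "lc \<kappa> (T i w) = T i (lc \<kappa> w)"
proof (rule linop_eqI[OF _ _ assms(1)[unfolded tensor_power_supp]])
  fix t :: "int list" assume "length t = Suc N"
  then obtain x t' where t: "t = t' @ [x]" "length t' = N" by (auto simp: length_Suc_conv_rev)
  have "T i (tens (basis t') (basis [x])) = tens (T i (basis t')) (basis [x])"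
    using t(2) assms(2) by (intro hecke_tens_left[of _ N] T_basis_power) auto
  then show "lc \<kappa> (T i (basis t)) = T i (lc \<kappa> (basis t))"
    by (simp add: t(1) lc_tens_snoc lc_snoc T_simps)
qed (intro linop_intros)+

text \<open>A generator on the shorter tensor comes from one on the longer tensor, so f of a wedge
  is still an eigenvector of all generators. The index is i + 1 for the first coordinate and i for
  the last.\<close>

lemma wedge_removal:
  assumes f: "linop f" and fN: "f (basis []) = 0"
    and fp: "\<And>N w. w \<in> tensor_power (Suc N) \<Longrightarrow> f w \<in> tensor_power N"
    and fT: "\<And>N w i. w \<in> tensor_power (Suc N) \<Longrightarrow> Suc i < N \<Longrightarrow> \<exists>k. Suc k < Suc N \<and> T i (f w) = f (T k w)"
  shows "AS (f (AS w)) = f (AS w)"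
proof (rule linop_eqI'[where w = w])
  fix t
  show "AS (f (W t)) = f (W t)"
  proof (cases t)
    case Nil
    have "W [] = basis []" by (rule AS_eigen[of _ 0]) (auto intro: tensor_power_intros)
    then show ?thesis by (simp add: Nil fN AS_simps)
  next
    case (Cons x t')
    define N where "N = length t'"
    have W: "W t \<in> tensor_power (Suc N)" using AS_basis_power[of t] by (simp add: Cons N_def)
    show ?thesis
    proof (rule AS_eigen[OF fp[OF W]])
      fix i assume "Suc i < N"
      then obtain k where k: "Suc k < Suc N" "T i (f (W t)) = f (T k (W t))" using fT[OF W] by blast
      moreover have "T k (W t) = smul (- inverse v) (W t)"
        using T_AS[of "basis t" "Suc N" k] k(1) by (simp add: Cons N_def T_basis_power)
      ultimately show "T i (f (W t)) = smul (- inverse v) (f (W t))"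
        by (simp only: linop_smul[OF f])
    qed
  qed
qed (intro linop_intros linop_comp[OF f])+

lemma fc_wedge: "AS w = w \<Longrightarrow> AS (fc \<kappa> w) = fc \<kappa> w"
  using wedge_removal[of "fc \<kappa>" w] linop_fc' fc_power fc_T[symmetric]
  by (metis Suc_mono fc_Nil)

lemma lc_wedge: "AS w = w \<Longrightarrow> AS (lc \<kappa> w) = lc \<kappa> w"
  using wedge_removal[of "lc \<kappa>" w] linop_lc' lc_power lc_T[symmetric]
  by (metis less_SucI lc_Nil)

lemma fc_tens: "u \<in> tensor_power (Suc N) \<Longrightarrow> fc \<kappa> (tens u w) = tens (fc \<kappa> u) w"
proof (rule linop_eqI'[where w = w])
  fix t assume "u \<in> tensor_power (Suc N)"
  then show "fc \<kappa> (tens u (basis t)) = tens (fc \<kappa> u) (basis t)"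
    unfolding tensor_power_supp
    by - (rule linop_eqI[where P = "\<lambda>t. length t = Suc N" and w = u], auto intro!: linop_intros simp: length_Suc_conv fc_Cons tens_simps)
qed (intro linop_intros)+

lemma fc_T_inv:
  assumes "w \<in> tensor_power (Suc N)" "Suc i < N"
  shows "fc \<kappa> (T_inv (Suc i) w) = T_inv i (fc \<kappa> w)"
  by (simp add: T_inv_def fc_simps fc_T[OF assms])

lemma lc_T_inv:
  assumes "w \<in> tensor_power (Suc N)" "Suc i < N"
  shows "lc \<kappa> (T_inv i w) = T_inv i (lc \<kappa> w)"
  by (simp add: T_inv_def lc_simps lc_T[OF assms])

text \<open>Both coset expansions leave one term not expressed by \<open>fc \<kappa> u\<close>, a
  chain of all generators or of all inverses. \<open>Rf_shift\<close> eliminates these two terms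
  against each other.\<close>

lemma fc_step:
  assumes u: "u \<in> tensor_power N" "AS u = u"
  shows "smul (qint_minus v (Suc N)) (fc \<kappa> (u \<odot> basis [x])) = smul (qint_minus v N) (fc \<kappa> u \<odot> basis [x])
      + smul ((- inverse v) ^ N) (fc \<kappa> (foldr T [0..<N] (tens u (basis [x]))))" (is ?th1)
    and "smul (qint_plus v (Suc N)) (fc \<kappa> (u \<odot> basis [x])) = smul (qint_plus v N) (fc \<kappa> u \<odot> basis [x])
      + smul ((- v) ^ N) (fc \<kappa> (foldr T_inv [0..<N] (tens u (basis [x]))))" (is ?th2)
proof -
  let ?z = "tens u (basis [x])"
  have z: "?z \<in> tensor_power (Suc N)" using tens_power[OF u(1) T_basis_power[of "[x]" 1]] by simp
  have "fc \<kappa> (smul (qint_minus v (Suc N)) (u \<odot> basis [x])) = fc \<kappa> (H.C N ?z)"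
    and "fc \<kappa> (smul (qint_plus v (Suc N)) (u \<odot> basis [x])) = fc \<kappa> (Hi.C N ?z)"
    by (simp_all only: wedge_coset[OF u])
  then have *: "smul (qint_minus v (Suc N)) (fc \<kappa> (u \<odot> basis [x])) = fc \<kappa> (H.C N ?z)"
    "smul (qint_plus v (Suc N)) (fc \<kappa> (u \<odot> basis [x])) = fc \<kappa> (Hi.C N ?z)"
    by (simp_all only: fc_simps)
  have "?th1 \<and> ?th2"
  proof (cases N)
    case 0
    have "qint_minus v 0 = 0" "qint_plus v 0 = 0" by (simp_all add: qint_minus_def qint_plus_def)
    then show ?thesis using * by (simp add: 0 H.C_def Hi.C_def)
  next
    case (Suc M)
    have fu: "fc \<kappa> u \<in> tensor_power M" "AS (fc \<kappa> u) = fc \<kappa> u"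
      using fc_power[of u M] u fc_wedge by (simp_all add: Suc)
    have fz: "fc \<kappa> ?z = tens (fc \<kappa> u) (basis [x])" using fc_tens[of u M] u by (simp add: Suc)
    show ?thesis
      unfolding * unfolding Suc
      using H.C_first[OF linop_fc', of ?z M \<kappa>] Hi.C_first[OF linop_fc', of ?z M \<kappa>] z
        wedge_coset[OF fu, of x]
      by (simp add: Suc fc_T fc_T_inv fz add.commute del: upt_Suc)
  qed
  then show ?th1 ?th2 by auto
qed

text \<open>By \<open>T_inv_Y\<close> each inverse generator becomes a generator as Y moves one
  position to the left.\<close>

lemma chain_Y:
  assumes z: "z \<in> tensor_power (Suc N)" and a: "a \<le> N"
  shows "foldr T_inv [a..<N] (Y N z) = Y a (foldr T [a..<N] z)"
  using a
proof (induction a rule: inc_induct)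
  case (step a)
  then have "[a..<N] = a # [Suc a..<N]" by (simp add: upt_conv_Cons)
  with step show ?case by (simp add: T_inv_Y[OF H.foldr_power[OF z]])
qed simp

lemma fc_Y: "w \<in> tensor_power (Suc N) \<Longrightarrow> fc \<kappa> (Y 0 w) = fc (\<kappa> - int n) w"
  unfolding tensor_power_supp
  by (rule linop_eqI[where P = "\<lambda>t. length t = Suc N" and w = w]) (auto intro!: linop_intros simp: length_Suc_conv Y_basis fc_Cons)

lemma qint_plus_minus: "qint_plus v (Suc N) = (v ^ 2) ^ N * qint_minus v (Suc N)"
proof -
  have "(v ^ 2) ^ N * (\<Sum>k<Suc N. ((- inverse v) ^ 2) ^ k) = (\<Sum>k<Suc N. (v ^ 2) ^ (N - k))"
    unfolding sum_distrib_left
  proof (intro sum.cong refl)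
    fix k assume "k \<in> {..<Suc N}"
    then have "(v ^ 2) ^ N = (v ^ 2) ^ (N - k) * (v ^ 2) ^ k" by (simp flip: power_add)
    then show "(v ^ 2) ^ N * ((- inverse v) ^ 2) ^ k = (v ^ 2) ^ (N - k)"
      by (simp add: power_inverse)
  qed
  also have "\<dots> = (\<Sum>k<Suc N. (v ^ 2) ^ k)"
    using sum.nat_diff_reindex[of "\<lambda>k. (v ^ 2) ^ k" "Suc N"] by simp
  finally show ?thesis
    unfolding qn_plus[symmetric] qn_minus[symmetric] Hi.qn_def H.qn_def by simp
qed

definition Rf :: "int \<Rightarrow> tensor \<Rightarrow> tensor" where
  "Rf \<kappa> = lin (\<lambda>t. smul (qint_plus v (length t)) (fc \<kappa> (basis t)))"

definition Rl :: "int \<Rightarrow> tensor \<Rightarrow> tensor" where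
  "Rl \<kappa> = lin (\<lambda>t. smul ((- v) ^ length t * qint_minus v (length t)) (lc \<kappa> (basis t)))"

lemma linop_Rf': "linop (Rf \<kappa>)" and linop_Rl': "linop (Rl \<kappa>)"
  unfolding Rf_def Rl_def by (intro linop_intros)+

lemmas linop_Rf [linop_intros] = linop_comp[OF linop_Rf']
lemmas linop_Rl [linop_intros] = linop_comp[OF linop_Rl']
lemmas Rf_simps = linop_simps[OF linop_Rf']

lemma Rf_fc: "w \<in> tensor_power N \<Longrightarrow> Rf \<kappa> w = smul (qint_plus v N) (fc \<kappa> w)"
  unfolding tensor_power_supp
  by (rule linop_eqI[where P = "\<lambda>t. length t = N" and w = w]) (auto intro!: linop_intros simp: Rf_def)

lemma Rl_lc: "w \<in> tensor_power N \<Longrightarrow> Rl \<kappa> w = smul ((- v) ^ N * qint_minus v N) (lc \<kappa> w)"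
  unfolding tensor_power_supp
  by (rule linop_eqI[where P = "\<lambda>t. length t = N" and w = w]) (auto intro!: linop_intros simp: Rl_def)

text \<open>As e with index x is Y times e with index x - n, \<open>chain_Y\<close> and
  \<open>fc_Y\<close> identify the inverse chain for (\<kappa>, x) with the ordinary chain for
  (\<kappa> - n, x - n). Eliminating it leaves a relation among wedges only; the factor v^2 is the
  mismatch between the two kinds of quantum integers.\<close>

lemma Rf_shift:
  assumes u: "u \<in> tensor_power N" "AS u = u"
  shows "Rf \<kappa> (u \<odot> basis [x]) - Rf \<kappa> u \<odot> basis [x]
    = Rf (\<kappa> - int n) (u \<odot> basis [x - int n]) - smul (v ^ 2) (Rf (\<kappa> - int n) u \<odot> basis [x - int n])"
proof -
  let ?z = "tens u (basis [x - int n])"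
  let ?q = "(v ^ 2) ^ N"
  have z: "?z \<in> tensor_power (Suc N)" using tens_power[OF u(1) T_basis_power[of "[x - int n]" 1]] by simp
  have pw: "u \<odot> basis [y] \<in> tensor_power (Suc N)" for y
    using wdg_power[OF u(1) T_basis_power[of "[y]" 1]] by simp
  have zx: "tens u (basis [x]) = Y N ?z"
    using Y_tens_right[OF u(1), of 0 1 "basis [x - int n]"] by (simp add: Y_basis)
  have "Rf \<kappa> (u \<odot> basis [x]) - Rf \<kappa> u \<odot> basis [x] = smul ((- v) ^ N) (fc \<kappa> (foldr T_inv [0..<N] (Y N ?z)))"
    unfolding Rf_fc[OF pw] Rf_fc[OF u(1)] fc_step(2)[OF u] zx by (simp add: wdg_simps)
  also have "\<dots> = smul ((- v) ^ N) (fc (\<kappa> - int n) (foldr T [0..<N] ?z))"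
    using chain_Y[OF z, of 0] fc_Y[OF H.foldr_power[OF z]] by simp
  also have "(- v) ^ N = ?q * (- inverse v) ^ N"
  proof -
    have "- v = v ^ 2 * - inverse v" by (simp add: power2_eq_square)
    then show ?thesis by (metis power_mult_distrib)
  qed
  also have "smul (?q * (- inverse v) ^ N) (fc (\<kappa> - int n) (foldr T [0..<N] ?z))
      = smul ?q (smul (qint_minus v (Suc N)) (fc (\<kappa> - int n) (u \<odot> basis [x - int n]))
        - smul (qint_minus v N) (fc (\<kappa> - int n) u \<odot> basis [x - int n]))"
    unfolding fc_step(1)[OF u] by simp
  also have "\<dots> = smul (?q * qint_minus v (Suc N)) (fc (\<kappa> - int n) (u \<odot> basis [x - int n]))
        - smul (?q * qint_minus v N) (fc (\<kappa> - int n) u \<odot> basis [x - int n])"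
    by (simp add: tm.scale_right_diff_distrib)
  also have "?q * qint_minus v (Suc N) = qint_plus v (Suc N)" by (simp add: qint_plus_minus)
  also have "?q * qint_minus v N = v ^ 2 * qint_plus v N"
  proof (cases N)
    case 0
    then show ?thesis by (simp add: qint_plus_def qint_minus_def)
  qed (simp add: qint_plus_minus)
  finally show ?thesis
    unfolding Rf_fc[OF pw] Rf_fc[OF u(1)] by (simp add: wdg_simps)
qed

text \<open>Solution of the recursion \<open>Rf_shift\<close>: each shift by a positive multiple of
  n receives 1 - v^2, whatever \<kappa> and x are.\<close>

definition cf :: "int \<Rightarrow> int \<Rightarrow> nat \<Rightarrow> complex" where
  "cf \<kappa> x d = (if d = 0 then 1 else if n dvd d then 1 - v ^ 2 else 0)"

lemma cf_sum:
  assumes "\<And>d. d > B \<Longrightarrow> F d = 0"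
  shows "(\<Sum>d\<le>B. smul (cf \<kappa> x d) (F d)) = F 0 + smul (1 - v ^ 2) (\<Sum>s\<in>{1..B}. F (n * s))"
proof -
  have n: "n > 0" using n_pos by simp
  have "(\<Sum>s\<in>{1..B}. F (n * s)) = (\<Sum>d\<in>(\<lambda>s. n * s) ` {1..B}. F d)"
    using n by (subst sum.reindex) (auto simp: inj_on_def)
  also have "\<dots> = (\<Sum>d\<in>{d\<in>{1..B}. n dvd d}. F d)"
  proof (rule sum.mono_neutral_right)
    show "{d \<in> {1..B}. n dvd d} \<subseteq> (\<lambda>s. n * s) ` {1..B}"
    proof
      fix d assume "d \<in> {d \<in> {1..B}. n dvd d}"
      then obtain s where s: "d = n * s" "1 \<le> d" "d \<le> B" by (auto elim: dvdE)
      have "1 \<le> s" using s(1,2) by (cases s) auto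
      moreover have "s \<le> B" using s n by (metis le_trans mult_le_mono1 nat_mult_1 Suc_leI One_nat_def)
      ultimately show "d \<in> (\<lambda>s. n * s) ` {1..B}" using s(1) by auto
    qed
    show "\<forall>d\<in>(\<lambda>s. n * s) ` {1..B} - {d \<in> {1..B}. n dvd d}. F d = 0"
      using n by (auto intro!: assms)
  qed simp
  finally have "smul (1 - v ^ 2) (\<Sum>s\<in>{1..B}. F (n * s)) = (\<Sum>d\<in>{d\<in>{1..B}. n dvd d}. smul (1 - v ^ 2) (F d))"
    by (simp only: tm.scale_sum_right)
  also have "\<dots> = (\<Sum>d\<in>{1..B}. smul (cf \<kappa> x d) (F d))"
    by (rule sum.mono_neutral_cong_left) (auto simp: cf_def)
  also have "F 0 + \<dots> = (\<Sum>d\<in>insert 0 {1..B}. smul (cf \<kappa> x d) (F d))"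
    by (subst sum.insert) (auto simp: cf_def)
  also have "insert 0 {1..B} = {..B}" by auto
  finally show ?thesis by simp
qed

lemma Rf_low:
  assumes "low a w" "\<kappa> < a"
  shows "Rf \<kappa> w = 0"
proof -
  have "Rf \<kappa> w = (\<lambda>w. 0) w"
  proof (rule linop_eqI[OF _ _ assms(1)])
    show "Rf \<kappa> (basis t) = 0" if "set t \<subseteq> {a..}" for t
      using that assms(2) by (cases t) (auto simp: Rf_def fc_Cons)
  qed (intro linop_intros)+
  then show ?thesis by simp
qed

lemma Rl_low:
  assumes "low a w" "\<kappa> < a"
  shows "Rl \<kappa> w = 0"
proof -
  have "Rl \<kappa> w = (\<lambda>w. 0) w"
  proof (rule linop_eqI[OF _ _ assms(1)])
    show "Rl \<kappa> (basis t) = 0" if "set t \<subseteq> {a..}" for t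
      using that assms(2) by (cases t rule: rev_cases) (auto simp: Rl_def lc_snoc)
  qed (intro linop_intros)+
  then show ?thesis by simp
qed

text \<open>The recursion \<open>Rf_shift\<close> telescopes. After B steps the removed index lies
  below all indices present, because \<kappa> < x, so the remainder vanishes.\<close>

lemma Rf_rule:
  assumes u: "u \<in> tensor_power N" "AS u = u" "low a u" and "\<kappa> < x" "\<kappa> - int B < a"
  shows "Rf \<kappa> (u \<odot> basis [x]) = (\<Sum>d\<le>B. smul (cf \<kappa> x d) (Rf (\<kappa> - int d) u \<odot> basis [x - int d]))"
proof -
  define F where "F s = Rf (\<kappa> - int (n * s)) u \<odot> basis [x - int (n * s)]" for s
  define G where "G s = Rf (\<kappa> - int (n * s)) (u \<odot> basis [x - int (n * s)])" for s
  have step: "G s - F s = smul (1 - v ^ 2) (F (Suc s)) + (G (Suc s) - F (Suc s))" for s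
    using Rf_shift[OF u(1,2), of "\<kappa> - int (n * s)" "x - int (n * s)"]
    by (simp add: F_def G_def tm.scale_left_diff_distrib algebra_simps)
  have tele: "G 0 = F 0 + smul (1 - v ^ 2) (\<Sum>s\<in>{1..S}. F s) + (G S - F S)" for S
  proof (induction S)
    case (Suc S)
    then show ?case using step[of S] by (simp add: tm.scale_right_distrib add.assoc)
  qed simp
  have "1 * B \<le> n * B" using n_pos by (rule mult_le_mono1)
  then have nB: "int (n * B) \<ge> int B" by (simp only: of_nat_le_iff mult_1)
  have "low (min a (x - int (n * B))) (u \<odot> basis [x - int (n * B)])"
  proof (intro low_wdg)
    show "low (min a (x - int (n * B))) u"
      by (rule supp_mono[OF u(3)]) (simp add: subset_iff min.coboundedI1)
  qed simp
  then have "G B = 0" unfolding G_def by (rule Rf_low) (use assms(4,5) nB in auto)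
  moreover have "F B = 0"
    unfolding F_def using Rf_low[OF u(3), of "\<kappa> - int (n * B)"] assms(5) nB by (simp add: wdg_simps)
  moreover have "(\<Sum>d\<le>B. smul (cf \<kappa> x d) (Rf (\<kappa> - int d) u \<odot> basis [x - int d]))
      = Rf (\<kappa> - int 0) u \<odot> basis [x - int 0]
        + smul (1 - v ^ 2) (\<Sum>s\<in>{1..B}. Rf (\<kappa> - int (n * s)) u \<odot> basis [x - int (n * s)])"
    by (rule cf_sum) (use Rf_low[OF u(3)] assms(5) in \<open>auto simp: wdg_simps\<close>)
  ultimately show ?thesis using tele[of B] by (simp add: F_def G_def)
qed

end

context wedge_setup
begin

lemma Rf_wedge: "AS w = w \<Longrightarrow> AS (Rf \<kappa> w) = Rf \<kappa> w"
proof -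
  have "AS (Rf \<kappa> (AS w)) = Rf \<kappa> (AS w)"
  proof (rule linop_eqI'[where w = w])
    fix t
    have W: "W t \<in> tensor_power (length t)" by (rule AS_basis_power)
    show "AS (Rf \<kappa> (W t)) = Rf \<kappa> (W t)"
      unfolding Rf_fc[OF W] by (simp add: AS_simps fc_wedge)
  qed (intro linop_intros)+
  then show "AS w = w \<Longrightarrow> AS (Rf \<kappa> w) = Rf \<kappa> w" by simp
qed

lemma Rl_wedge: "AS w = w \<Longrightarrow> AS (Rl \<kappa> w) = Rl \<kappa> w"
proof -
  have "AS (Rl \<kappa> (AS w)) = Rl \<kappa> (AS w)"
  proof (rule linop_eqI'[where w = w])
    fix t
    have W: "W t \<in> tensor_power (length t)" by (rule AS_basis_power)
    show "AS (Rl \<kappa> (W t)) = Rl \<kappa> (W t)"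
      unfolding Rl_lc[OF W] by (simp add: AS_simps lc_wedge)
  qed (intro linop_intros)+
  then show "AS w = w \<Longrightarrow> AS (Rl \<kappa> w) = Rl \<kappa> w" by simp
qed

lemma Rf_box: "supp (box a b \<sigma> (Suc N)) w \<Longrightarrow> supp (box a b (\<sigma> - \<kappa>) N) (Rf \<kappa> w)"
  by (erule supp_linop[OF linop_Rf']) (auto simp: box_def length_Suc_conv Rf_def fc_Cons intro!: supp_smul)

lemma Rl_box: "supp (box a b \<sigma> (Suc N)) w \<Longrightarrow> supp (box a b (\<sigma> - \<kappa>) N) (Rl \<kappa> w)"
  by (erule supp_linop[OF linop_Rl']) (auto simp: box_def length_Suc_conv_rev Rl_def lc_snoc intro!: supp_smul)

lemma Rf_psum: "Rf \<kappa> (psum j w) = psum j (Rf \<kappa> w) + Rf (\<kappa> - int n * j) w"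
proof (rule linop_eqI'[where w = w])
  fix t
  show "Rf \<kappa> (psum j (basis t)) = psum j (Rf \<kappa> (basis t)) + Rf (\<kappa> - int n * j) (basis t)"
  proof (cases t)
    case Nil
    then show ?thesis by (simp add: Rf_def psum_simps)
  next
    case (Cons x t')
    have t: "basis (x # t') \<in> tensor_power (Suc (length t'))" by (rule T_basis_power) simp
    have "psum j (basis (x # t')) = basis ((x + int n * j) # t') + tens (basis [x]) (psum j (basis t'))"
      using psum_tens[of j "basis [x]" "basis t'"] by (simp add: psum_single)
    then have "fc \<kappa> (psum j (basis (x # t'))) = psum j (fc \<kappa> (basis (x # t'))) + fc (\<kappa> - int n * j) (basis (x # t'))"
      by (auto simp: fc_simps fc_Cons fc_tens_Cons psum_simps)
    then show ?thesis
      unfolding Cons Rf_fc[OF t] Rf_fc[OF psum_power[OF t]] by (simp add: psum_simps tm.scale_right_distrib)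
  qed
qed (intro linop_intros)+

lemma Rl_psum: "Rl \<kappa> (psum j w) = psum j (Rl \<kappa> w) + Rl (\<kappa> - int n * j) w"
proof (rule linop_eqI'[where w = w])
  fix t
  show "Rl \<kappa> (psum j (basis t)) = psum j (Rl \<kappa> (basis t)) + Rl (\<kappa> - int n * j) (basis t)"
  proof (cases t rule: rev_cases)
    case Nil
    then show ?thesis by (simp add: Rl_def psum_simps)
  next
    case (snoc t' x)
    have t: "basis (t' @ [x]) \<in> tensor_power (Suc (length t'))" by (rule T_basis_power) simp
    have "psum j (basis (t' @ [x])) = tens (psum j (basis t')) (basis [x]) + basis (t' @ [x + int n * j])"
      using psum_tens[of j "basis t'" "basis [x]"] by (simp add: psum_single)
    then have "lc \<kappa> (psum j (basis (t' @ [x]))) = psum j (lc \<kappa> (basis (t' @ [x]))) + lc (\<kappa> - int n * j) (basis (t' @ [x]))"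
      by (auto simp: lc_simps lc_snoc lc_tens_snoc psum_simps)
    then show ?thesis
      unfolding snoc Rl_lc[OF t] Rl_lc[OF psum_power[OF t]] by (simp add: psum_simps tm.scale_right_distrib)
  qed
qed (intro linop_intros)+

lemma cf_removal_pre: "removal_pre n v Rf cf"
proof unfold_locales
  show "Rf \<kappa> (u \<odot> basis [x]) = (\<Sum>d\<le>B. smul (cf \<kappa> x d) (Rf (\<kappa> - int d) u \<odot> basis [x - int d]))"
    if "u \<in> tensor_power N" "AS u = u" "low a u" "\<kappa> < x" "\<kappa> - int B < a" for u N a \<kappa> x B
    using that by (rule Rf_rule)
qed (auto intro: linop_Rf' Rf_wedge Rf_low Rf_box Rf_psum simp: cf_def)

lemma eta_prod':
  assumes "j > 0"
  shows "(\<Prod>x\<in>{k + 1..<k + int n * int j}. cc (x - k)) = \<eta> j"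
proof -
  have "(\<Prod>x\<in>{k + 1..<k + int n * int j}. cc (x - k)) = (\<Prod>y\<in>{k + 1..<k + int n * int j}. cc (k + int n * int j - y))"
    by (rule prod.reindex_bij_witness[of _ "\<lambda>y. k + (k + int n * int j) - y" "\<lambda>y. k + (k + int n * int j) - y"]) auto
  then show ?thesis using eta_prod[OF assms, of k] by simp
qed

lemma eta_1: "\<eta> 1 = (- v) ^ (n - 1)"
  by (simp add: \<eta>_def)

text \<open>Each further block of n vectors contributes - v^2 from \<open>Rf_shift\<close> and the
  exchange factor of n - 1 neighbours.\<close>

definition \<alpha>f :: "nat \<Rightarrow> complex" where "\<alpha>f i = (- (v ^ 2) * (- v) ^ (n - 1)) ^ i"

lemma Rf_upper:
  assumes "supp (\<lambda>t. set t \<subseteq> {..<b}) w" "b \<le> \<kappa>"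
  shows "Rf \<kappa> w = 0"
proof -
  have "Rf \<kappa> w = (\<lambda>w. 0) w"
  proof (rule linop_eqI[OF _ _ assms(1)])
    show "Rf \<kappa> (basis t) = 0" if "set t \<subseteq> {..<b}" for t
      using that assms(2) by (cases t) (auto simp: Rf_def fc_Cons)
  qed (intro linop_intros)+
  then show ?thesis by simp
qed

lemma W_run_box: "a \<le> b \<Longrightarrow> supp (box a b (sum_list (run a b)) (nat (b - a))) (W (run a b))"
  by (rule supp_box_AS) (auto simp: box_def)

lemma W_Nil: "W [] = basis []"
  by (rule AS_eigen[of _ 0]) (auto intro: tensor_power_intros)

lemma W_single: "W [x] = basis [x]"
  by (rule AS_eigen[of _ 1]) (auto intro: tensor_power_intros)

text \<open>For the last vector of the run, two terms of \<open>Rf_shift\<close> vanish: \<kappa>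
  does not occur before its end, and \<kappa> - n is a repetition. What remains removes \<kappa> - n
  and appends it again on the right; moving it back into its hole gives the exchange factor.\<close>

lemma Rf_top: "Rf (a + int n * int i) (W [a..a + int n * int i]) = smul (\<alpha>f i) (W (run a (a + int n * int i)))"
proof (induction i)
  case 0
  have "qint_plus v 1 = 1" using v_sq by (simp add: qint_plus_def)
  then show ?case by (simp add: W_single W_Nil \<alpha>f_def Rf_def fc_Cons)
next
  case (Suc i)
  interpret R: removal_pre n v Rf cf by (rule cf_removal_pre)
  define k \<kappa> where "k = a + int n * int i" and "\<kappa> = k + int n"
  have ak: "a \<le> k" by (simp add: k_def)
  have kk: "k < \<kappa>" "a \<le> \<kappa>" using n_pos ak by (auto simp: \<kappa>_def)
  have \<kappa>: "a + int n * int (Suc i) = \<kappa>" by (simp add: k_def \<kappa>_def algebra_simps)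
  let ?u = "W (run a \<kappa>)"
  have "Rf \<kappa> ?u = 0"
  proof (rule Rf_upper[of \<kappa>])
    show "supp (\<lambda>t. set t \<subseteq> {..<\<kappa>}) ?u"
      using W_run_box[OF kk(2)] by (rule supp_mono) (auto simp: box_def)
  qed simp
  moreover have "?u \<odot> basis [k] = 0"
    using kill_after[of a k \<kappa>] kk ak by (simp add: W_append)
  moreover have "\<kappa> - int n = k" by (simp add: \<kappa>_def)
  ultimately have "Rf \<kappa> (?u \<odot> basis [\<kappa>]) = - smul (v ^ 2) (Rf k ?u \<odot> basis [k])"
    using Rf_shift[OF AS_basis_power, of "run a \<kappa>" \<kappa> \<kappa>] by (simp add: wdg_simps Rf_simps)
  also have "Rf k ?u = smul (\<alpha>f i) (W (run a k) \<odot> basis (run (k + 1) \<kappa>))"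
    using R.vac_iter[of k "k + 1" \<kappa> a] Suc kk by (simp add: cf_def k_def wdg_simps)
  also have "smul (\<alpha>f i) (W (run a k) \<odot> basis (run (k + 1) \<kappa>)) \<odot> basis [k]
      = smul (\<alpha>f i) (W (run a k) \<odot> basis (run (k + 1) \<kappa> @ k # []))"
    by (simp only: wdg_simps wdg_basis_append)
  also have "W (run a k) \<odot> basis (run (k + 1) \<kappa> @ k # []) = smul (\<eta> 1) (W (run a k) \<odot> basis (run k \<kappa> @ []))"
    using move_left[of k \<kappa> "W (run a k)" "[]"] eta_prod'[of 1 k] kk by (simp add: \<kappa>_def)
  also have "W (run a k) \<odot> basis (run k \<kappa> @ []) = ?u"
    using run_append[of a k \<kappa>] kk ak by (simp flip: W_append)
  also have "?u \<odot> basis [\<kappa>] = W [a..\<kappa>]"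
    using run_snoc[of a \<kappa>] kk by (simp flip: W_append)
  finally show ?case
    unfolding \<kappa> by (simp add: \<alpha>f_def eta_1[unfolded One_nat_def] mult_ac)
qed

theorem Rf_removal: "removal n v Rf cf \<alpha>f"
proof -
  interpret R: removal_pre n v Rf cf by (rule cf_removal_pre)
  show ?thesis by unfold_locales (simp_all add: Rf_top \<alpha>f_def)
qed

lemma Rf_constant: "removal.K n v cf \<alpha>f \<kappa> j = 1 - v powi (2 * int n * int j)"
proof -
  interpret R: removal n v Rf cf \<alpha>f by (rule Rf_removal)
  \<comment> \<open>The contribution of one block of n vectors to \<open>\<eta> j\<close> times
    \<open>\<alpha>f j\<close>, up to the overall sign of \<eta>. The leading coefficients
    \<open>cf\<close> equal 1, so the denominator of K is 1.\<close>
  have "(- v) ^ (n - 1) * (- 1) * (- (v ^ 2) * (- v) ^ (n - 1)) = ((- v) ^ (n - 1) * (- v)) ^ 2"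
    by (simp add: power2_eq_square mult_ac)
  also have "(- v) ^ (n - 1) * (- v) = (- v) ^ n" using n_pos by (simp add: power_eq_if mult.commute)
  also have "((- v) ^ n) ^ 2 = (v ^ 2) ^ n" by (metis power2_minus power_mult mult.commute)
  finally have "\<eta> j * \<alpha>f j = - (((v ^ 2) ^ n) ^ j)"
    by (simp add: \<eta>_def \<alpha>f_def flip: power_mult_distrib)
  also have "((v ^ 2) ^ n) ^ j = v powi (2 * int n * int j)"
    by (simp add: power_int_mult flip: power_mult)
  finally have "\<eta> j * \<alpha>f j = - (v powi (2 * int n * int j))" .
  then show ?thesis by (simp add: R.K_def cf_def) (simp add: \<alpha>f_def)
qed

subsection \<open>The last coordinate\<close>

text \<open>Read off from T on the last two factors: the swapped tensor gives d = 0, and for d > 0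
  the geometric sum contains one suitable term precisely when \<kappa> and x are congruent.\<close>

definition cl :: "int \<Rightarrow> int \<Rightarrow> nat \<Rightarrow> complex" where
  "cl \<kappa> x d = (if d = 0 then (if \<kappa> mod int n = x mod int n then v else 1)
    else if \<kappa> mod int n = x mod int n then h else 0)"

lemma lc_pair: "lc \<kappa> (basis (ps @ [a, b] @ [])) = (if b = \<kappa> then basis (ps @ [a]) else 0)"
  using lc_snoc[of \<kappa> "ps @ [a]" b] by simp

lemma finite_shifts: "finite {s. 0 \<le> s \<and> t + int n * s < x}"
proof (rule finite_subset)
  show "{s. 0 \<le> s \<and> t + int n * s < x} \<subseteq> {0..max 0 (x - t)}"
  proof safe
    fix s :: int assume s: "0 \<le> s" "t + int n * s < x"
    then have "1 * s \<le> int n * s" using n_pos by (intro mult_right_mono) auto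
    with s show "s \<in> {0..max 0 (x - t)}" unfolding atLeastAtMost_iff by linarith
  qed
qed simp

lemma lc_T_last_basis:
  assumes "length ps = M" "\<kappa> < x" "\<kappa> - int B < t"
  shows "lc \<kappa> (T M (basis (ps @ [t, x] @ [])))
    = (if t \<le> \<kappa> then smul (cl \<kappa> x (nat (\<kappa> - t))) (basis (ps @ [x - (\<kappa> - t)])) else 0)"
proof -
  have n: "int n > 0" using n_pos by simp
  consider "t < x" | "t = x" | "x < t" by linarith
  then show ?thesis
  proof cases
    case 1
    let ?S = "{s. 0 \<le> s \<and> t + int n * s < x}"
    have sum: "(\<Sum>s\<in>?S. lc \<kappa> (basis (ps @ [t + int n * s, x - int n * s] @ [])))
        = (if \<kappa> mod int n = x mod int n \<and> t < \<kappa> then basis (ps @ [x - (\<kappa> - t)]) else 0)"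
    proof (cases "\<kappa> mod int n = x mod int n")
      case True
      then have "int n dvd x - \<kappa>" using mod_eq_dvd by (metis)
      then obtain s0 where s0: "x - \<kappa> = int n * s0" by (elim dvdE)
      have iff: "x - int n * s = \<kappa> \<longleftrightarrow> s = s0" for s
      proof -
        have "x - int n * s = \<kappa> \<longleftrightarrow> int n * s = int n * s0" using s0 by linarith
        then show ?thesis using n by simp
      qed
      have mem: "s0 \<in> ?S \<longleftrightarrow> t < \<kappa>"
      proof -
        have "0 < int n * s0" using s0 assms(2) by linarith
        then have "0 \<le> s0" using n by (simp add: zero_less_mult_iff)
        moreover have "t + int n * s0 < x \<longleftrightarrow> t < \<kappa>" using s0 by linarith
        ultimately show ?thesis by simp
      qed
      have "(\<Sum>s\<in>?S. lc \<kappa> (basis (ps @ [t + int n * s, x - int n * s] @ [])))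
          = (\<Sum>s\<in>?S. if s = s0 then basis (ps @ [t + int n * s0]) else 0)"
        by (intro sum.cong refl) (simp only: lc_pair iff cong: if_cong)
      also have "\<dots> = (if s0 \<in> ?S then basis (ps @ [t + int n * s0]) else 0)"
        by (simp only: sum.delta[OF finite_shifts])
      also have "t + int n * s0 = x - (\<kappa> - t)" using s0 by linarith
      finally show ?thesis using True mem by (simp only: if_True simp_thms)
    next
      case False
      have "x - int n * s \<noteq> \<kappa>" for s
      proof
        assume "x - int n * s = \<kappa>"
        then have "int n dvd \<kappa> - x" by (metis add_diff_cancel_left' diff_add_cancel dvd_minus_iff dvd_triv_left minus_diff_eq)
        then show False using False mod_eq_dvd by blast
      qed
      then show ?thesis using False by (simp only: lc_pair if_False sum.neutral_const simp_thms)
    qed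
    have "lc \<kappa> (T M (basis (ps @ [t, x] @ []))) = smul (if t mod int n = x mod int n then v else 1) (lc \<kappa> (basis (ps @ [x, t] @ [])))
        + smul h (\<Sum>s\<in>?S. lc \<kappa> (basis (ps @ [t + int n * s, x - int n * s] @ [])))"
      unfolding hecke_less[OF assms(1) 1] lc_simps ..
    also have "\<dots> = (if t \<le> \<kappa> then smul (cl \<kappa> x (nat (\<kappa> - t))) (basis (ps @ [x - (\<kappa> - t)])) else 0)"
      unfolding sum unfolding lc_pair cl_def by auto
    finally show ?thesis .
  next
    case 2
    have "lc \<kappa> (T M (basis (ps @ [t, x] @ []))) = smul v (lc \<kappa> (basis (ps @ [t, t] @ [])))"
      using hecke_equal[OF assms(1), of t "[]"] 2 by (simp add: lc_simps)
    then show ?thesis using 2 assms(2) unfolding lc_pair by simp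
  next
    case 3
    have "x + int n * s \<noteq> \<kappa>" if "s \<in> {s. 1 \<le> s \<and> x < t - int n * s}" for s
    proof -
      from that obtain d where "d = int n * s" "0 < d" by (rule shift_inner)
      then show ?thesis using assms(2) by linarith
    qed
    then have "(\<Sum>s\<in>{s. 1 \<le> s \<and> x < t - int n * s}. lc \<kappa> (basis (ps @ [t - int n * s, x + int n * s] @ []))) = 0"
      unfolding lc_pair by (intro sum.neutral) auto
    then show ?thesis
      unfolding hecke_greater[OF assms(1) 3] lc_simps using 3 assms(2) unfolding lc_pair by simp
  qed
qed

lemma lc_T_last:
  assumes u: "u \<in> tensor_power (Suc M)" "low a u" and x: "\<kappa> < x" "\<kappa> - int B < a"
  shows "lc \<kappa> (T M (tens u (basis [x]))) = (\<Sum>d\<le>B. smul (cl \<kappa> x d) (tens (lc (\<kappa> - int d) u) (basis [x - int d])))"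
proof -
  have "supp (\<lambda>t. length t = Suc M \<and> set t \<subseteq> {a..}) u"
    using u by (auto simp: tensor_power_supp supp_def)
  then show ?thesis
  proof (rule linop_eqI[where w = u, rotated 2])
    fix t' :: "int list" assume "length t' = Suc M \<and> set t' \<subseteq> {a..}"
    then obtain ps t where t: "t' = ps @ [t]" "length ps = M" "a \<le> t" by (auto simp: length_Suc_conv_rev)
    have "smul (cl \<kappa> x d) (tens (lc (\<kappa> - int d) (basis t')) (basis [x - int d]))
        = (if d = nat (\<kappa> - t) \<and> t \<le> \<kappa> then smul (cl \<kappa> x (nat (\<kappa> - t))) (basis (ps @ [x - (\<kappa> - t)])) else 0)" for d
      by (auto simp: t(1) lc_snoc tens_simps)
    then have "(\<Sum>d\<le>B. smul (cl \<kappa> x d) (tens (lc (\<kappa> - int d) (basis t')) (basis [x - int d])))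
        = (if t \<le> \<kappa> then smul (cl \<kappa> x (nat (\<kappa> - t))) (basis (ps @ [x - (\<kappa> - t)])) else 0)"
      using x(2) t(3) by (auto simp: sum.delta)
    then show "lc \<kappa> (T M (tens (basis t') (basis [x]))) = (\<Sum>d\<le>B. smul (cl \<kappa> x d) (tens (lc (\<kappa> - int d) (basis t')) (basis [x - int d])))"
      using lc_T_last_basis[OF t(2) x(1), of B t] x(2) t(1,3) by simp
  qed (intro linop_intros)+
qed

text \<open>Since \<kappa> < x, the appended vector itself is never removed, and only chains
  containing the last generator contribute. They carry a factor - 1 / v, which the power of - v in
  \<open>Rl\<close> absorbs, so the coefficients do not depend on N.\<close>

lemma Rl_rule:
  assumes u: "u \<in> tensor_power N" "AS u = u" "low a u" and x: "\<kappa> < x" "\<kappa> - int B < a"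
  shows "Rl \<kappa> (u \<odot> basis [x]) = (\<Sum>d\<le>B. smul (cl \<kappa> x d) (Rl (\<kappa> - int d) u \<odot> basis [x - int d]))"
proof -
  let ?z = "tens u (basis [x])"
  have z: "?z \<in> tensor_power (Suc N)" using tens_power[OF u(1) T_basis_power[of "[x]" 1]] by simp
  have pw: "u \<odot> basis [x] \<in> tensor_power (Suc N)"
    using wdg_power[OF u(1) T_basis_power[of "[x]" 1]] by simp
  have lz: "lc \<kappa> ?z = 0" using x by (simp add: lc_tens_snoc)
  have "lc \<kappa> (smul (qint_minus v (Suc N)) (u \<odot> basis [x])) = lc \<kappa> (H.C N ?z)"
    by (simp only: wedge_coset[OF u(1,2)])
  then have 1: "smul (qint_minus v (Suc N)) (lc \<kappa> (u \<odot> basis [x])) = lc \<kappa> (H.C N ?z)"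
    by (simp only: lc_simps)
  have 2: "lc \<kappa> (H.C N ?z) = smul (- inverse v * qint_minus v N) (\<Sum>d\<le>B. smul (cl \<kappa> x d) (lc (\<kappa> - int d) u \<odot> basis [x - int d]))"
  proof (cases N)
    case 0
    have "qint_minus v 0 = 0" by (simp add: qint_minus_def)
    then show ?thesis by (simp add: 0 H.C_def lz)
  next
    case (Suc M)
    have lu: "lc k u \<in> tensor_power M" "AS (lc k u) = lc k u" for k
      using lc_power[of u M] u lc_wedge by (simp_all add: Suc)
    have "lc \<kappa> (H.C (Suc M) ?z) = lc \<kappa> ?z + smul (- inverse v) (H.C M (lc \<kappa> (T M ?z)))"
      using z unfolding Suc by (intro H.C_last linop_lc' lc_T) auto
    also have "H.C M (lc \<kappa> (T M ?z)) = (\<Sum>d\<le>B. smul (cl \<kappa> x d) (H.C M (tens (lc (\<kappa> - int d) u) (basis [x - int d]))))"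
      using lc_T_last[of u M a \<kappa> x B] u x by (simp add: Suc linop_simps[OF H.linop_C'(1)[OF linop_id]])
    also have "\<dots> = smul (qint_minus v (Suc M)) (\<Sum>d\<le>B. smul (cl \<kappa> x d) (lc (\<kappa> - int d) u \<odot> basis [x - int d]))"
      by (simp add: wedge_coset(1)[OF lu, symmetric] tm.scale_sum_right mult.commute)
    finally show ?thesis unfolding Suc lz by simp
  qed
  have "Rl \<kappa> (u \<odot> basis [x]) = smul ((- v) ^ Suc N) (smul (qint_minus v (Suc N)) (lc \<kappa> (u \<odot> basis [x])))"
    unfolding Rl_lc[OF pw] by simp
  also have "\<dots> = smul ((- v) ^ N * qint_minus v N) (\<Sum>d\<le>B. smul (cl \<kappa> x d) (lc (\<kappa> - int d) u \<odot> basis [x - int d]))"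
    unfolding 1 2 tm.scale_scale by (simp add: mult_ac)
  also have "\<dots> = (\<Sum>d\<le>B. smul (cl \<kappa> x d) (Rl (\<kappa> - int d) u \<odot> basis [x - int d]))"
    unfolding Rl_lc[OF u(1)] by (simp add: wdg_simps tm.scale_sum_right mult.commute)
  finally show ?thesis .
qed

lemma cl_nonzero: "cl \<kappa> x 0 \<noteq> 0"
  by (simp add: cl_def)

lemma cl_periodic: "cl (\<kappa> - int n * int i) x 0 = cl \<kappa> x 0"
proof -
  have "(\<kappa> - int n * int i) mod int n = \<kappa> mod int n" by (simp add: mod_eq_dvd)
  then show ?thesis by (simp add: cl_def)
qed

lemma cl_removal_pre: "removal_pre n v Rl cl"
proof unfold_locales
  show "Rl \<kappa> (u \<odot> basis [x]) = (\<Sum>d\<le>B. smul (cl \<kappa> x d) (Rl (\<kappa> - int d) u \<odot> basis [x - int d]))"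
    if "u \<in> tensor_power N" "AS u = u" "low a u" "\<kappa> < x" "\<kappa> - int B < a" for u N a \<kappa> x B
    using that by (rule Rl_rule)
qed (auto intro: linop_Rl' Rl_wedge Rl_low Rl_box Rl_psum simp: cl_nonzero cl_periodic)

text \<open>In T of the last two factors only the summand s = 0 ends in x, with coefficient h;
  passing from T to its inverse subtracts exactly this term.\<close>

lemma lc_top:
  assumes u: "u \<in> tensor_power (Suc M)" "supp (\<lambda>t. set t \<subseteq> {..<x}) u"
  shows "lc x (T_inv M (tens u (basis [x]))) = 0"
proof -
  have "supp (\<lambda>t. length t = Suc M \<and> set t \<subseteq> {..<x}) u"
    using u by (auto simp: tensor_power_supp supp_def)
  then have "lc x (T_inv M (tens u (basis [x]))) = (\<lambda>u. 0) u"
  proof (rule linop_eqI[where w = u, rotated 2])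
    fix t' :: "int list" assume "length t' = Suc M \<and> set t' \<subseteq> {..<x}"
    then obtain ps t where t: "t' = ps @ [t]" "length ps = M" "t < x" by (auto simp: length_Suc_conv_rev)
    let ?S = "{s. 0 \<le> s \<and> t + int n * s < x}"
    have "(\<Sum>s\<in>?S. lc x (basis (ps @ [t + int n * s, x - int n * s] @ [])))
        = (\<Sum>s\<in>?S. if s = 0 then basis (ps @ [t]) else 0)"
      using n_pos by (intro sum.cong refl) (simp add: lc_pair[simplified])
    also have "\<dots> = basis (ps @ [t])" using t(3) by (simp add: sum.delta[OF finite_shifts])
    finally have "lc x (T M (basis (ps @ [t, x] @ []))) = smul h (basis (ps @ [t]))"
      unfolding hecke_less[OF t(2,3)] lc_simps using t(3) by (simp add: lc_pair[simplified])
    then show "lc x (T_inv M (tens (basis t') (basis [x]))) = 0"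
      using lc_pair[of x ps t x] by (simp add: t(1) T_inv_def lc_simps)
  qed (intro linop_intros)+
  then show ?thesis by simp
qed

text \<open>With N = ni this is (- v)^(N + 1) times v^(- 2 N), the ratio of the minus integer to the
  plus integer of N + 1.\<close>

definition \<alpha>l :: "nat \<Rightarrow> complex" where "\<alpha>l i = (- v) * ((- v) ^ n * (inverse v ^ 2) ^ n) ^ i"

text \<open>In the expansion by inverse generators \<open>lc_top\<close> kills every nonempty chain,
  so only the original wedge remains; the rest is conversion of quantum integers.\<close>

lemma Rl_top: "Rl (a + int n * int i) (W [a..a + int n * int i]) = smul (\<alpha>l i) (W (run a (a + int n * int i)))"
proof -
  define \<kappa> N where "\<kappa> = a + int n * int i" and "N = n * i"
  have a\<kappa>: "a \<le> \<kappa>" by (simp add: \<kappa>_def)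
  let ?u = "W (run a \<kappa>)" and ?z = "tens (W (run a \<kappa>)) (basis [\<kappa>])"
  have len: "length (run a \<kappa>) = N" by (simp add: \<kappa>_def N_def nat_mult_distrib)
  have u: "?u \<in> tensor_power N" using AS_basis_power[of "run a \<kappa>"] len by simp
  have ub: "supp (\<lambda>t. set t \<subseteq> {..<\<kappa>}) ?u"
    using W_run_box[OF a\<kappa>] by (rule supp_mono) (auto simp: box_def)
  have z: "?z \<in> tensor_power (Suc N)" using tens_power[OF u T_basis_power[of "[\<kappa>]" 1]] by simp
  have pw: "?u \<odot> basis [\<kappa>] \<in> tensor_power (Suc N)"
    using wdg_power[OF u T_basis_power[of "[\<kappa>]" 1]] by simp
  have lz: "lc \<kappa> ?z = ?u" by (simp add: lc_tens_snoc)
  have "lc \<kappa> (Hi.C N ?z) = ?u"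
  proof (cases N)
    case 0
    then show ?thesis by (simp add: Hi.C_def lz)
  next
    case (Suc M)
    have "lc \<kappa> (Hi.C (Suc M) ?z) = lc \<kappa> ?z + smul (- v) (Hi.C M (lc \<kappa> (T_inv M ?z)))"
      using z unfolding Suc by (intro Hi.C_last linop_lc' lc_T_inv) auto
    moreover have "lc \<kappa> (T_inv M ?z) = 0" using lc_top[OF _ ub] u by (simp add: Suc)
    ultimately show ?thesis
      by (simp add: Suc lz linop_simps[OF Hi.linop_C'(1)[OF linop_id]])
  qed
  moreover have "lc \<kappa> (smul (qint_plus v (Suc N)) (?u \<odot> basis [\<kappa>])) = lc \<kappa> (Hi.C N ?z)"
    using wedge_coset(2)[OF u, of \<kappa>] by simp
  ultimately have 1: "smul (qint_plus v (Suc N)) (lc \<kappa> (?u \<odot> basis [\<kappa>])) = ?u"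
    by (simp only: lc_simps)
  have "qint_minus v (Suc N) = (inverse v ^ 2) ^ N * qint_plus v (Suc N)"
    unfolding qint_plus_minus by (simp add: power_inverse flip: power_mult_distrib mult.assoc)
  then have 2: "Rl \<kappa> (?u \<odot> basis [\<kappa>])
      = smul ((- v) ^ Suc N * (inverse v ^ 2) ^ N) (smul (qint_plus v (Suc N)) (lc \<kappa> (?u \<odot> basis [\<kappa>])))"
    unfolding Rl_lc[OF pw] by (simp add: mult_ac)
  have 3: "?u \<odot> basis [\<kappa>] = W [a..\<kappa>]" using run_snoc[OF a\<kappa>] by (simp flip: W_append)
  have 4: "(- v) ^ Suc N * (inverse v ^ 2) ^ N = \<alpha>l i"
    unfolding \<alpha>l_def N_def power_mult power_mult_distrib power_Suc by (simp only: mult.assoc)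
  show ?thesis using 2 unfolding 1 4 unfolding 3 unfolding \<kappa>_def .
qed

theorem Rl_removal: "removal n v Rl cl \<alpha>l"
proof -
  interpret R: removal_pre n v Rl cl by (rule cl_removal_pre)
  show ?thesis by unfold_locales (simp_all add: Rl_top \<alpha>l_def)
qed

lemma cl_block: "(\<Prod>x\<in>{\<kappa> - int (n * j) + 1..\<kappa>}. cl \<kappa> x 0) = v ^ j"
proof (induction j)
  case (Suc j)
  obtain a m where a: "a = int (n * j)" and m: "m = int n" by simp
  have n: "m > 0" and a0: "a \<ge> 0" using n_pos by (simp_all add: a m)
  have am: "int (n * Suc j) = a + m" by (simp add: a m)
  have set: "{\<kappa> - (a + m) + 1..\<kappa>} = {\<kappa> - a + 1..\<kappa>} \<union> insert (\<kappa> - a) {\<kappa> - (a + m) + 1..\<kappa> - a - 1}"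
    using n a0 by auto
  have "cl \<kappa> x 0 = 1" if x: "x \<in> {\<kappa> - (a + m) + 1..\<kappa> - a - 1}" for x
  proof -
    have "\<not> int n dvd \<kappa> - x - a" using x by (intro zdvd_not_zless) (auto simp: m)
    moreover have "int n dvd a" by (simp add: a)
    ultimately have "\<not> int n dvd \<kappa> - x" by (metis dvd_diff)
    then show ?thesis by (simp add: cl_def mod_eq_dvd)
  qed
  moreover have "cl \<kappa> (\<kappa> - a) 0 = v" by (simp add: cl_def mod_eq_dvd a)
  moreover have "(\<Prod>x\<in>{\<kappa> - (a + m) + 1..\<kappa>}. cl \<kappa> x 0) = (\<Prod>x\<in>{\<kappa> - a + 1..\<kappa>}. cl \<kappa> x 0)
      * (cl \<kappa> (\<kappa> - a) 0 * (\<Prod>x\<in>{\<kappa> - (a + m) + 1..\<kappa> - a - 1}. cl \<kappa> x 0))"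
    unfolding set using n a0 by (subst prod.union_disjoint) auto
  ultimately show ?case unfolding am using Suc[folded a] by simp
qed simp

lemma Rl_constant: "removal.K n v cl \<alpha>l \<kappa> j = 1 - v powi (- 2 * int j)"
proof -
  interpret R: removal n v Rl cl \<alpha>l by (rule Rl_removal)
  have vn: "(- v) ^ (n - 1) * (- v) = (- v) ^ n" using n_pos by (simp add: power_eq_if mult.commute)
  \<comment> \<open>Per block, \<eta> and \<alpha>l together give 1 / v up to the overall sign; the
    denominator in K supplies another factor v by \<open>cl_block\<close>.\<close>
  have "(- v) ^ (n - 1) * (- 1) * ((- v) ^ n * (inverse v ^ 2) ^ n)
      = inverse v * (((- v) ^ (n - 1) * (- v)) * ((- v) ^ n * (inverse v ^ 2) ^ n))"
    by (simp add: mult_ac)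
  also have "\<dots> = inverse v"
  proof -
    have "(- v) ^ n * ((- v) ^ n * (inverse v ^ 2) ^ n) = ((- v) * ((- v) * inverse v ^ 2)) ^ n"
      by (simp only: power_mult_distrib)
    also have "(- v) * ((- v) * inverse v ^ 2) = 1" by (simp add: power2_eq_square)
    finally show ?thesis unfolding vn by simp
  qed
  finally have "\<eta> j * (\<alpha>l j / \<alpha>l 0) = - (inverse v ^ j)"
    by (simp add: \<eta>_def \<alpha>l_def flip: power_mult_distrib)
  moreover have "R.K \<kappa> j = 1 + \<eta> j * (\<alpha>l j / \<alpha>l 0) / v ^ j"
    unfolding R.K_def cl_block by simp
  moreover have "inverse v ^ j / v ^ j = v powi (- 2 * int j)"
    by (simp add: power_int_minus power_int_mult power_inverse divide_inverse power_mult power2_eq_square power_mult_distrib)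
  ultimately show ?thesis by simp
qed

end

context wedge_setup
begin

subsection \<open>Inserting a vector on the right\<close>

text \<open>If a \<ge> M, then a repeats a vector of the run. Otherwise b does, so the swapped pair
  vanishes, and the inner pairs have the same sum and smaller distance.\<close>

lemma kill_pair:
  assumes "a < l" "b < l" "2 * M \<le> a + b"
  shows "u \<odot> basis (run M l @ [a, b] @ qs) = 0"
  using assms
proof (induction "nat \<bar>b - a\<bar>" arbitrary: a b rule: less_induct)
  case less
  show ?case
  proof (cases "M \<le> a")
    case True
    then have "u \<odot> basis ([] @ (run M l @ [a]) @ b # qs) = 0"
      using less.prems by (intro wdg_kill kill_after)
    then show ?thesis by simp
  next
    case False
    then have ab: "a < b" "M \<le> b" using less.prems by auto
    let ?f = "\<lambda>x y. u \<odot> W (run M l @ [x, y] @ qs)"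
    have swap: "?f b a = 0"
    proof -
      have "u \<odot> basis ([] @ (run M l @ [b]) @ a # qs) = 0"
        using ab less.prems by (intro wdg_kill kill_after)
      then show ?thesis by (simp only: wdg_AS_right) simp
    qed
    have inner: "?f (a + int n * s) (b - int n * s) = 0" if "s \<in> {s. 1 \<le> s \<and> a + int n * s < b}" for s
    proof -
      obtain d where d: "d = int n * s" by simp
      have "0 < d" unfolding d by (rule shift_pos) (use that in simp)
      moreover have "a + d < b" using that unfolding d by simp
      ultimately have "u \<odot> basis (run M l @ [a + d, b - d] @ qs) = 0"
        using less.prems by (intro less.hyps) auto
      then show ?thesis unfolding d by (simp only: wdg_AS_right)
    qed
    have "W [a, b] = smul (- inverse v) (smul (- v) (W [a, b]))" by simp
    also have "\<dots> = smul (- inverse v * (if a mod int n = b mod int n then v else 1)) (W [b, a])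
      + smul (- inverse v * h) (\<Sum>s\<in>{s. 1 \<le> s \<and> a + int n * s < b}. W [a + int n * s, b - int n * s])"
      unfolding pair_less[OF ab(1)] tm.scale_right_distrib tm.scale_scale ..
    finally have "W [a, b] = smul (- inverse v * (if a mod int n = b mod int n then v else 1)) (W [b, a])
      + smul (- inverse v * h) (\<Sum>s\<in>{s. 1 \<le> s \<and> a + int n * s < b}. W [a + int n * s, b - int n * s])" .
    from W_pair_sum[OF this, of "run M l" qs] have "?f a b = 0"
      using inner by (simp only: wdg_simps swap) simp
    then show ?thesis by (simp only: wdg_AS_right)
  qed
qed

text \<open>Here k may lie below the run: the inner pairs keep the sum k + l and stay below l, so
  \<open>kill_pair\<close> removes them.\<close>

lemma exchange_far:
  assumes "k < l" "2 * M \<le> k + l"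
  shows "u \<odot> basis (run M l @ [l, k] @ qs) = smul (cc (l - k)) (u \<odot> basis (run M l @ [k, l] @ qs))"
proof -
  have "u \<odot> W (run M l @ [l - int n * s, k + int n * s] @ qs) = 0"
    if "s \<in> {s. 1 \<le> s \<and> k < l - int n * s}" for s
  proof -
    from that obtain d where d: "d = int n * s" "0 < d" "k < l - d" by (rule shift_inner)
    have "u \<odot> basis (run M l @ [l - d, k + d] @ qs) = 0"
      using d assms by (intro kill_pair) auto
    then show ?thesis unfolding d(1) by (simp only: wdg_AS_right)
  qed
  then have "u \<odot> W (run M l @ [l, k] @ qs) = smul (cc (l - k)) (u \<odot> W (run M l @ [k, l] @ qs))"
    unfolding W_pair_sum[OF pair_greater'[OF assms(1)]] wdg_simps by simp
  then show ?thesis by (simp only: wdg_AS_right)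
qed

lemma sorted_sum_bound:
  "sorted_wrt (<) xs \<Longrightarrow> (\<And>x. x \<in> set xs \<Longrightarrow> x < b) \<Longrightarrow> sum_list xs \<le> sum_list (run (b - int (length xs)) b)"
proof (induction xs arbitrary: b rule: rev_induct)
  case (snoc y xs)
  have "sum_list xs \<le> sum_list (run (b - 1 - int (length xs)) (b - 1))"
    using snoc.prems by (intro snoc.IH) (force simp: sorted_wrt_append)+
  moreover have "run (b - int (length (xs @ [y]))) b = run (b - 1 - int (length xs)) (b - 1) @ [b - 1]"
    using run_snoc[of "b - 1 - int (length xs)" "b - 1"] by (simp add: algebra_simps)
  moreover have "y \<le> b - 1" using snoc.prems(2)[of y] by simp
  ultimately show ?case by simp
qed simp

text \<open>In an increasing list of this length and sum, the last 2J - 1 entries are bounded by the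
  top of the interval, so the first two sum to at least k' + l. If the second is below l,
  \<open>kill_pair\<close> applies; otherwise all entries after the first form the run from l, and
  the sum forces the first to be k'.\<close>

lemma far_coefficient:
  assumes z: "supp (box k (l + 2 * int J) (sum_list (run l (l + 2 * int J)) + k') (Suc (2 * J))) z"
    and J: "J > 0" and l: "k' < l" "2 * M \<le> k' + l" "M \<le> l"
  obtains \<mu> where "\<And>u. u \<odot> basis (run M l) \<odot> z = smul \<mu> (u \<odot> basis (run M l @ k' # run l (l + 2 * int J)))"
proof -
  let ?b = "l + 2 * int J"
  let ?\<sigma> = "sum_list (run l ?b) + k'"
  let ?g = "{W s |s. sorted_wrt (<) s \<and> box k ?b ?\<sigma> (Suc (2 * J)) s}"
  \<comment> \<open>The tensors for which the claim holds form a subspace, so checking the spanning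
    wedges suffices.\<close>
  define S where "S = {x. \<exists>\<mu>. \<forall>u. u \<odot> basis (run M l) \<odot> x = smul \<mu> (u \<odot> basis (run M l @ k' # run l ?b))}"
  have "tm.subspace S"
  proof (rule tm.subspaceI)
    show "0 \<in> S" unfolding S_def by (auto simp: wdg_simps intro!: exI[of _ 0])
    show "x + y \<in> S" if "x \<in> S" "y \<in> S" for x y
    proof -
      from that obtain a b where "\<forall>u. u \<odot> basis (run M l) \<odot> x = smul a (u \<odot> basis (run M l @ k' # run l ?b))"
        "\<forall>u. u \<odot> basis (run M l) \<odot> y = smul b (u \<odot> basis (run M l @ k' # run l ?b))"
        unfolding S_def by blast
      then show ?thesis unfolding S_def by (auto simp: wdg_simps tm.scale_left_distrib intro!: exI[of _ "a + b"])
    qed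
    show "smul c x \<in> S" if "x \<in> S" for c x
    proof -
      from that obtain a where "\<forall>u. u \<odot> basis (run M l) \<odot> x = smul a (u \<odot> basis (run M l @ k' # run l ?b))"
        unfolding S_def by blast
      then show ?thesis unfolding S_def by (auto simp: wdg_simps intro!: exI[of _ "c * a"])
    qed
  qed
  moreover have "?g \<subseteq> S"
  proof
    fix x assume "x \<in> ?g"
    then obtain s where x: "x = W s" and s: "sorted_wrt (<) s" "box k ?b ?\<sigma> (Suc (2 * J)) s" by blast
    obtain s1 s2 r where sr: "s = s1 # s2 # r" 
      using s(2) J by (cases s; cases "tl s") (auto simp: box_def)
    have len: "int (length r) = 2 * int J - 1" and bd: "\<And>x. x \<in> set s \<Longrightarrow> x < ?b"
      and sum: "s1 + s2 + sum_list r = ?\<sigma>"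
      using s(2) J by (auto simp: box_def sr)
    have run: "run l ?b = l # run (l + 1) ?b" using J by (intro run_Cons) simp
    have "sum_list r \<le> sum_list (run (?b - int (length r)) ?b)"
      using s(1) bd by (intro sorted_sum_bound) (auto simp: sr)
    also have "?b - int (length r) = l + 1" using len by simp
    finally have s12: "k' + l \<le> s1 + s2" using sum run by simp
    have xz: "u \<odot> basis (run M l) \<odot> x = u \<odot> basis (run M l @ s)" for u
      by (simp add: x wdg_basis_append)
    show "x \<in> S"
    proof (cases "s2 < l")
      case True
      have "u \<odot> basis (run M l @ [s1, s2] @ r) = 0" for u
        using s(1) True s12 l by (intro kill_pair) (auto simp: sr)
      then have "u \<odot> basis (run M l) \<odot> x = 0" for u by (simp add: xz[unfolded sr] sr)
      then show ?thesis unfolding S_def by (auto intro!: exI[of _ 0])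
    next
      case False
      have "s2 # r = run l ?b"
      proof (rule sorted_full)
        show "sorted_wrt (<) (s2 # r)" using s(1) by (simp add: sr)
        show "set (s2 # r) \<subseteq> {l..<?b}" using s(1) False bd by (fastforce simp: sr)
        show "int (length (s2 # r)) = ?b - l" using len by simp
      qed
      moreover from this have "s1 = k'" using sum by (metis add_diff_cancel_left' add_diff_cancel_right' sum_list.Cons add.assoc)
      ultimately have "s = k' # run l ?b" by (simp add: sr)
      then show ?thesis unfolding S_def using xz by (auto intro!: exI[of _ 1])
    qed
  qed
  ultimately have "tm.span ?g \<subseteq> S" by (intro tm.span_minimal)
  then have "AS z \<in> S" using straighten_supp[OF z] by blast
  then show ?thesis using that unfolding S_def by auto
qed

lemma eta_sq: "\<eta> j ^ 2 = v powi (2 * int (n - 1) * int j)"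
proof -
  have "\<eta> j ^ 2 = (((- v) ^ (n - 1) * (- 1)) ^ 2) ^ j"
    by (simp add: \<eta>_def mult_ac flip: power_mult)
  also have "((- v) ^ (n - 1) * (- 1)) ^ 2 = (v ^ 2) ^ (n - 1)"
    by (simp add: power_mult_distrib flip: power_mult) (simp add: power_mult mult.commute)
  finally show ?thesis by (simp add: power_int_mult mult_ac flip: power_mult)
qed

text \<open>
  Both sides are multiples of one wedge with factors independent of \<open>u\<close>.  To compare them, take for
  the left part the vectors from \<open>e\<^sub>k\<close> on with \<open>e\<^sub>k\<^sub>'\<close> missing, and apply the power sum to its vanishing
  wedge product with \<open>e\<^sub>k\<close>.
\<close>

theorem insert_correction:
  assumes j: "j > 0" and k': "k' = k + int (n * j)"
  shows "\<exists>L\<ge>M. \<forall>l\<ge>L. \<forall>u.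
    u \<odot> basis (run M l) \<odot> psum (int j) (basis (run l (l + int (n * j)))) \<odot> basis (k # run (l + int (n * j)) (l + 2 * int (n * j)))
    = smul (\<eta> j ^ 2 - 1) (u \<odot> basis (run M (l + int (n * j))) \<odot> basis (k' # run (l + int (n * j)) (l + 2 * int (n * j))))"
proof -
  obtain J where J: "J = n * j" by simp
  have J0: "J > 0" using n_pos j by (simp add: J)
  have iJ: "int J = int n * int j" by (simp add: J)
  have k'J: "k' = k + int J" using k' by (simp add: J)
  \<comment> \<open>Beyond k', so that the hole of the test vector lies before the run that starts
    at M0.\<close>
  define M0 where "M0 = max M (k' + 1)"
  have main: "u \<odot> basis (run M0 l) \<odot> psum (int j) (basis (run l (l + int J))) \<odot> basis (k # run (l + int J) (l + 2 * int J))
    = smul (\<eta> j ^ 2 - 1) (u \<odot> basis (run M0 l) \<odot> basis (run l (l + int J)) \<odot> basis (k' # run (l + int J) (l + 2 * int J)))"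
    if l: "l \<ge> M0" "l \<ge> 2 * M0 - k'" for l u
  proof -
    define b b' y tl where "b = l + int J" and "b' = l + 2 * int J" and "y = psum (int j) (basis (run l b))"
      and "tl = run b b'"
    note defs = b_def b'_def y_def tl_def
    have kk: "k < k'" "k' + 1 \<le> M0" "M0 \<le> l" "k' < l" "l \<le> b" "b \<le> b'" "k' < b" "k + 1 \<le> b" "2 * M0 \<le> k' + l"
      using J0 l by (auto simp: defs k'J M0_def)
    let ?\<sigma> = "sum_list (run l b') + k'"
    have sumb: "sum_list (run l b') = sum_list (run l b) + sum_list tl"
      using run_append[of l b b'] kk by (simp add: tl_def flip: sum_list_append)
    have z1: "supp (box k b' ?\<sigma> (Suc (2 * J))) (tens y (basis (k # tl)))"
    proof (rule supp_tens[where P = "box l b' (sum_list (run l b) + int J) J" and Q = "\<lambda>t. t = k # tl"])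
      show "supp (box l b' (sum_list (run l b) + int J) J) y"
        using psum_run_box[OF j, of l] unfolding defs J .
      show "supp (\<lambda>t. t = k # tl) (basis (k # tl))" by simp
      show "box k b' ?\<sigma> (Suc (2 * J)) (s @ t)"
        if "box l b' (sum_list (run l b) + int J) J s" "t = k # tl" for s t
        using that kk J0 sumb by (force simp: box_def tl_def b_def b'_def k'J)
    qed
    have z2: "supp (box k b' ?\<sigma> (Suc (2 * J))) (basis (run l b @ k' # tl))"
      using kk J0 sumb by (auto simp: box_def tl_def b_def b'_def)
    obtain \<mu>1 where mu1: "\<And>u. u \<odot> basis (run M0 l) \<odot> tens y (basis (k # tl)) = smul \<mu>1 (u \<odot> basis (run M0 l @ k' # run l b'))"
      using far_coefficient[OF z1[unfolded b'_def] J0 kk(4,9,3)] unfolding b'_def by blast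
    obtain \<mu>2 where mu2: "\<And>u. u \<odot> basis (run M0 l) \<odot> basis (run l b @ k' # tl) = smul \<mu>2 (u \<odot> basis (run M0 l @ k' # run l b'))"
      using far_coefficient[OF z2[unfolded b'_def] J0 kk(4,9,3)] unfolding b'_def by blast
    have yt: "x \<odot> y \<odot> basis t = x \<odot> tens y (basis t)" for x t
      unfolding wdg_assoc by (simp only: wdg_def AS_tens_right)
    define u0 where "u0 = W (run k k' @ run (k' + 1) M0)"
    define hh where "hh = W (run k k' @ run (k' + 1) l)"
    define V where "V = W (run k b')"
    define \<gamma> where "\<gamma> x = (\<Prod>y\<in>{x + 1..<b}. cc (y - x))" for x
    have hh: "u0 \<odot> basis (run M0 l) = hh"
      using run_append[of "k' + 1" M0 l] kk by (simp add: u0_def hh_def flip: W_append)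
    have hb: "hh \<odot> basis (run l b) = W (run k k' @ run (k' + 1) b)"
      using run_append[of "k' + 1" l b] kk by (simp add: hh_def flip: W_append)
    have tl: "run k b @ tl = run k b'"
      using run_append[of k b b'] kk by (simp add: tl_def)
    have fill': "hh \<odot> basis (run l b) \<odot> basis (k' # tl) = smul (\<gamma> k') V"
    proof -
      have "hh \<odot> basis (run l b) \<odot> basis (k' # tl) = basis (run k k') \<odot> basis (run (k' + 1) b @ k' # tl)"
        unfolding hb by (simp flip: W_append)
      also have "\<dots> = smul (\<gamma> k') (basis (run k k') \<odot> basis (run k' b @ tl))"
        unfolding \<gamma>_def using kk by (intro move_left) simp
      also have "basis (run k k') \<odot> basis (run k' b @ tl) = V"
        using run_append'[of k k' b tl] kk tl by (simp add: V_def flip: W_append)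
      finally show ?thesis .
    qed
    have fill: "W (run (k + 1) b) \<odot> basis (k # tl) = smul (\<gamma> k) V"
    proof -
      have "W (run (k + 1) b) \<odot> basis (k # tl) = basis [] \<odot> basis (run (k + 1) b @ k # tl)"
        by (simp flip: W_append)
      also have "\<dots> = smul (\<gamma> k) (basis [] \<odot> basis (run k b @ tl))"
        unfolding \<gamma>_def using kk by (intro move_left) simp
      finally show ?thesis unfolding tl by (simp add: V_def)
    qed
    \<comment> \<open>The vector crosses the nj - 1 neighbours before k', then k' itself with factor
      - 1, then vectors at distances congruent to those from k'.\<close>
    have \<gamma>k: "\<gamma> k = - (\<eta> j * \<gamma> k')"
    proof -
      have set: "{k + 1..<b} = {k + 1..<k'} \<union> insert k' {k' + 1..<b}" using kk by auto
      have "cc (y - k) = cc (y - k')" for y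
      proof -
        have "y - k = y - k' + int n * int j" by (simp add: k'J J)
        then have "int n dvd y - k \<longleftrightarrow> int n dvd y - k'" by (metis dvd_add_left_iff dvd_triv_left)
        then show ?thesis by (simp add: cc_def)
      qed
      moreover have "cc (k' - k) = - 1" by (simp add: cc_def k'J J)
      moreover have "(\<Prod>y\<in>{k + 1..<k'}. cc (y - k)) = \<eta> j"
        using eta_prod'[OF j, of k] by (simp add: k'J iJ)
      moreover have "\<gamma> k = (\<Prod>y\<in>{k + 1..<k'}. cc (y - k)) * (cc (k' - k) * (\<Prod>y\<in>{k' + 1..<b}. cc (y - k)))"
        unfolding \<gamma>_def set by (subst prod.union_disjoint) auto
      ultimately show ?thesis by (simp only: \<gamma>_def) simp
    qed
    \<comment> \<open>k occurs twice: the length fits the interval, but the sum does not.\<close>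
    have "W (run k k' @ run (k' + 1) b @ [k]) = 0"
    proof (rule W_wrong_sum[of _ k b])
      have "run k b = run k k' @ k' # run (k' + 1) b"
        using run_append[of k k' b] run_Cons[of k' b] kk by simp
      then show "sum_list (run k k' @ run (k' + 1) b @ [k]) \<noteq> sum_list [k..b - 1]" using kk by simp
    qed (use kk in auto)
    then have "(hh \<odot> basis (run l b)) \<odot> basis [k] = 0"
      unfolding hb by (simp flip: W_append)
    \<comment> \<open>The power sum of this zero has three parts: raising inside \<open>hh\<close>
      fills its hole, raising in the tail is the boundary term, and raising k gives k'. The first
      and the third are known.\<close>
    then have "psum (int j) ((hh \<odot> basis (run l b)) \<odot> basis [k]) = 0" by (simp add: psum_simps)
    then have "(psum (int j) hh \<odot> basis (run l b) + hh \<odot> y) \<odot> basis [k] + hh \<odot> basis (run l b) \<odot> basis [k'] = 0"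
      by (simp add: psum_wdg psum_single y_def k'J iJ)
    then have "((psum (int j) hh \<odot> basis (run l b) + hh \<odot> y) \<odot> basis [k] + hh \<odot> basis (run l b) \<odot> basis [k']) \<odot> basis tl = 0"
      by (simp add: wdg_simps)
    then have sum0: "psum (int j) hh \<odot> basis (run l b) \<odot> basis (k # tl) + hh \<odot> y \<odot> basis (k # tl)
        + hh \<odot> basis (run l b) \<odot> basis (k' # tl) = 0"
      by (simp add: wdg_simps wdg_basis_append)
    have "basis [] \<odot> psum (int j) (basis (run k k' @ run (k' + 1) l)) \<odot> basis (run l (l + int n * int j))
        = smul (\<eta> j) (basis [] \<odot> basis (run (k + 1) (l + int n * int j)))"
      by (rule psum_hole) (use j kk in \<open>auto simp: k'J J\<close>)
    then have "psum (int j) hh \<odot> basis (run l b) = smul (\<eta> j) (W (run (k + 1) b))"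
      by (simp add: hh_def AS_psum[symmetric] b_def iJ)
    then have "psum (int j) hh \<odot> basis (run l b) \<odot> basis (k # tl) = smul (\<eta> j * \<gamma> k) V"
      by (simp only: wdg_simps fill tm.scale_scale)
    with sum0 fill' have "hh \<odot> y \<odot> basis (k # tl) = - smul (\<eta> j * \<gamma> k) V - smul (\<gamma> k') V"
      by (simp add: eq_neg_iff_add_eq_0 algebra_simps)
    also have "\<dots> = smul ((\<eta> j ^ 2 - 1) * \<gamma> k') V"
      unfolding \<gamma>k by (rule poly_mapping_eqI) (simp add: lookup_minus algebra_simps power2_eq_square)
    also have "\<dots> = smul (\<eta> j ^ 2 - 1) (hh \<odot> basis (run l b) \<odot> basis (k' # tl))"
      unfolding fill' by simp
    finally have vac: "hh \<odot> y \<odot> basis (k # tl) = smul (\<eta> j ^ 2 - 1) (hh \<odot> basis (run l b) \<odot> basis (k' # tl))" .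
    define X where "X = u0 \<odot> basis (run M0 l @ k' # run l b')"
    have v1: "hh \<odot> y \<odot> basis (k # tl) = smul \<mu>1 X"
      unfolding yt X_def using mu1[of u0] by (simp only: hh)
    have v2: "hh \<odot> basis (run l b) \<odot> basis (k' # tl) = smul \<mu>2 X"
      unfolding X_def using mu2[of u0] by (simp only: hh wdg_basis_append)
    have "\<gamma> k' \<noteq> 0" by (simp add: \<gamma>_def cc_nonzero)
    moreover have "V \<noteq> 0"
    proof -
      \<comment> \<open>Supplies the nonvanishing of runs, which is proved through a removal
        operator.\<close>
      interpret R: removal n v Rf cf \<alpha>f by (rule Rf_removal)
      show ?thesis unfolding V_def by (rule R.W_run_nonzero) (use kk in simp)
    qed
    ultimately have X: "X \<noteq> 0" using v2 fill' by auto
    have "smul \<mu>1 X = smul ((\<eta> j ^ 2 - 1) * \<mu>2) X" using vac unfolding v1 v2 by simp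
    then have "\<mu>1 = (\<eta> j ^ 2 - 1) * \<mu>2" using X by (simp add: tm.scale_right_imp_eq)
    then show ?thesis
      using mu1[of u] mu2[of u] unfolding defs[symmetric] yt by (simp only: wdg_basis_append tm.scale_scale append_assoc)
  qed
  show ?thesis unfolding J[symmetric]
  proof (intro exI[of _ "max M0 (2 * M0 - k')"] conjI allI impI)
    show "M \<le> max M0 (2 * M0 - k')" by (simp add: M0_def)
    fix l u assume "max M0 (2 * M0 - k') \<le> l"
    then have l: "l \<ge> M0" "l \<ge> 2 * M0 - k'" by auto
    have r: "run M l = run M M0 @ run M0 l" using l(1) by (intro run_append[symmetric]) (auto simp: M0_def)
    have r': "run M (l + int J) = run M M0 @ run M0 l @ run l (l + int J)"
      using l(1) run_append[of M0 l "l + int J"] run_append[of M M0 "l + int J"] by (simp add: M0_def)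
    show "u \<odot> basis (run M l) \<odot> psum (int j) (basis (run l (l + int J))) \<odot> basis (k # run (l + int J) (l + 2 * int J))
      = smul (\<eta> j ^ 2 - 1) (u \<odot> basis (run M (l + int J)) \<odot> basis (k' # run (l + int J) (l + 2 * int J)))"
      using main[OF l, of "u \<odot> basis (run M M0)"] unfolding r r' by (simp only: wdg_basis_append append_assoc)
  qed
qed

end

subsection \<open>The inductive limit\<close>

context wedge_setup
begin

abbreviation ws :: "nat \<Rightarrow> tensor set" where "ws \<equiv> wedge_space n v"

abbreviation up :: "int \<Rightarrow> nat \<Rightarrow> nat \<Rightarrow> tensor \<Rightarrow> tensor" where
  "up m l N w \<equiv> w \<odot> basis (run (int l - m) (int N - m))"

lemma ws_diff: "w \<in> ws N \<Longrightarrow> u \<in> ws N \<Longrightarrow> w - u \<in> ws N"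
  and ws_smul: "w \<in> ws N \<Longrightarrow> smul c w \<in> ws N"
  and ws_psum: "w \<in> ws N \<Longrightarrow> psum j w \<in> ws N"
  by (auto simp: wedge_space_iff AS_simps AS_psum intro: tensor_power_intros psum_power)

lemma ws_wdg: "u \<in> ws N \<Longrightarrow> w \<in> tensor_power M \<Longrightarrow> u \<odot> w \<in> ws (N + M)"
  by (simp add: wedge_space_iff wdg_power)

lemma up_ws: "w \<in> ws l \<Longrightarrow> l \<le> N \<Longrightarrow> up m l N w \<in> ws N"
  using ws_wdg[of w l "basis (run (int l - m) (int N - m))" "N - l"]
  by (simp add: tensor_power_intros)

lemma up_self [simp]: "w \<in> ws l \<Longrightarrow> up m l l w = w"
  by (simp add: wedge_space_iff)

lemma up_up: "l \<le> N \<Longrightarrow> N \<le> M \<Longrightarrow> up m N M (up m l N w) = up m l M w"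
  using run_append[of "int l - m" "int N - m" "int M - m"] by (simp add: wdg_basis_append)

lemma Psi_eq: "w \<in> tensor_power N \<Longrightarrow> Psi n v N k w = w \<odot> basis [k]"
  using AS_antisym[OF tens_power[of w N "basis [k]" 1]]
  by (simp add: Psi_def wdg_def tens_def tensor_power_intros)

lemma Phi_eq: "w \<in> tensor_power N \<Longrightarrow> Phi n v N k w = basis [k] \<odot> w"
  using AS_antisym[OF tens_power[of "basis [k]" 1 w N]]
  by (simp add: Phi_def wdg_def tens_def tensor_power_intros)

lemma transition_eq:
  assumes "w \<in> ws N" "N \<le> M"
  shows "transition n v m M N w = up m N M w"
  using assms(2)
proof (induction M rule: dec_induct)
  case base
  then show ?case using assms(1) by (simp add: transition_def wedge_space_iff)
next
  case (step M)
  have "up m N M w \<in> tensor_power M" using up_ws[OF assms(1) step.hyps(1)] by (simp add: wedge_space_iff)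
  moreover have "run (int N - m) (int (Suc M) - m) = run (int N - m) (int M - m) @ [int M - m]"
    using run_snoc[of "int N - m" "int M - m"] step.hyps by (simp add: algebra_simps)
  ultimately show ?case
    using step by (simp add: transition_def Psi_eq wdg_basis_append)
qed

lemma limit_rel_iff:
  "((N, w), (M, u)) \<in> limit_rel n v m \<longleftrightarrow>
    w \<in> ws N \<and> u \<in> ws M \<and> (\<exists>R\<ge>max N M. up m N R w = up m M R u)"
  by (auto simp: limit_rel_def transition_eq)

lemma up_eq_mono: "up m N R w = up m M R u \<Longrightarrow> max N M \<le> R \<Longrightarrow> R \<le> S \<Longrightarrow> up m N S w = up m M S u"
  by (metis up_up max.bounded_iff)

lemma equiv_limit: "equiv (SIGMA N:UNIV. ws N) (limit_rel n v m)"
proof (rule equivI)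
  show "limit_rel n v m \<subseteq> (SIGMA N:UNIV. ws N) \<times> (SIGMA N:UNIV. ws N)" by (auto simp: limit_rel_def)
  show "refl_on (SIGMA N:UNIV. ws N) (limit_rel n v m)" by (auto simp: refl_on_def limit_rel_iff)
  show "sym (limit_rel n v m)" by (auto simp: sym_def limit_rel_iff max.commute)
  show "trans (limit_rel n v m)"
  proof (rule transI, clarify)
    fix N w M u L x
    assume "((N, w), (M, u)) \<in> limit_rel n v m" "((M, u), (L, x)) \<in> limit_rel n v m"
    then obtain R S where R: "max N M \<le> R" "up m N R w = up m M R u"
      and S: "max M L \<le> S" "up m M S u = up m L S x" and w: "w \<in> ws N" "x \<in> ws L"
      unfolding limit_rel_iff by blast
    have "up m N (max R S) w = up m M (max R S) u" using R by (intro up_eq_mono[OF R(2)]) auto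
    also have "\<dots> = up m L (max R S) x" using S by (intro up_eq_mono[OF S(2)]) auto
    finally show "((N, w), (L, x)) \<in> limit_rel n v m"
      unfolding limit_rel_iff using w R(1) S(1) by (auto intro!: exI[of _ "max R S"])
  qed
qed

lemma canon_mem: "(M, u) \<in> canon n v m N w \<longleftrightarrow> w \<in> ws N \<and> u \<in> ws M \<and> (\<exists>R\<ge>max N M. up m N R w = up m M R u)"
  by (simp add: canon_def limit_rel_iff)

lemma canon_eqI:
  assumes "w \<in> ws N" "u \<in> ws M" "N \<le> R" "M \<le> R" "up m N R w = up m M R u"
  shows "canon n v m N w = canon n v m M u"
  unfolding canon_def
  by (rule equiv_class_eq[OF equiv_limit]) (use assms in \<open>auto simp: limit_rel_iff\<close>)

lemma canon_up: "w \<in> ws N \<Longrightarrow> N \<le> M \<Longrightarrow> canon n v m M (up m N M w) = canon n v m N w"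
  by (rule canon_eqI[of _ _ _ _ M]) (auto intro: up_ws)

lemma semi_spaceE:
  assumes "X \<in> semi_space n v m"
  obtains l w where "w \<in> ws l" "X = canon n v m l w"
  using assms by (auto simp: semi_space_def canon_def elim!: quotientE)

text \<open>Two representatives agree from some level on, so one of them determines the eventual
  value for all; uniqueness holds because a constant statement that is eventually true is
  true.\<close>

lemma induced_eval:
  assumes w: "w \<in> ws l"
    and ev: "\<And>N. N \<ge> N0 \<Longrightarrow> N \<ge> l \<Longrightarrow> canon n v (m + d) (nat (int N + d)) (A m N (up m l N w)) = Z"
  shows "induced n v d A m (canon n v m l w) = Z"
proof -
  define P where "P Z \<longleftrightarrow> (\<forall>(l', w')\<in>canon n v m l w. \<forall>\<^sub>F N in sequentially.
    Z = canon n v (m + d) (nat (int N + d)) (A m N (transition n v m N l' w')))" for Z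
  have "P Z" unfolding P_def
  proof (intro ballI, clarify)
    fix l' w' assume "(l', w') \<in> canon n v m l w"
    then obtain R where R: "max l l' \<le> R" "up m l R w = up m l' R w'" and w': "w' \<in> ws l'"
      by (auto simp: canon_mem)
    show "\<forall>\<^sub>F N in sequentially. Z = canon n v (m + d) (nat (int N + d)) (A m N (transition n v m N l' w'))"
      using eventually_ge_at_top[of "max N0 R"]
    proof eventually_elim
      case (elim N)
      then have "up m l N w = up m l' N w'" using R by (intro up_eq_mono[OF R(2)]) auto
      then show ?case using ev[of N] elim R(1) w' by (simp add: transition_eq)
    qed
  qed
  moreover have "Z' = Z" if "P Z'" for Z'
  proof -
    have "(l, w) \<in> canon n v m l w" using w by (auto simp: canon_mem)
    with that have "\<forall>\<^sub>F N in sequentially. Z' = canon n v (m + d) (nat (int N + d)) (A m N (transition n v m N l w))"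
      by (auto simp: P_def)
    then have "\<forall>\<^sub>F N in sequentially. Z' = Z"
      using eventually_ge_at_top[of "max N0 l"]
      by eventually_elim (use ev w in \<open>simp add: transition_eq\<close>)
    then show ?thesis by (simp add: eventually_const)
  qed
  ultimately show ?thesis
    unfolding induced_def P_def by (rule the_equality)
qed

text \<open>\<open>semi_scale\<close> and \<open>semi_diff\<close> are unions over representatives;
  all of them contribute the same class, so the union is that class.\<close>

lemma UN_constant_pairs:
  assumes "p \<in> X" "\<And>a b. (a, b) \<in> X \<Longrightarrow> f a b = C"
  shows "(\<Union>(a, b)\<in>X. f a b) = C"
proof -
  have "(\<Union>(a, b)\<in>X. f a b) = (\<Union>x\<in>X. C)"
    by (rule SUP_cong) (auto simp: assms(2))
  also have "\<dots> = C" using assms(1) by (rule UN_constant_eq) simp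
  finally show ?thesis .
qed

lemma semi_scale_canon:
  assumes w: "w \<in> ws N"
  shows "semi_scale n v m c (canon n v m N w) = canon n v m N (smul c w)"
proof -
  have "canon n v m M (smul c u) = canon n v m N (smul c w)" if "(M, u) \<in> canon n v m N w" for M u
  proof -
    from that obtain R where R: "max N M \<le> R" "up m N R w = up m M R u" "u \<in> ws M"
      by (auto simp: canon_mem)
    then show ?thesis using w by (intro canon_eqI[of _ _ _ _ R]) (auto simp: ws_smul wdg_simps)
  qed
  moreover have "(N, w) \<in> canon n v m N w" using w by (auto simp: canon_mem)
  ultimately show ?thesis unfolding semi_scale_def by (intro UN_constant_pairs)
qed

lemma semi_diff_canon:
  assumes w: "w \<in> ws N" and u: "u \<in> ws N"
  shows "semi_diff n v m (canon n v m N w) (canon n v m N u) = canon n v m N (w - u)"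
proof -
  have "canon n v m (max M L) (transition n v m (max M L) M w' - transition n v m (max M L) L u') = canon n v m N (w - u)"
    if "(M, w') \<in> canon n v m N w" "(L, u') \<in> canon n v m N u" for M L w' u'
  proof -
    from that obtain R S where R: "max N M \<le> R" "up m N R w = up m M R w'" "w' \<in> ws M"
      and S: "max N L \<le> S" "up m N S u = up m L S u'" "u' \<in> ws L"
      by (auto simp: canon_mem)
    define Q where "Q = max R S"
    have wu: "up m N Q w = up m M Q w'" "up m N Q u = up m L Q u'"
      using up_eq_mono[OF R(2) R(1), of Q] up_eq_mono[OF S(2) S(1), of Q] by (simp_all add: Q_def)
    have "up m (max M L) Q (up m M (max M L) w' - up m L (max M L) u') = up m N Q (w - u)"
    proof -
      have le: "M \<le> max M L" "L \<le> max M L" "max M L \<le> Q" using R(1) S(1) by (auto simp: Q_def)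
      show ?thesis unfolding wdg_simps wu up_up[OF le(1,3)] up_up[OF le(2,3)] ..
    qed
    moreover have le: "M \<le> max M L" "L \<le> max M L" "max M L \<le> Q" "N \<le> Q" using R(1) S(1) by (auto simp: Q_def)
    ultimately show ?thesis
      unfolding transition_eq[OF R(3) le(1)] transition_eq[OF S(3) le(2)]
      by (intro canon_eqI[of _ _ _ _ Q] ws_diff up_ws R(3) S(3) w u)
  qed
  moreover have "(N, w) \<in> canon n v m N w" "(N, u) \<in> canon n v m N u" using w u by (auto simp: canon_mem)
  ultimately show ?thesis unfolding semi_diff_def by (intro UN_constant_pairs)
qed

subsection \<open>The bosonic operators\<close>

text \<open>The bound l + nj \<le> N ensures that a tail vector beyond level N is lowered onto a
  tail vector and not into w.\<close>

lemma psum_lower_stable: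
  assumes w: "w \<in> ws l" and j: "j > 0" and N: "l + n * j \<le> N" "N \<le> M"
  shows "psum (- int j) (up m l M w) = up m N M (psum (- int j) (up m l N w))"
proof -
  let ?r = "run (int N - m) (int M - m)"
  have "up m l N w \<odot> psum (- int j) (basis ?r) = 0"
  proof -
    obtain d where d: "d = int n * int j" "d > 0" using n_pos j by simp
    have lN: "int l + d \<le> int N" using N(1) unfolding d(1) by (metis of_nat_add of_nat_le_iff of_nat_mult)
    have "up m l N w \<odot> basis (run (int N - m) y @ (y + int n * - int j) # run (y + 1) (int M - m)) = 0"
      if y: "y \<in> {int N - m..<int M - m}" for y
    proof -
      have "w \<odot> basis ([] @ (run (int l - m) y @ [y - d]) @ run (y + 1) (int M - m)) = 0"
        using y lN d by (intro wdg_kill kill_after) auto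
      moreover have "run (int l - m) y = run (int l - m) (int N - m) @ run (int N - m) y"
        using y lN d by (intro run_append[symmetric]) auto
      moreover have "y + int n * - int j = y - d" by (simp add: d)
      ultimately show ?thesis by (simp add: wdg_basis_append)
    qed
    moreover have "int N - m \<le> int M - m" using N by simp
    ultimately show ?thesis by (simp add: psum_run wdg_simps)
  qed
  then have "psum (- int j) (up m N M (up m l N w)) = up m N M (psum (- int j) (up m l N w))"
    unfolding psum_wdg by simp
  then show ?thesis using N by (simp add: up_up)
qed

text \<open>For j > 0 the results at levels N and M agree only after nj further tail vectors, which
  kill the power sum of the vectors in between; equality of classes asks for no more.\<close>

lemma boson_canon:
  assumes w: "w \<in> ws l" and j: "j \<noteq> 0" and N0: "j < 0 \<Longrightarrow> l + n * nat (- j) \<le> N" and l: "l \<le> N"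
  shows "boson n v j m (canon n v m l w) = canon n v m N (psum j (up m l N w))"
proof -
  have wN: "up m l N w \<in> ws N" using w l by (rule up_ws)
  have st: "canon n v m M (psum j (up m l M w)) = canon n v m N (psum j (up m l N w))" if M: "N \<le> M" for M
  proof (cases "j < 0")
    case True
    then have "psum j (up m l M w) = up m N M (psum j (up m l N w))"
      using psum_lower_stable[OF w _ N0[OF True] M] True by simp
    then show ?thesis using M by (simp add: canon_up ws_psum wN)
  next
    case False
    define i where "i = nat j"
    have i: "i > 0" "j = int i" using False j by (auto simp: i_def)
    define R where "R = M + n * i"
    have R: "int R - m = int M - m + int n * int i" by (simp add: R_def)
    have MR: "M \<le> R" "N \<le> R" using M by (simp_all add: R_def)
    obtain z where z: "z = up m l N w" by simp
    have "up m M R (z \<odot> psum j (basis (run (int N - m) (int M - m)))) = 0"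
      using psum_run_tail[of "int N - m" "int M - m" "int i" _ "[]"] M i unfolding R i(2) by simp
    then have "up m M R (psum j (up m N M z)) = up m N R (psum j z)"
      unfolding psum_wdg wdg_simps up_up[OF M MR(1)] by (simp only: add_0_right)
    then have "up m M R (psum j (up m l M w)) = up m N R (psum j (up m l N w))"
      unfolding z using l M by (simp add: up_up)
    then show ?thesis
      using M MR l w by (intro canon_eqI[of _ _ _ _ R]) (auto intro!: ws_psum up_ws)
  qed
  have ps: "power_sum n M j (up m l M w) = psum j (up m l M w)" if M: "N \<le> M" for M
  proof -
    have "up m l M w \<in> tensor_power M" using up_ws[OF w, of M m] M l by (simp add: wedge_space_iff)
    then show ?thesis by (rule psum_eq_power_sum[symmetric])
  qed
  show ?thesis
    unfolding boson_def
  proof (rule induced_eval[where A = "\<lambda>m N. power_sum n N j" and d = 0 and m = m and ?N0.0 = N and l = l and w = w])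
    show "w \<in> ws l" by (rule w)
    fix M assume M: "N \<le> M"
    show "canon n v (m + 0) (nat (int M + 0)) (power_sum n M j (up m l M w)) = canon n v m N (psum j (up m l N w))"
      using st[OF M] ps[OF M] by (simp only: add_0_right nat_int)
  qed
qed

end

subsection \<open>Commutators with the bosonic operators\<close>

text \<open>\<open>A'\<close> is the given operator, \<open>A\<close> a form of it that is linear on
  all tensors and agrees on wedges. \<alpha> is the coefficient of the commutator at a finite level,
  \<gamma> the one of the boundary term; the constants in the limit are \<alpha> (- j) for lowering
  and \<alpha> j + \<gamma> j for raising.\<close>

locale charged_family = wedge_setup +
  fixes A A' :: "int \<Rightarrow> int \<Rightarrow> nat \<Rightarrow> tensor \<Rightarrow> tensor" and d :: int
    and \<alpha> :: "int \<Rightarrow> complex" and \<gamma> :: "nat \<Rightarrow> complex"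
  assumes d: "d \<ge> - 1"
    and linop_A: "linop (A k m N)"
    and A'_eq: "w \<in> wedge_space n v N \<Longrightarrow> A' k m N w = A k m N w"
    and A_ws: "w \<in> wedge_space n v N \<Longrightarrow> N \<ge> 1 \<Longrightarrow> A k m N w \<in> wedge_space n v (nat (int N + d))"
    and A_stable: "w \<in> wedge_space n v l \<Longrightarrow> \<exists>N0\<ge>l. \<forall>N\<ge>N0.
      A k m (Suc N) (w \<odot> basis (run (int l - m) (int N - m + 1))) = A k m N (w \<odot> basis (run (int l - m) (int N - m))) \<odot> basis [int N - m]"
    and A_psum: "A k m N (psum i w) = psum i (A k m N w) - smul (\<alpha> i) (A (k + int n * i) m N w)"
    and A_correction: "w \<in> wedge_space n v l \<Longrightarrow> j > 0 \<Longrightarrow> \<exists>N0\<ge>l. \<forall>N\<ge>N0.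
      A k m (N + n * j) (w \<odot> basis (run (int l - m) (int N - m))
        \<odot> psum (int j) (basis (run (int N - m) (int N - m + int (n * j)))))
        \<odot> basis (run (int N - m + int (n * j)) (int N - m + 2 * int (n * j)))
      = smul (\<gamma> j) (A (k + int (n * j)) m (N + n * j) (w \<odot> basis (run (int l - m) (int N - m + int (n * j))))
        \<odot> basis (run (int N - m + int (n * j)) (int N - m + 2 * int (n * j))))"
begin

lemmas A_simps = linop_simps[OF linop_A]

definition hat :: "int \<Rightarrow> int \<Rightarrow> semi_wedge \<Rightarrow> semi_wedge" where
  "hat k = induced n v d (A' k)"

lemma level: "N \<ge> 1 \<Longrightarrow> int (nat (int N + d)) = int N + d"
  using d by simp

lemma A_stable_up:
  assumes w: "w \<in> ws l"
  shows "\<exists>N0\<ge>max l 1. \<forall>N\<ge>N0. \<forall>M\<ge>N.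
    A k m M (up m l M w) = up (m + d) (nat (int N + d)) (nat (int M + d)) (A k m N (up m l N w))"
proof -
  obtain N1 where N1: "N1 \<ge> l" "\<And>N. N \<ge> N1 \<Longrightarrow>
      A k m (Suc N) (w \<odot> basis (run (int l - m) (int N - m + 1))) = A k m N (w \<odot> basis (run (int l - m) (int N - m))) \<odot> basis [int N - m]"
    using A_stable[OF w] by blast
  have st: "A k m M (up m l M w) = A k m N (up m l N w) \<odot> basis (run (int N - m) (int M - m))"
    if N: "N \<ge> max N1 1" and "N \<le> M" for N M
    using that(2)
  proof (induction M rule: dec_induct)
    case base
    have "A k m N (up m l N w) \<in> ws (nat (int N + d))" using N N1(1) w by (intro A_ws up_ws) auto
    then show ?case unfolding wedge_space_iff by simp
  next
    case (step M)
    have M: "int (Suc M) - m = int M - m + 1" by simp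
    have r: "run (int N - m) (int M - m + 1) = run (int N - m) (int M - m) @ [int M - m]"
      using step.hyps by (intro run_snoc) simp
    have "M \<ge> N1" using step.hyps N by simp
    from N1(2)[OF this] show ?case
      unfolding M r step.IH wdg_basis_append .
  qed
  show ?thesis
  proof (intro exI[of _ "max N1 1"] conjI allI impI)
    show "max l 1 \<le> max N1 1" using N1(1) by simp
    fix N M assume N: "max N1 1 \<le> N" and NM: "N \<le> M"
    have "int (nat (int N + d)) - (m + d) = int N - m" "int (nat (int M + d)) - (m + d) = int M - m"
      using level[of N] level[of M] N NM by linarith+
    then show "A k m M (up m l M w) = up (m + d) (nat (int N + d)) (nat (int M + d)) (A k m N (up m l N w))"
      using st[OF N NM] by (simp only:)
  qed
qed

lemma hat_canon:
  assumes w: "w \<in> ws l"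
  shows "\<exists>N0\<ge>max l 1. \<forall>N\<ge>N0. hat k m (canon n v m l w) = canon n v (m + d) (nat (int N + d)) (A k m N (up m l N w))"
proof -
  obtain N0 where N0: "N0 \<ge> max l 1" and st: "\<And>N M. N0 \<le> N \<Longrightarrow> N \<le> M \<Longrightarrow>
      A k m M (up m l M w) = up (m + d) (nat (int N + d)) (nat (int M + d)) (A k m N (up m l N w))"
    using A_stable_up[OF w] by blast
  have "hat k m (canon n v m l w) = canon n v (m + d) (nat (int N + d)) (A k m N (up m l N w))" if N: "N0 \<le> N" for N
    unfolding hat_def
  proof (rule induced_eval[where A = "A' k" and d = d and m = m and ?N0.0 = N and l = l and w = w])
    show "w \<in> ws l" by (rule w)
    fix M assume M: "N \<le> M" "l \<le> M"
    have "A' k m M (up m l M w) = A k m M (up m l M w)" using w M by (intro A'_eq up_ws)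
    also have "\<dots> = up (m + d) (nat (int N + d)) (nat (int M + d)) (A k m N (up m l N w))"
      using N M(1) by (rule st)
    finally have eq: "A' k m M (up m l M w) = up (m + d) (nat (int N + d)) (nat (int M + d)) (A k m N (up m l N w))" .
    have "A k m N (up m l N w) \<in> ws (nat (int N + d))" using N N0 w by (intro A_ws up_ws) auto
    moreover have "nat (int N + d) \<le> nat (int M + d)" using M by simp
    ultimately show "canon n v (m + d) (nat (int M + d)) (A' k m M (up m l M w))
        = canon n v (m + d) (nat (int N + d)) (A k m N (up m l N w))"
      unfolding eq by (rule canon_up)
  qed
  then show ?thesis using N0 by blast
qed

lemma boson_hat:
  assumes w: "w \<in> ws l" and j: "j \<noteq> 0"
  shows "\<exists>N0\<ge>max l 1. \<forall>N\<ge>N0. boson n v j (m + d) (hat k m (canon n v m l w))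
    = canon n v (m + d) (nat (int N + d)) (psum j (A k m N (up m l N w)))"
proof -
  obtain N1 where N1: "N1 \<ge> max l 1"
    and h: "\<And>N. N1 \<le> N \<Longrightarrow> hat k m (canon n v m l w) = canon n v (m + d) (nat (int N + d)) (A k m N (up m l N w))"
    using hat_canon[OF w] by blast
  obtain N2 where st: "\<And>N M. N2 \<le> N \<Longrightarrow> N \<le> M \<Longrightarrow>
      A k m M (up m l M w) = up (m + d) (nat (int N + d)) (nat (int M + d)) (A k m N (up m l N w))"
    using A_stable_up[OF w] by blast
  define N where "N = max N1 N2"
  have N: "N1 \<le> N" "N2 \<le> N" "N \<ge> 1" "l \<le> N" using N1 by (auto simp: N_def)
  have u: "A k m N (up m l N w) \<in> ws (nat (int N + d))" using N w by (intro A_ws up_ws)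
  have "boson n v j (m + d) (hat k m (canon n v m l w))
    = canon n v (m + d) (nat (int M + d)) (psum j (A k m M (up m l M w)))" if M: "N + n * nat (- j) \<le> M" for M
  proof -
    have NM: "N \<le> M" using M by simp
    have "boson n v j (m + d) (canon n v (m + d) (nat (int N + d)) (A k m N (up m l N w)))
      = canon n v (m + d) (nat (int M + d)) (psum j (up (m + d) (nat (int N + d)) (nat (int M + d)) (A k m N (up m l N w))))"
      using u j
    proof (rule boson_canon)
      show "nat (int N + d) + n * nat (- j) \<le> nat (int M + d)"
      proof -
        obtain i where i: "i = n * nat (- j)" by simp
        show ?thesis using M N(3) d unfolding i[symmetric] by linarith
      qed
    qed (use NM in simp)
    then show ?thesis unfolding h[OF N(1)] st[OF N(2) NM] .
  qed
  moreover have "max l 1 \<le> N + n * nat (- j)" using N by simp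
  ultimately show ?thesis by blast
qed

theorem commutator_lower:
  assumes w: "w \<in> ws l" and j: "j > 0"
  shows "commutator n v d (boson n v (- int j)) (hat k) m (canon n v m l w)
    = semi_scale n v (m + d) (\<alpha> (- int j)) (hat (k - int (n * j)) m (canon n v m l w))"
proof -
  define L where "L = l + n * j"
  define y where "y = psum (- int j) (up m l L w)"
  have y: "y \<in> ws L" unfolding y_def using w by (intro ws_psum up_ws) (auto simp: L_def)
  have By: "boson n v (- int j) m (canon n v m l w) = canon n v m L y"
    unfolding y_def using w j by (intro boson_canon) (auto simp: L_def)
  have jn: "- int j \<noteq> 0" using j by simp
  obtain N1 where N1: "N1 \<ge> max l 1" and BA: "\<And>N. N \<ge> N1 \<Longrightarrow> boson n v (- int j) (m + d) (hat k m (canon n v m l w))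
    = canon n v (m + d) (nat (int N + d)) (psum (- int j) (A k m N (up m l N w)))"
    using boson_hat[OF w jn] by blast
  obtain N2 where N2: "N2 \<ge> max L 1" and AB: "\<And>N. N \<ge> N2 \<Longrightarrow>
      hat k m (canon n v m L y) = canon n v (m + d) (nat (int N + d)) (A k m N (up m L N y))"
    using hat_canon[OF y] by blast
  obtain N3 where A: "\<And>N. N \<ge> N3 \<Longrightarrow>
      hat (k - int (n * j)) m (canon n v m l w) = canon n v (m + d) (nat (int N + d)) (A (k - int (n * j)) m N (up m l N w))"
    using hat_canon[OF w] by blast
  define N where "N = max N1 (max N2 N3)"
  have N: "N1 \<le> N" "N2 \<le> N" "N3 \<le> N" "1 \<le> N" "L \<le> N" "l \<le> N" using N1 N2 by (auto simp: N_def)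
  let ?x = "up m l N w"
  have x: "?x \<in> ws N" using w N by (intro up_ws)
  have "up m L N y = psum (- int j) ?x"
    unfolding y_def using psum_lower_stable[OF w j, of L N] N by (simp add: L_def)
  then have "psum (- int j) (A k m N ?x) - A k m N (up m L N y) = smul (\<alpha> (- int j)) (A (k - int (n * j)) m N ?x)"
    using A_psum[where k = k and m = m and N = N and i = "- int j" and w = ?x] by simp
  moreover have "A k' m N ?x \<in> ws (nat (int N + d))" for k' using x N by (intro A_ws)
  moreover have "A k m N (up m L N y) \<in> ws (nat (int N + d))" using y N by (intro A_ws up_ws)
  ultimately show ?thesis
    unfolding commutator_def By BA[OF N(1)] AB[OF N(2)] A[OF N(3)]
    by (simp add: semi_diff_canon semi_scale_canon ws_psum)
qed

text \<open>At level N the power sum of the prolonged w is the prolonged power sum of w plus a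
  boundary term g from the last nj tail vectors. A of g becomes a multiple of the expected vector
  after nj more tail vectors, so the classes are compared at the level higher by nj.\<close>

theorem commutator_raise:
  assumes w: "w \<in> ws l" and j: "j > 0"
  shows "commutator n v d (boson n v (int j)) (hat k) m (canon n v m l w)
    = semi_scale n v (m + d) (\<alpha> (int j) + \<gamma> j) (hat (k + int (n * j)) m (canon n v m l w))"
proof -
  obtain J where J: "J = n * j" by simp
  have iJ: "int n * int j = int J" by (simp add: J)
  define y where "y = psum (int j) w"
  have y: "y \<in> ws l" unfolding y_def using w by (rule ws_psum)
  have By: "boson n v (int j) m (canon n v m l w) = canon n v m l y"
    using boson_canon[of w l "int j" l m] w j by (simp add: y_def wedge_space_iff)
  have jn: "int j \<noteq> 0" using j by simp
  obtain N1 where N1: "N1 \<ge> max l 1" and BA: "\<And>N. N \<ge> N1 \<Longrightarrow> boson n v (int j) (m + d) (hat k m (canon n v m l w))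
    = canon n v (m + d) (nat (int N + d)) (psum (int j) (A k m N (up m l N w)))"
    using boson_hat[OF w jn] by blast
  obtain N2 where AB: "\<And>N. N \<ge> N2 \<Longrightarrow>
      hat k m (canon n v m l y) = canon n v (m + d) (nat (int N + d)) (A k m N (up m l N y))"
    using hat_canon[OF y] by blast
  obtain N3 where A: "\<And>N. N \<ge> N3 \<Longrightarrow>
      hat (k + int J) m (canon n v m l w) = canon n v (m + d) (nat (int N + d)) (A (k + int J) m N (up m l N w))"
    using hat_canon[OF w] by blast
  obtain N4 where corr: "\<And>N. N \<ge> N4 \<Longrightarrow>
      A k m (N + J) (up m l N w \<odot> psum (int j) (basis (run (int N - m) (int N - m + int J))))
        \<odot> basis (run (int N - m + int J) (int N - m + 2 * int J))
      = smul (\<gamma> j) (A (k + int J) m (N + J) (w \<odot> basis (run (int l - m) (int N - m + int J)))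
        \<odot> basis (run (int N - m + int J) (int N - m + 2 * int J)))"
    using A_correction[OF w j, of k m] unfolding J by blast
  define Q where "Q = max N1 (max N2 (max N3 N4))"
  \<comment> \<open>The boundary vectors run from level Q to level N; they also kill the power sum
    of the tail before Q.\<close>
  define N where "N = Q + J"
  have N: "N1 \<le> N" "N2 \<le> N" "N3 \<le> N" "N4 \<le> Q" "1 \<le> N" "l \<le> N" "l \<le> Q" "Q \<le> N"
    using N1 by (auto simp: N_def Q_def)
  have QN: "int N - m = int Q - m + int J" by (simp add: N_def)
  let ?x = "up m l N w" and ?N = "nat (int N + d)" and ?R = "nat (int N + int J + d)"
  define g where "g = up m l Q w \<odot> psum (int j) (basis (run (int Q - m) (int N - m)))"
  have x: "?x \<in> ws N" using w N by (intro up_ws)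
  have Ax: "A k' m N ?x \<in> ws ?N" for k' using x N by (intro A_ws)
  have Ay: "A k m N (up m l N y) \<in> ws ?N" using y N by (intro A_ws up_ws)
  have psum_x: "psum (int j) ?x = up m l N y + g"
  proof -
    have "w \<odot> psum (int j) (basis (run (int l - m) (int Q - m))) \<odot> basis (run (int Q - m) (int Q - m + int n * int j) @ []) = 0"
      using N j by (intro psum_run_tail) simp_all
    then have kill: "w \<odot> psum (int j) (basis (run (int l - m) (int Q - m))) \<odot> basis (run (int Q - m) (int N - m)) = 0"
      unfolding iJ QN by simp
    have "psum (int j) (up m Q N (up m l Q w)) = up m Q N (up m l Q y) + g"
      unfolding psum_wdg wdg_simps kill g_def y_def by (simp only: add_0_right)
    then show ?thesis unfolding up_up[OF N(7,8)] .
  qed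
  define z where "z = psum (int j) (A k m N ?x) - A k m N (up m l N y)"
  have z: "z \<in> ws ?N" unfolding z_def using Ax Ay by (intro ws_diff ws_psum)
  have "A k m N (up m l N y) = A k m N (psum (int j) ?x) - A k m N g"
    unfolding psum_x A_simps by simp
  then have z_eq: "z = smul (\<alpha> (int j)) (A (k + int J) m N ?x) + A k m N g"
    unfolding z_def A_psum iJ by simp
  define tl where "tl = run (int N - m) (int N - m + int J)"
  have g: "A k m N g \<odot> basis tl = smul (\<gamma> j) (A (k + int J) m N ?x \<odot> basis tl)"
  proof -
    have e: "int Q - m + 2 * int J = int Q - m + int J + int J" by simp
    show ?thesis using corr[OF N(4)] unfolding g_def tl_def N_def[symmetric] e QN[symmetric] .
  qed
  have R: "int ?R = int N + int J + d" using N(5) d by simp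
  have tl: "up (m + d) ?N ?R u = u \<odot> basis tl" for u
  proof -
    have "int ?N - (m + d) = int N - m" "int ?R - (m + d) = int N - m + int J"
      unfolding R level[OF N(5)] by simp_all
    then show ?thesis unfolding tl_def by (simp only:)
  qed
  have "canon n v (m + d) ?N z = canon n v (m + d) ?N (smul (\<alpha> (int j) + \<gamma> j) (A (k + int J) m N ?x))"
  proof (rule canon_eqI[OF z ws_smul[OF Ax], where R = ?R])
    show "?N \<le> ?R" "?N \<le> ?R" by simp_all
    show "up (m + d) ?N ?R z = up (m + d) ?N ?R (smul (\<alpha> (int j) + \<gamma> j) (A (k + int J) m N ?x))"
      unfolding tl z_eq wdg_simps g tm.scale_left_distrib ..
  qed
  then show ?thesis
    unfolding commutator_def By BA[OF N(1)] AB[OF N(2)] J[symmetric] A[OF N(3)] semi_diff_canon[OF ws_psum[OF Ax] Ay]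
      z_def[symmetric] semi_scale_canon[OF Ax] .
qed

end

lemma (in charged_family) semi_scale_one_hat:
  assumes "w \<in> ws l"
  shows "semi_scale n v (m + d) 1 (hat k m (canon n v m l w)) = hat k m (canon n v m l w)"
proof -
  obtain N where N: "N \<ge> max l 1"
    and h: "hat k m (canon n v m l w) = canon n v (m + d) (nat (int N + d)) (A k m N (up m l N w))"
    using hat_canon[OF assms] by blast
  have "A k m N (up m l N w) \<in> ws (nat (int N + d))" using N assms by (intro A_ws up_ws) auto
  then show ?thesis unfolding h by (simp add: semi_scale_canon)
qed

subsection \<open>The four families\<close>

context wedge_setup
begin

lemma to_level:
  assumes "\<exists>L\<ge>int l - m. \<forall>x\<ge>L. P x"
  shows "\<exists>N0\<ge>l. \<forall>N\<ge>N0. P (int N - m)"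
proof -
  from assms obtain L where L: "L \<ge> int l - m" "\<And>x. x \<ge> L \<Longrightarrow> P x" by blast
  show ?thesis
  proof (intro exI[of _ "nat (L + m)"] conjI allI impI)
    show "l \<le> nat (L + m)" using L(1) by linarith
    show "P (int N - m)" if "nat (L + m) \<le> N" for N using that by (intro L(2)) linarith
  qed
qed

lemma low_exists: "\<exists>a\<le>M. low a w"
proof -
  let ?S = "insert M (\<Union>(set ` Poly_Mapping.keys w))"
  have "low (Min ?S) w" by (auto simp: supp_def intro!: Min_le)
  moreover have "Min ?S \<le> M" by (intro Min_le) auto
  ultimately show ?thesis by blast
qed

text \<open>The floor in the normalisations jumps exactly at the multiples of n, where
  \<open>cc\<close> and \<open>cl\<close> take their exceptional values.\<close>

lemma div_pred: "(x - 1) div int n = (if int n dvd x then x div int n - 1 else x div int n)"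
proof -
  define a q r where "a = int n" and "q = x div a" and "r = x mod a"
  have a: "a > 0" using n_pos by (simp add: a_def)
  have x: "x = a * q + r" by (simp add: q_def r_def)
  have r: "0 \<le> r" "r < a" using a by (auto simp: r_def)
  have dvd: "a dvd x \<longleftrightarrow> r = 0" by (simp add: r_def dvd_eq_mod_eq_0)
  have "(x - 1) div a = (if r = 0 then q - 1 else q)"
  proof (cases "r = 0")
    case True
    then have "x - 1 = a * (q - 1) + (a - 1)" using x by (simp add: right_diff_distrib)
    then have "(x - 1) div a = q - 1" by (rule int_div_pos_eq) (use a in auto)
    with True show ?thesis by simp
  next
    case False
    have "x - 1 = a * q + (r - 1)" using x by simp
    then have "(x - 1) div a = q" by (rule int_div_pos_eq) (use r False in auto)
    with False show ?thesis by simp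
  qed
  then show ?thesis unfolding dvd[symmetric] by (simp add: a_def q_def)
qed

lemma div_shift: "(x + int n * i) div int n = x div int n + i"
  using n_pos by simp

lemma Phi_family:
  "charged_family n v (\<lambda>k m N w. basis [k] \<odot> w) (\<lambda>k m N. Phi n v N k) 1 (\<lambda>i. 1) (\<lambda>j. 0)"
proof
  show "linop (\<lambda>w. basis [k] \<odot> w)" for k by (intro linop_intros)
  show "Phi n v N k w = basis [k] \<odot> w" if "w \<in> ws N" for N k w
    using that by (simp add: Phi_eq wedge_space_iff)
  show "basis [k] \<odot> w \<in> ws (nat (int N + 1))" if "w \<in> ws N" for N k w
  proof -
    have "nat (int N + 1) = 1 + N" by simp
    then show ?thesis
      using wdg_power[of "basis [k]" 1 w N] that by (simp only: wedge_space_iff AS_wdg) (simp add: tensor_power_intros)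
  qed
  show "\<exists>N0\<ge>l. \<forall>N\<ge>N0. basis [k] \<odot> (w \<odot> basis (run (int l - m) (int N - m + 1)))
      = basis [k] \<odot> (w \<odot> basis (run (int l - m) (int N - m))) \<odot> basis [int N - m]" for l k m w
  proof (intro exI[of _ l] conjI allI impI)
    fix N assume "l \<le> N"
    then have "run (int l - m) (int N - m + 1) = run (int l - m) (int N - m) @ [int N - m]" by (intro run_snoc) simp
    then show "basis [k] \<odot> (w \<odot> basis (run (int l - m) (int N - m + 1)))
      = basis [k] \<odot> (w \<odot> basis (run (int l - m) (int N - m))) \<odot> basis [int N - m]"
      by (simp only: wdg_assoc[symmetric] wdg_basis_append)
  qed simp
  show "basis [k] \<odot> psum i w = psum i (basis [k] \<odot> w) - smul 1 (basis [k + int n * i] \<odot> w)" for k i w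
    by (simp add: psum_wdg psum_single)
  show "\<exists>N0\<ge>l. \<forall>N\<ge>N0. basis [k] \<odot> (w \<odot> basis (run (int l - m) (int N - m))
        \<odot> psum (int j) (basis (run (int N - m) (int N - m + int (n * j)))))
        \<odot> basis (run (int N - m + int (n * j)) (int N - m + 2 * int (n * j)))
      = smul 0 (basis [k + int (n * j)] \<odot> (w \<odot> basis (run (int l - m) (int N - m + int (n * j))))
        \<odot> basis (run (int N - m + int (n * j)) (int N - m + 2 * int (n * j))))"
    if j: "j > 0" for l k m w j
  proof (intro exI[of _ l] conjI allI impI)
    fix N
    obtain J where J: "J = int (n * j)" by simp
    have "u \<odot> psum (int j) (basis (run x (x + J))) \<odot> basis (run (x + J) (x + 2 * J)) = 0" for x u
    proof -
      have "x + 2 * J = x + J + int n * int j" "x \<le> x + J" by (simp_all add: J)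
      then show ?thesis using psum_run_tail[of x "x + J" "int j" u "[]"] j by (simp only: append_Nil2)
    qed
    then show "basis [k] \<odot> (w \<odot> basis (run (int l - m) (int N - m))
        \<odot> psum (int j) (basis (run (int N - m) (int N - m + int (n * j)))))
        \<odot> basis (run (int N - m + int (n * j)) (int N - m + 2 * int (n * j)))
      = smul 0 (basis [k + int (n * j)] \<odot> (w \<odot> basis (run (int l - m) (int N - m + int (n * j))))
        \<odot> basis (run (int N - m + int (n * j)) (int N - m + 2 * int (n * j))))"
      unfolding J[symmetric] by (simp only: wdg_assoc[symmetric] tm.scale_zero_left)
  qed simp
qed simp

definition \<nu> :: "int \<Rightarrow> int \<Rightarrow> nat \<Rightarrow> complex" where
  "\<nu> k m N = (- 1) ^ N * v powi ((int N - 1 - m - k) div int n - int N)"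

text \<open>The normalisation of \<open>Psi_norm\<close> is made to cancel the factor for exchanging
  e with index k and the next tail vector.\<close>

lemma \<nu>_Suc: "\<nu> k m (Suc N) * cc (int N - m - k) = \<nu> k m N"
proof -
  define x where "x = int N - m - k"
  have e: "int (Suc N) - 1 - m - k = x" "int N - 1 - m - k = x - 1" by (simp_all add: x_def)
  define q where "q = x div int n"
  have "v powi (q - int N) = v powi (q - int (Suc N)) * v"
    using power_int_add_1[of v "q - int (Suc N)"] by simp
  then show ?thesis
    unfolding \<nu>_def e div_pred x_def[symmetric] q_def[symmetric] cc_def by (simp add: algebra_simps)
qed

text \<open>Source of the powers of v in the relations for \<open>Psi_norm\<close>: shifting k by ni
  moves the floor by i.\<close>

lemma \<nu>_shift: "\<nu> k m N = v powi i * \<nu> (k + int n * i) m N"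
proof -
  define y where "y = int N - 1 - m - k"
  have "int N - 1 - m - (k + int n * i) = y + int n * (- i)" by (simp add: y_def)
  then have "(int N - 1 - m - (k + int n * i)) div int n = y div int n - i" by (simp only: div_shift)
  moreover have "v powi (y div int n - int N) = v powi i * v powi (y div int n - i - int N)"
    by (simp flip: power_int_add)
  ultimately show ?thesis by (simp add: \<nu>_def flip: y_def)
qed

lemma wdg_basis_Cons: "u \<odot> basis [k] \<odot> basis t = u \<odot> basis (k # t)"
  by (simp add: wdg_basis_append)

text \<open>The boundary constant is that of \<open>insert_correction\<close>, multiplied by v^j to
  pass from the normalisation for k to that for k + nj.\<close>

lemma Psi_family:
  "charged_family n v (\<lambda>k m N w. smul (\<nu> k m N) (w \<odot> basis [k])) (\<lambda>k m N. Psi_norm n v m N k) 1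
    (\<lambda>i. v powi i) (\<lambda>j. (\<eta> j ^ 2 - 1) * v powi int j)"
proof
  show "linop (\<lambda>w. smul (\<nu> k m N) (w \<odot> basis [k]))" for k m N by (intro linop_intros)
  show "Psi_norm n v m N k w = smul (\<nu> k m N) (w \<odot> basis [k])" if "w \<in> ws N" for N k m w
    using that by (simp add: Psi_norm_def \<nu>_def Psi_eq wedge_space_iff)
  show "smul (\<nu> k m N) (w \<odot> basis [k]) \<in> ws (nat (int N + 1))" if "w \<in> ws N" for N k m w
  proof -
    have "nat (int N + 1) = N + 1" by simp
    then show ?thesis using that by (simp only:) (intro ws_smul ws_wdg tensor_power_intros, simp_all)
  qed
  show "\<exists>N0\<ge>l. \<forall>N\<ge>N0. smul (\<nu> k m (Suc N)) (w \<odot> basis (run (int l - m) (int N - m + 1)) \<odot> basis [k])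
      = smul (\<nu> k m N) (w \<odot> basis (run (int l - m) (int N - m)) \<odot> basis [k]) \<odot> basis [int N - m]" for l k m w
  proof -
    let ?M = "int l - m"
    have "\<exists>L\<ge>?M. \<forall>x\<ge>L. ?M \<le> x \<and> k < x \<and> 2 * ?M \<le> k + x"
      by (intro exI[of _ "max ?M (max (k + 1) (2 * ?M - k))"]) auto
    then obtain N0 where N0: "N0 \<ge> l" "\<And>N. N \<ge> N0 \<Longrightarrow> ?M \<le> int N - m \<and> k < int N - m \<and> 2 * ?M \<le> k + (int N - m)"
      using to_level[of l m "\<lambda>x. ?M \<le> x \<and> k < x \<and> 2 * ?M \<le> k + x"] by blast
    show ?thesis
    proof (intro exI[of _ N0] conjI allI impI N0(1))
      fix N assume "N0 \<le> N"
      from N0(2)[OF this] have x: "?M \<le> int N - m" "k < int N - m" "2 * ?M \<le> k + (int N - m)" by auto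
      have "w \<odot> basis (run ?M (int N - m + 1)) \<odot> basis [k] = w \<odot> basis (run ?M (int N - m) @ [int N - m, k] @ [])"
        unfolding run_snoc[OF x(1)] by (simp add: wdg_basis_append)
      also have "\<dots> = smul (cc (int N - m - k)) (w \<odot> basis (run ?M (int N - m) @ [k, int N - m] @ []))"
        by (rule exchange_far[OF x(2,3)])
      also have "w \<odot> basis (run ?M (int N - m) @ [k, int N - m] @ [])
          = w \<odot> basis (run ?M (int N - m)) \<odot> basis [k] \<odot> basis [int N - m]"
        by (simp add: wdg_basis_append)
      finally show "smul (\<nu> k m (Suc N)) (w \<odot> basis (run ?M (int N - m + 1)) \<odot> basis [k])
          = smul (\<nu> k m N) (w \<odot> basis (run ?M (int N - m)) \<odot> basis [k]) \<odot> basis [int N - m]"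
        by (simp only: tm.scale_scale \<nu>_Suc wdg_simps)
    qed
  qed
  show "smul (\<nu> k m N) (psum i w \<odot> basis [k]) = psum i (smul (\<nu> k m N) (w \<odot> basis [k]))
      - smul (v powi i) (smul (\<nu> (k + int n * i) m N) (w \<odot> basis [k + int n * i]))" for k m N i w
    unfolding tm.scale_scale \<nu>_shift[symmetric] by (simp add: psum_wdg psum_single psum_simps tm.scale_right_distrib)
  show "\<exists>N0\<ge>l. \<forall>N\<ge>N0. smul (\<nu> k m (N + n * j)) (w \<odot> basis (run (int l - m) (int N - m))
        \<odot> psum (int j) (basis (run (int N - m) (int N - m + int (n * j)))) \<odot> basis [k])
        \<odot> basis (run (int N - m + int (n * j)) (int N - m + 2 * int (n * j)))
      = smul ((\<eta> j ^ 2 - 1) * v powi int j)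
        (smul (\<nu> (k + int (n * j)) m (N + n * j)) (w \<odot> basis (run (int l - m) (int N - m + int (n * j))) \<odot> basis [k + int (n * j)])
        \<odot> basis (run (int N - m + int (n * j)) (int N - m + 2 * int (n * j))))"
    if j: "j > 0" for l k m w j
  proof -
    have nu: "(\<eta> j ^ 2 - 1) * v powi int j * \<nu> (k + int (n * j)) m N = \<nu> k m N * (\<eta> j ^ 2 - 1)" for N
      using \<nu>_shift[of k m N "int j"] by simp
    from to_level[OF insert_correction[OF j refl, of "int l - m" k]]
    show ?thesis
      unfolding wdg_simps wdg_basis_Cons tm.scale_scale nu by (auto simp only: tm.scale_scale[symmetric])
  qed
qed simp

lemma Phi_star_family:
  "charged_family n v (\<lambda>k m N. Rf (- k)) (\<lambda>k m N. Phi_star_norm v N k) (- 1)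
    (\<lambda>i. - 1) (\<lambda>j. 1 - v powi (2 * int n * int j))"
proof -
  interpret R: removal n v Rf cf \<alpha>f by (rule Rf_removal)
  show ?thesis
  proof
    show "linop (Rf (- k))" for k by (rule linop_Rf')
    show "Phi_star_norm v N k w = Rf (- k) w" if "w \<in> ws N" for N k w
      using that Rf_fc[of w N "- k"] by (simp add: Phi_star_norm_def wedge_space_iff fc_def)
    show "Rf (- k) w \<in> ws (nat (int N + - 1))" if "w \<in> ws N" "N \<ge> 1" for N k w
    proof -
      from that(2) obtain L where "N = Suc L" by (cases N) auto
      then show ?thesis
        using that(1) Rf_wedge[of w "- k"] Rf_fc[of w N "- k"] fc_power[of w L "- k"] tensor_power_intros(4)
        by (simp add: wedge_space_iff)
    qed
    show "\<exists>N0\<ge>l. \<forall>N\<ge>N0. Rf (- k) (w \<odot> basis (run (int l - m) (int N - m + 1)))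
        = Rf (- k) (w \<odot> basis (run (int l - m) (int N - m))) \<odot> basis [int N - m]" if "w \<in> ws l" for l k m w
    proof -
      obtain a where a: "a \<le> int l - m" "low a w" using low_exists by blast
      from that have "w \<in> tensor_power l" "AS w = w" by (simp_all add: wedge_space_iff)
      from R.R_stable[OF this a(2,1), of "- k"] show ?thesis
        by (intro to_level) (auto simp: cf_def)
    qed
    show "Rf (- k) (psum i w) = psum i (Rf (- k) w) - smul (- 1) (Rf (- (k + int n * i)) w)" for k i w
      by (simp add: Rf_psum)
    show "\<exists>N0\<ge>l. \<forall>N\<ge>N0. Rf (- k) (w \<odot> basis (run (int l - m) (int N - m))
          \<odot> psum (int j) (basis (run (int N - m) (int N - m + int (n * j)))))
          \<odot> basis (run (int N - m + int (n * j)) (int N - m + 2 * int (n * j)))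
        = smul (1 - v powi (2 * int n * int j)) (Rf (- (k + int (n * j))) (w \<odot> basis (run (int l - m) (int N - m + int (n * j))))
          \<odot> basis (run (int N - m + int (n * j)) (int N - m + 2 * int (n * j))))"
      if "w \<in> ws l" "j > 0" for l k m w j
    proof -
      obtain a where a: "a \<le> int l - m" "low a w" using low_exists by blast
      from that have "w \<in> tensor_power l" "AS w = w" by (simp_all add: wedge_space_iff)
      from to_level[OF R.R_correction[OF this a(2,1) that(2), of "- k"]] show ?thesis
        unfolding Rf_constant minus_add_distrib diff_conv_add_uminus .
    qed
  qed simp
qed

text \<open>What is left of the factor in \<open>Psi_star_norm\<close> once \<open>Rl\<close> has
  taken the power of - v and the quantum integer.\<close>

definition \<beta> :: "int \<Rightarrow> int \<Rightarrow> nat \<Rightarrow> complex" where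
  "\<beta> k m N = - (v powi (- 1 - (int N - 1 - m + k) div int n))"

lemma \<beta>_Suc: "\<beta> k m (Suc N) * cl (- k) (int N - m) 0 = \<beta> k m N"
proof -
  define x where "x = int N - m + k"
  have e: "int (Suc N) - 1 - m + k = x" "int N - 1 - m + k = x - 1" by (simp_all add: x_def)
  have m: "(- k) mod int n = (int N - m) mod int n \<longleftrightarrow> int n dvd x"
  proof -
    have "(- k) mod int n = (int N - m) mod int n \<longleftrightarrow> int n dvd - k - (int N - m)" by (rule mod_eq_dvd_iff)
    also have "- k - (int N - m) = - x" by (simp add: x_def)
    finally show ?thesis by simp
  qed
  define q where "q = x div int n"
  have "v powi (- q) = v powi (- 1 - q) * v"
    using power_int_add_1[of v "- 1 - q"] by simp
  then show ?thesis
    unfolding \<beta>_def e div_pred cl_def m q_def[symmetric] by simp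
qed

lemma \<beta>_shift: "\<beta> k m N = v powi i * \<beta> (k + int n * i) m N"
proof -
  define y where "y = int N - 1 - m + k"
  have "int N - 1 - m + (k + int n * i) = y + int n * i" by (simp add: y_def)
  then have "(int N - 1 - m + (k + int n * i)) div int n = y div int n + i" by (simp only: div_shift)
  moreover have "v powi (- 1 - y div int n) = v powi i * v powi (- 1 - (y div int n + i))"
    by (simp flip: power_int_add)
  ultimately show ?thesis by (simp add: \<beta>_def flip: y_def)
qed

lemma Psi_star_norm_eq: "w \<in> tensor_power N \<Longrightarrow> Psi_star_norm n v m N k w = smul (\<beta> k m N) (Rl (- k) w)"
proof -
  assume w: "w \<in> tensor_power N"
  define e where "e = (int N - 1 - m + k) div int n"
  have "v powi (int N - 1 - e) = v powi (- 1 - e) * v ^ N"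
  proof -
    have "int N - 1 - e = - 1 - e + int N" by simp
    then show ?thesis using power_int_add[of v "- 1 - e" "int N"] by (simp only:) simp
  qed
  moreover have "(- 1) powi (int N - 1) = - ((- 1 :: complex) ^ N)"
    using power_int_diff[of "- 1 :: complex" "int N" 1] by simp
  ultimately have "(- 1) powi (int N - 1) * qint_minus v N * v powi (int N - 1 - e)
      = - (v powi (- 1 - e)) * ((- v) ^ N * qint_minus v N)"
    by (simp add: power_minus[of v])
  then show ?thesis by (simp add: Psi_star_norm_def Rl_lc[OF w] \<beta>_def lc_def flip: e_def)
qed

lemma Psi_star_family:
  "charged_family n v (\<lambda>k m N w. smul (\<beta> k m N) (Rl (- k) w)) (\<lambda>k m N. Psi_star_norm n v m N k) (- 1)
    (\<lambda>i. - (v powi i)) (\<lambda>j. (1 - v powi (- 2 * int j)) * v powi int j)"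
proof -
  interpret R: removal n v Rl cl \<alpha>l by (rule Rl_removal)
  show ?thesis
  proof
    show "linop (\<lambda>w. smul (\<beta> k m N) (Rl (- k) w))" for k m N by (intro linop_intros)
    show "Psi_star_norm n v m N k w = smul (\<beta> k m N) (Rl (- k) w)" if "w \<in> ws N" for N k m w
      using that by (simp add: Psi_star_norm_eq wedge_space_iff)
    show "smul (\<beta> k m N) (Rl (- k) w) \<in> ws (nat (int N + - 1))" if "w \<in> ws N" "N \<ge> 1" for N k m w
    proof -
      from that(2) obtain L where "N = Suc L" by (cases N) auto
      then have "Rl (- k) w \<in> ws (nat (int N + - 1))"
        using that(1) Rl_wedge[of w "- k"] Rl_lc[of w N "- k"] lc_power[of w L "- k"] tensor_power_intros(4)
        by (simp add: wedge_space_iff del: power_Suc)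
      then show ?thesis by (rule ws_smul)
    qed
    show "\<exists>N0\<ge>l. \<forall>N\<ge>N0. smul (\<beta> k m (Suc N)) (Rl (- k) (w \<odot> basis (run (int l - m) (int N - m + 1))))
        = smul (\<beta> k m N) (Rl (- k) (w \<odot> basis (run (int l - m) (int N - m)))) \<odot> basis [int N - m]"
      if "w \<in> ws l" for l k m w
    proof -
      obtain a where a: "a \<le> int l - m" "low a w" using low_exists by blast
      from that have "w \<in> tensor_power l" "AS w = w" by (simp_all add: wedge_space_iff)
      from R.R_stable[OF this a(2,1), of "- k"]
      have "\<exists>N0\<ge>l. \<forall>N\<ge>N0. Rl (- k) (w \<odot> basis (run (int l - m) (int N - m + 1)))
        = smul (cl (- k) (int N - m) 0) (Rl (- k) (w \<odot> basis (run (int l - m) (int N - m))) \<odot> basis [int N - m])"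
        by (intro to_level) auto
      then obtain N0 where N0: "N0 \<ge> l" "\<And>N. N \<ge> N0 \<Longrightarrow> Rl (- k) (w \<odot> basis (run (int l - m) (int N - m + 1)))
        = smul (cl (- k) (int N - m) 0) (Rl (- k) (w \<odot> basis (run (int l - m) (int N - m))) \<odot> basis [int N - m])"
        by blast
      show ?thesis
      proof (intro exI[of _ N0] conjI allI impI N0(1))
        fix N assume "N0 \<le> N"
        then show "smul (\<beta> k m (Suc N)) (Rl (- k) (w \<odot> basis (run (int l - m) (int N - m + 1))))
          = smul (\<beta> k m N) (Rl (- k) (w \<odot> basis (run (int l - m) (int N - m)))) \<odot> basis [int N - m]"
          unfolding N0(2)[OF \<open>N0 \<le> N\<close>] tm.scale_scale \<beta>_Suc wdg_simps by simp
      qed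
    qed
    show "smul (\<beta> k m N) (Rl (- k) (psum i w)) = psum i (smul (\<beta> k m N) (Rl (- k) w))
        - smul (- (v powi i)) (smul (\<beta> (k + int n * i) m N) (Rl (- (k + int n * i)) w))" for k m N i w
      using \<beta>_shift[of k m N i] by (simp add: Rl_psum psum_simps tm.scale_right_distrib)
    show "\<exists>N0\<ge>l. \<forall>N\<ge>N0. smul (\<beta> k m (N + n * j)) (Rl (- k) (w \<odot> basis (run (int l - m) (int N - m))
          \<odot> psum (int j) (basis (run (int N - m) (int N - m + int (n * j))))))
          \<odot> basis (run (int N - m + int (n * j)) (int N - m + 2 * int (n * j)))
        = smul ((1 - v powi (- 2 * int j)) * v powi int j)
          (smul (\<beta> (k + int (n * j)) m (N + n * j)) (Rl (- (k + int (n * j))) (w \<odot> basis (run (int l - m) (int N - m + int (n * j)))))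
          \<odot> basis (run (int N - m + int (n * j)) (int N - m + 2 * int (n * j))))"
      if "w \<in> ws l" "j > 0" for l k m w j
    proof -
      obtain a where a: "a \<le> int l - m" "low a w" using low_exists by blast
      from that have w: "w \<in> tensor_power l" "AS w = w" by (simp_all add: wedge_space_iff)
      have be: "(1 - v powi (- 2 * int j)) * v powi int j * \<beta> (k + int (n * j)) m N = \<beta> k m N * (1 - v powi (- 2 * int j))" for N
        using \<beta>_shift[of k m N "int j"] by simp
      from to_level[OF R.R_correction[OF w a(2,1) that(2), of "- k"]] show ?thesis
        unfolding Rl_constant minus_add_distrib diff_conv_add_uminus[symmetric] wdg_simps tm.scale_scale be
        by (auto simp only: tm.scale_scale[symmetric])
    qed
  qed simp
qed

end

theorem proposition5p19:
  fixes n :: nat and v :: complex and k j m :: int and X :: semi_wedge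
  assumes "n \<ge> 1"
    and "v \<noteq> 0" and "\<forall>r::nat. r > 0 \<longrightarrow> v ^ r \<noteq> 1"
    and "j > 0"
    and "X \<in> semi_space n v m"
  shows "commutator n v 1 (boson n v (- j)) (hat_Phi n v k) m X
           = hat_Phi n v (k - int n * j) m X \<and>
    commutator n v 1 (boson n v (- j)) (hat_Psi n v k) m X
           = semi_scale n v (m + 1) (v powi (- j)) (hat_Psi n v (k - int n * j) m X) \<and>
    commutator n v (- 1) (boson n v (- j)) (hat_Phi_star n v k) m X
           = semi_scale n v (m - 1) (- 1) (hat_Phi_star n v (k - int n * j) m X) \<and>
    commutator n v (- 1) (boson n v (- j)) (hat_Psi_star n v k) m X
           = semi_scale n v (m - 1) (- (v powi (- j))) (hat_Psi_star n v (k - int n * j) m X) \<and>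
    commutator n v 1 (boson n v j) (hat_Phi n v k) m X
           = hat_Phi n v (k + int n * j) m X \<and>
    commutator n v 1 (boson n v j) (hat_Psi n v k) m X
           = semi_scale n v (m + 1) (v powi (j * (2 * int n - 1))) (hat_Psi n v (k + int n * j) m X) \<and>
    commutator n v (- 1) (boson n v j) (hat_Phi_star n v k) m X
           = semi_scale n v (m - 1) (- (v powi (2 * j * int n))) (hat_Phi_star n v (k + int n * j) m X) \<and>
    commutator n v (- 1) (boson n v j) (hat_Psi_star n v k) m X
           = semi_scale n v (m - 1) (- (v powi (- j))) (hat_Psi_star n v (k + int n * j) m X)"
proof -
  interpret wedge_setup n v using assms(1-3) by unfold_locales auto
  obtain l w where w: "w \<in> ws l" and X: "X = canon n v m l w"
    using assms(5) by (rule semi_spaceE)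
  obtain i where j: "j = int i" and i: "i > 0" using assms(4) by (metis zero_less_imp_eq_int)
  have nj: "int n * j = int (n * i)" by (simp add: j)
  interpret Ph: charged_family n v "\<lambda>k m N w. basis [k] \<odot> w" "\<lambda>k m N. Phi n v N k" 1 "\<lambda>i. 1" "\<lambda>j. 0"
    by (rule Phi_family)
  interpret Ps: charged_family n v "\<lambda>k m N w. smul (\<nu> k m N) (w \<odot> basis [k])" "\<lambda>k m N. Psi_norm n v m N k" 1
    "\<lambda>i. v powi i" "\<lambda>j. (\<eta> j ^ 2 - 1) * v powi int j"
    by (rule Psi_family)
  interpret Fs: charged_family n v "\<lambda>k m N. Rf (- k)" "\<lambda>k m N. Phi_star_norm v N k" "- 1"
    "\<lambda>i. - 1" "\<lambda>j. 1 - v powi (2 * int n * int j)"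
    by (rule Phi_star_family)
  interpret Gs: charged_family n v "\<lambda>k m N w. smul (\<beta> k m N) (Rl (- k) w)" "\<lambda>k m N. Psi_star_norm n v m N k" "- 1"
    "\<lambda>i. - (v powi i)" "\<lambda>j. (1 - v powi (- 2 * int j)) * v powi int j"
    by (rule Psi_star_family)
  have hats: "Ph.hat = hat_Phi n v" "Ps.hat = hat_Psi n v" "Fs.hat = hat_Phi_star n v" "Gs.hat = hat_Psi_star n v"
    by (simp_all add: fun_eq_iff Ph.hat_def Ps.hat_def Fs.hat_def Gs.hat_def
        hat_Phi_def hat_Psi_def hat_Phi_star_def hat_Psi_star_def)
  \<comment> \<open>\<open>eta_sq\<close> gives the exponent 2(n - 1)j, and the shift of the
    normalisation adds j.\<close>
  have c1: "v powi j + (\<eta> i ^ 2 - 1) * v powi j = v powi (j * (2 * int n - 1))"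
  proof -
    have "v powi j + (\<eta> i ^ 2 - 1) * v powi j = v powi (2 * int (n - 1) * int i) * v powi int i"
      unfolding eta_sq j by (simp add: algebra_simps)
    also have "\<dots> = v powi (2 * int (n - 1) * int i + int i)" by (simp add: power_int_add)
    also have "2 * int (n - 1) * int i + int i = j * (2 * int n - 1)"
      using n_pos by (simp add: j of_nat_diff algebra_simps)
    finally show ?thesis .
  qed
  have c2: "- 1 + (1 - v powi (2 * int n * j)) = - (v powi (2 * j * int n))"
    by (simp add: j mult_ac)
  have c3: "- (v powi j) + (1 - v powi (- 2 * j)) * v powi j = - (v powi (- j))"
  proof -
    have "v powi (- 2 * int i) * v powi int i = v powi (- 2 * int i + int i)"
      by (rule power_int_add[symmetric]) (simp add: v_nonzero)
    then show ?thesis by (simp add: j left_diff_distrib)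
  qed
  have m: "m - 1 = m + - 1" by simp
  note lower = Ph.commutator_lower[OF w i] Ps.commutator_lower[OF w i]
    Fs.commutator_lower[OF w i] Gs.commutator_lower[OF w i]
  note raise = Ph.commutator_raise[OF w i] Ps.commutator_raise[OF w i]
    Fs.commutator_raise[OF w i] Gs.commutator_raise[OF w i]
  show ?thesis
    unfolding X m nj hats[symmetric]
    by (simp only: lower[folded j] raise[folded j] c1 c2 c3 add_0_right Ph.semi_scale_one_hat[OF w] simp_thms j[symmetric])
qed

end
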